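(* Let $m,n$ be positive integers such that $mn$ divides $24$. The morphism of Weber curves $\mathcal{W}_{mn}\to\mathcal{W}_n$ is the quotient by a subgroup of automorphisms in $\boldsymbol{\mu}_m^3$, isomorphic to $\Gamma_n/\Gamma_{mn}$. Moreover: (1) if $m=3$, then the automorphism group of the cover $\mathcal{W}_{mn}\to\mathcal{W}_n$ is $\Delta(\boldsymbol{\mu}_3)$; (2) if $m$ divides $8$, then the automorphism group of the cover $\mathcal{W}_{mn}\to\mathcal{W}_n$ is $\nabla(\boldsymbol{\mu}_m^2)$. In particular, the degree of $\mathcal{W}_{3n}\to\mathcal{W}_n$ is $3$, and if $m$ divides $8$, the degree of $\mathcal{W}_{mn}\to\mathcal{W}_n$ is $m^2$.
   Context: Write $\zeta_k=e^{2\pi i/k}$ and $\boldsymbol{\mu}_m=\langle\zeta_m\rangle$. Let $\eta$ be the Dedekind eta function and $$\mathfrak{f}(\tau)=\zeta_{48}^{-1}\frac{\eta\left(\frac{\tau+1}{2}\right)}{\eta(\tau)},\quad \mathfrak{f}_1(\tau)=\frac{\eta\left(\frac{\tau}{2}\right)}{\eta(\tau)},\quad \mathfrak{f}_2(\tau)=\sqrt2\,\frac{\eta(2\tau)}{\eta(\tau)},$$ $(\mathfrak{u}_0,\mathfrak{u}_1,\mathfrak{u}_2)=(\mathfrak{f},\zeta_{16}\mathfrak{f}_1,\zeta_{16}^{-1}\mathfrak{f}_2)$. For each divisor $N$ of $24$, the Weber curve $\mathcal{W}_N$ is the curve in $\mathbb{P}^3$ which is the image of $(\mathfrak{u}_0^{24/N}:\mathfrak{u}_1^{24/N}:\mathfrak{u}_2^{24/N}:1)$.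 Explicitly, for $k$ dividing $8$, $$\mathcal{W}_{3k}:\ X_0^k+X_1^k+X_2^k=0,\quad X_0X_1X_2=\sqrt2^{\,8/k}X_3^3,$$ $$\mathcal{W}_{k}:\ X_0^k+X_1^k+X_2^k=48X_3^k,\quad X_0X_1X_2=\sqrt8^{\,8/k}X_3^3.$$ The morphism $\mathcal{W}_{mn}\to\mathcal{W}_n$ is given on the affine part $X_3=1$ by $(x_0,x_1,x_2)\mapsto(x_0^m,x_1^m,x_2^m)$, so that it corresponds to the inclusion of the function field generated by the $\mathfrak{u}_i^{24/n}$ in that generated by the $\mathfrak{u}_i^{24/(mn)}$. For $N\mid 24$, $\Gamma_N\subset\mathrm{PSL}_2(\mathbb{Z})$ is the kernel of the action of $\mathrm{PSL}_2(\mathbb{Z})$ on the triple of functions, i.e. the group of all $g$ with $\mathfrak{u}_i^{24/N}\circ g=\mathfrak{u}_i^{24/N}$ for $i=0,1,2$; it is a normal congruence subgroup, and $\mathcal{W}_N$ is identified with the modular curve $X(\Gamma_N)$ (identification of smooth projective models / function fields), a Galois cover of $X(1)$ with group $\mathrm{PSL}_2(\mathbb{Z})/\Gamma_N$. The group $\boldsymbol{\mu}_m^3$ acts on $\mathbb{A}^3$ by coordinatewise multiplication. Its subgroups $\nabla$ and $\Delta$ are $$\nabla(\boldsymbol{\mu}_m^2)=\{(\zeta_m^i,\zeta_m^j,\zeta_m^{-i-j}) : i,j\in\mathbb{Z}/m\mathbb{Z}\},\qquad \Delta(\boldsymbol{\mu}_m)=\{(\zeta_m^i,\zeta_m^i,\zeta_m^i)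 : i\in\mathbb{Z}/m\mathbb{Z}\}.$$ *)

theory Defs
  imports "HOL-Analysis.Analysis" "HOL-Algebra.Embedded_Algebras" "HOL-Algebra.Bij"
begin

section \<open>Projective 3-space over the complex numbers\<close>

text \<open>Homogeneous coordinates are indexed by the four elements \<open>0, 1, 2, 3\<close> of the
  finite type \<open>4\<close> (in which \<open>4 = 0\<close>), so that the coordinates of \<open>v\<close> are
  \<open>v $ 0, \<dots>, v $ 3\<close>.\<close>

definition same_line :: "complex ^ 4 \<Rightarrow> complex ^ 4 \<Rightarrow> bool" where
  "same_line v w \<longleftrightarrow> v \<noteq> 0 \<and> w \<noteq> 0 \<and> (\<exists>c. c \<noteq> 0 \<and> w = c *s v)"

quotient_type P3 = "complex ^ 4" / partial: same_line
proof (rule part_equivpI)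
  have "same_line 1 1"
    by (auto simp: same_line_def intro!: exI[of _ 1])
  then show "\<exists>v. same_line v v" by blast
  show "symp same_line"
  proof (rule sympI)
    fix v w assume "same_line v w"
    then obtain c where c: "v \<noteq> 0" "w \<noteq> 0" "c \<noteq> 0" "w = c *s v"
      by (auto simp: same_line_def)
    then have "v = inverse c *s w" by simp
    with c show "same_line w v"
      unfolding same_line_def by (metis inverse_nonzero_iff_nonzero)
  qed
  show "transp same_line"
  proof (rule transpI)
    fix u v w assume "same_line u v" "same_line v w"
    then obtain c d where "u \<noteq> 0" "w \<noteq> 0" "c \<noteq> 0" "d \<noteq> 0" "w = (d * c) *s u"
      by (auto simp: same_line_def)
    then show "same_line u w"
      unfolding same_line_def by (metis mult_eq_0_iff)
  qed
qed

definition hcoords :: "complex \<Rightarrow> complex \<Rightarrow> complex \<Rightarrow> complex \<Rightarrow> complex ^ 4" where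
  "hcoords a b c d = (\<chi> i. if i = 0 then a else if i = 1 then b else if i = 2 then c else d)"

text \<open>Homogeneous polynomials are represented by the functions they define, which is faithful
  over the infinite field of complex numbers. The zero polynomial is homogeneous of every
  degree.\<close>

inductive hpoly :: "nat \<Rightarrow> (complex ^ 4 \<Rightarrow> complex) \<Rightarrow> bool" where
  hpoly_const: "hpoly 0 (\<lambda>v. c)"
| hpoly_zero: "hpoly d (\<lambda>v. 0)"
| hpoly_coord: "hpoly 1 (\<lambda>v. v $ i)"
| hpoly_add: "hpoly d p \<Longrightarrow> hpoly d q \<Longrightarrow> hpoly d (\<lambda>v. p v + q v)"
| hpoly_mult: "hpoly d p \<Longrightarrow> hpoly e q \<Longrightarrow> hpoly (d + e) (\<lambda>v. p v * q v)"

text \<open>Here and below, \<open>rep_P3 x\<close> is an arbitrary (nonzero) vector of homogeneous coordinates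
  of \<open>x\<close>. All conditions in which it occurs are homogeneous, hence independent of its choice.\<close>

definition zariski_closure :: "P3 set \<Rightarrow> P3 set" where
  "zariski_closure S =
     {x. \<forall>d p. hpoly d p \<longrightarrow> (\<forall>y\<in>S. p (rep_P3 y) = 0) \<longrightarrow> p (rep_P3 x) = 0}"

text \<open>The requirement below that the local expression \<open>F\<close> be valid wherever \<open>F\<close> does not vanish
  is no restriction: an expression valid on a Zariski neighbourhood of \<open>x\<close> can be multiplied by
  a form that vanishes outside this neighbourhood, but not at \<open>x\<close>.\<close>

definition is_morphism :: "P3 set \<Rightarrow> P3 set \<Rightarrow> (P3 \<Rightarrow> P3) \<Rightarrow> bool" where
  "is_morphism X Y f \<longleftrightarrow> f ` X \<subseteq> Y \<and>
     (\<forall>x\<in>X. \<exists>d F. (\<forall>i. hpoly d (\<lambda>v. F v $ i)) \<and> F (rep_P3 x) \<noteq> 0 \<and>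
        (\<forall>y\<in>X. F (rep_P3 y) \<noteq> 0 \<longrightarrow> f y = abs_P3 (F (rep_P3 y))))"


section \<open>Function fields\<close>

text \<open>The function field of an irreducible projective variety \<open>X\<close>, as the homogeneous
  localisation of its coordinate ring at the zero ideal: its elements are the classes of
  fractions \<open>p / q\<close> of forms of the same degree, with \<open>q\<close> not identically zero on \<open>X\<close>.\<close>

type_synonym ratfun = "((complex ^ 4 \<Rightarrow> complex) \<times> (complex ^ 4 \<Rightarrow> complex)) set"

definition fractions :: "P3 set \<Rightarrow> ratfun" where
  "fractions X = {(p, q). \<exists>d. hpoly d p \<and> hpoly d q \<and> (\<exists>x\<in>X. q (rep_P3 x) \<noteq> 0)}"

definition frac_class ::
  "P3 set \<Rightarrow> (complex ^ 4 \<Rightarrow> complex) \<Rightarrow> (complex ^ 4 \<Rightarrow> complex) \<Rightarrow> ratfun" where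
  "frac_class X p q = {(p', q') \<in> fractions X.
     \<forall>x\<in>X. p (rep_P3 x) * q' (rep_P3 x) = p' (rep_P3 x) * q (rep_P3 x)}"

definition function_field :: "P3 set \<Rightarrow> ratfun ring" where
  "function_field X =
    \<lparr>carrier = {frac_class X p q | p q. (p, q) \<in> fractions X},
     mult = (\<lambda>A B. \<Union>(p, q)\<in>A. \<Union>(p', q')\<in>B.
               frac_class X (\<lambda>v. p v * p' v) (\<lambda>v. q v * q' v)),
     one = frac_class X (\<lambda>v. 1) (\<lambda>v. 1),
     zero = frac_class X (\<lambda>v. 0) (\<lambda>v. 1),
     add = (\<lambda>A B. \<Union>(p, q)\<in>A. \<Union>(p', q')\<in>B.
              frac_class X (\<lambda>v. p v * q' v + p' v * q v) (\<lambda>v. q v * q' v))\<rparr>"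

text \<open>\<open>pullback X f A\<close> is the class of the rational function \<open>A \<circ> f\<close> on \<open>X\<close>,
  for a dominant morphism \<open>f\<close> with source \<open>X\<close>.\<close>

definition pullback :: "P3 set \<Rightarrow> (P3 \<Rightarrow> P3) \<Rightarrow> ratfun \<Rightarrow> ratfun" where
  "pullback X f A = {(p', q') \<in> fractions X. \<forall>(p, q)\<in>A. \<forall>x\<in>X.
     p (rep_P3 (f x)) * q' (rep_P3 x) = p' (rep_P3 x) * q (rep_P3 (f x))}"

definition pulled_back_field :: "P3 set \<Rightarrow> P3 set \<Rightarrow> (P3 \<Rightarrow> P3) \<Rightarrow> ratfun set" where
  "pulled_back_field X Y \<pi> = pullback X \<pi> ` carrier (function_field Y)"

definition has_degree :: "P3 set \<Rightarrow> P3 set \<Rightarrow> (P3 \<Rightarrow> P3) \<Rightarrow> nat \<Rightarrow> bool" where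
  "has_degree X Y \<pi> d \<longleftrightarrow>
     ring.dimension (function_field X) d (pulled_back_field X Y \<pi>) (carrier (function_field X))"


section \<open>Automorphisms and quotients\<close>

definition aut_group :: "P3 set \<Rightarrow> (P3 \<Rightarrow> P3) monoid" where
  "aut_group X = BijGroup X
     \<lparr>carrier := {\<sigma> \<in> Bij X. is_morphism X X \<sigma> \<and> is_morphism X X (inv_into X \<sigma>)}\<rparr>"

definition cover_aut_group :: "P3 set \<Rightarrow> (P3 \<Rightarrow> P3) \<Rightarrow> (P3 \<Rightarrow> P3) monoid" where
  "cover_aut_group X \<pi> = aut_group X
     \<lparr>carrier := {\<sigma> \<in> carrier (aut_group X). \<forall>x\<in>X. \<pi> (\<sigma> x) = \<pi> x}\<rparr>"

text \<open>Automorphisms of the function field of \<open>X\<close> over that of \<open>Y\<close>. For curves, these are the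
  automorphisms of the cover of smooth projective models (composed in the opposite order).\<close>

definition cover_galois_group ::
  "P3 set \<Rightarrow> P3 set \<Rightarrow> (P3 \<Rightarrow> P3) \<Rightarrow> (ratfun \<Rightarrow> ratfun) monoid" where
  "cover_galois_group X Y \<pi> = BijGroup (carrier (function_field X))
     \<lparr>carrier := {\<sigma> \<in> Bij (carrier (function_field X)).
        \<sigma> \<in> ring_iso (function_field X) (function_field X) \<and>
        (\<forall>A\<in>pulled_back_field X Y \<pi>. \<sigma> A = A)}\<rparr>"

text \<open>Quotients of curves are taken in the sense of smooth projective models: the function field
  of the quotient is the field of invariants. A set-theoretic condition on fibres would be wrong
  here, since the curve \<open>Y\<close> may be singular, in which case the fibre over a node can consist of
  several orbits.\<close>

definition is_quotient_by :: "P3 set \<Rightarrow> P3 set \<Rightarrow> (P3 \<Rightarrow> P3) \<Rightarrow> (P3 \<Rightarrow> P3) set \<Rightarrow> bool" where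
  "is_quotient_by X Y \<pi> S \<longleftrightarrow>
     is_morphism X Y \<pi> \<and> Y \<subseteq> zariski_closure (\<pi> ` X) \<and>
     finite S \<and> subgroup S (aut_group X) \<and>
     (\<forall>\<sigma>\<in>S. \<forall>x\<in>X. \<pi> (\<sigma> x) = \<pi> x) \<and>
     pulled_back_field X Y \<pi> =
       {A \<in> carrier (function_field X). \<forall>\<sigma>\<in>S. pullback X \<sigma> A = A}"


section \<open>Groups of roots of unity\<close>

definition \<zeta> :: "nat \<Rightarrow> complex" where
  "\<zeta> k = exp (2 * of_real pi * \<i> / of_nat k)"

definition mu :: "nat \<Rightarrow> complex monoid" where
  "mu m = \<lparr>carrier = range (\<lambda>i::int. \<zeta> m powi i), mult = (*), one = 1\<rparr>"

definition mu3 :: "nat \<Rightarrow> (complex \<times> complex \<times> complex) monoid" where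
  "mu3 m = mu m \<times>\<times> mu m \<times>\<times> mu m"

definition nabla :: "nat \<Rightarrow> (complex \<times> complex \<times> complex) set" where
  "nabla m = {(\<zeta> m powi i, \<zeta> m powi j, \<zeta> m powi (- i - j)) | i j :: int. True}"

definition diagonal :: "nat \<Rightarrow> (complex \<times> complex \<times> complex) set" where
  "diagonal m = {(\<zeta> m powi i, \<zeta> m powi i, \<zeta> m powi i) | i :: int. True}"

text \<open>The extension to \<open>P3\<close> of coordinatewise multiplication on the affine part \<open>X\<^sub>3 = 1\<close>.\<close>

fun torus_act :: "complex \<times> complex \<times> complex \<Rightarrow> P3 \<Rightarrow> P3" where
  "torus_act (a, b, c) x =
     (let v = rep_P3 x in abs_P3 (hcoords (a * v $ 0) (b * v $ 1) (c * v $ 2) (v $ 3)))"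

definition torus_aut :: "P3 set \<Rightarrow> complex \<times> complex \<times> complex \<Rightarrow> P3 \<Rightarrow> P3" where
  "torus_aut X g = restrict (torus_act g) X"

definition torus_field_aut ::
  "P3 set \<Rightarrow> complex \<times> complex \<times> complex \<Rightarrow> ratfun \<Rightarrow> ratfun" where
  "torus_field_aut X g = restrict (pullback X (torus_act g)) (carrier (function_field X))"


section \<open>Weber functions and Weber curves\<close>

definition upper_half_plane :: "complex set" where
  "upper_half_plane = {\<tau>. Im \<tau> > 0}"

definition eta :: "complex \<Rightarrow> complex" where
  "eta \<tau> = exp (2 * of_real pi * \<i> * \<tau> / 24) *
     (\<Prod>k. 1 - exp (2 * of_real pi * \<i> * \<tau>) ^ Suc k)"

definition weber_f :: "complex \<Rightarrow> complex" where
  "weber_f \<tau> = inverse (\<zeta> 48) * (eta ((\<tau> + 1) / 2) / eta \<tau>)"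

definition weber_f1 :: "complex \<Rightarrow> complex" where
  "weber_f1 \<tau> = eta (\<tau> / 2) / eta \<tau>"

definition weber_f2 :: "complex \<Rightarrow> complex" where
  "weber_f2 \<tau> = of_real (sqrt 2) * (eta (2 * \<tau>) / eta \<tau>)"

definition u0 :: "complex \<Rightarrow> complex" where "u0 = weber_f"
definition u1 :: "complex \<Rightarrow> complex" where "u1 \<tau> = \<zeta> 16 * weber_f1 \<tau>"
definition u2 :: "complex \<Rightarrow> complex" where "u2 \<tau> = inverse (\<zeta> 16) * weber_f2 \<tau>"

definition weber_point :: "nat \<Rightarrow> complex \<Rightarrow> P3" where
  "weber_point N \<tau> =
     abs_P3 (hcoords (u0 \<tau> ^ (24 div N)) (u1 \<tau> ^ (24 div N)) (u2 \<tau> ^ (24 div N)) 1)"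

text \<open>The image of the upper half plane misses the finitely many cusps; taking the Zariski
  closure adds them.\<close>

definition weber_curve :: "nat \<Rightarrow> P3 set" where
  "weber_curve N = zariski_closure (weber_point N ` upper_half_plane)"

definition weber_map :: "nat \<Rightarrow> P3 \<Rightarrow> P3" where
  "weber_map m x = abs_P3 (\<chi> i. rep_P3 x $ i ^ m)"


section \<open>The modular groups\<close>

definition SL2Z :: "(int ^ 2 ^ 2) monoid" where
  "SL2Z = \<lparr>carrier = {A. det A = 1}, mult = (**), one = mat 1\<rparr>"

definition PSL2Z :: "(int ^ 2 ^ 2) set monoid" where
  "PSL2Z = SL2Z Mod {mat 1, - mat 1}"

definition moebius_act :: "int ^ 2 ^ 2 \<Rightarrow> complex \<Rightarrow> complex" where
  "moebius_act A \<tau> = (of_int (A $ 1 $ 1) * \<tau> + of_int (A $ 1 $ 2)) /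
                     (of_int (A $ 2 $ 1) * \<tau> + of_int (A $ 2 $ 2))"

text \<open>The elements of \<open>PSL2Z\<close> are the cosets \<open>{A, - A}\<close>, both of whose members induce the same
  transformation.\<close>

definition Gamma_weber :: "nat \<Rightarrow> (int ^ 2 ^ 2) set set" where
  "Gamma_weber N = {g \<in> carrier PSL2Z. \<forall>A\<in>g. \<forall>\<tau>\<in>upper_half_plane. \<forall>u\<in>{u0, u1, u2}.
     u (moebius_act A \<tau>) ^ (24 div N) = u \<tau> ^ (24 div N)}"

end

theory Submission
  imports Defs "HOL-Complex_Analysis.Complex_Analysis" "HOL-Computational_Algebra.Fraction_Field"
begin

text \<open>The function field of the \<open>N\<close>-th Weber curve is the subfield of the fraction field of the
  holomorphic functions on the upper half plane that is generated over \<open>\<complex>\<close> by the powers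
  \<open>u\<^sub>i\<^bsup>24/N\<^esup>\<close>. An element of \<open>\<Gamma>\<^sub>n\<close> fixes the \<open>m\<close>-th powers of the generators for \<open>N = m n\<close>, so
  it multiplies these generators by constant \<open>m\<close>-th roots of unity, which embeds
  \<open>\<Gamma>\<^sub>n/\<Gamma>\<^bsub>mn\<^esub>\<close> into \<open>\<mu>\<^sub>m\<^sup>3\<close>. Translations \<open>(1 2k; 0 1)\<close> and their conjugates by the inversion provide all
  of \<open>\<nabla>\<close> or \<open>\<Delta>\<close>; conversely, \<open>u\<^sub>0 u\<^sub>1 u\<^sub>2 = sqrt 2\<close> and \<open>u\<^sub>0\<^sup>8 + u\<^sub>1\<^sup>8 + u\<^sub>2\<^sup>8 = 0\<close> leave no
  room for more. The fixed field and the degree follow from Kummer theory. The behaviour of the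
  Weber functions under \<open>\<tau> \<mapsto> - 1/\<tau>\<close> and the second relation (Jacobi's identity) are obtained from
  Liouville's theorem, which determines a theta function by its quasi-periodicity in \<open>z\<close>.\<close>

subsection \<open>The q-Pochhammer symbol\<close>

text \<open>A Weber curve is accessible only as the Zariski closure of a holomorphic image of the
  upper half plane, so a form vanishes on it exactly when its restriction to the half plane is zero.
  This turns questions about a possibly singular curve into questions about functions of \<tau>.
  Every matrix acts on all of \<open>mero\<close>, and the degree is bounded below by such actions:
  they provide the homomorphisms of Kummer theory. The delicate case is m = 3. The product relation
  alone would allow the group of order 9 of triples with product 1, and two independent cube roots
  over \<open>KK n\<close>; Jacobi's relation ties them together and leaves only one. The difference
  between 3 and the divisors of 8 is already visible in the weights -1, -1, 2 of the translation by
  2, which agree modulo 3 but not modulo 8. Two kinds of automorphism, regular maps of the closure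
  and automorphisms of its function field, are both reduced to one condition on a triple of roots of
  unity, \<open>compatible\<close>.\<close>

definition qpoch :: "complex \<Rightarrow> complex \<Rightarrow> complex" where
  "qpoch a x = (\<Prod>k. 1 - a * x ^ k)"

lemma summable_qpoch: "norm x < 1 \<Longrightarrow> summable (\<lambda>k. norm (a * x ^ k))" for a x :: complex
  by (simp add: norm_mult norm_power summable_mult)

lemma convergent_qpoch: "norm x < 1 \<Longrightarrow> convergent_prod (\<lambda>k. 1 - a * x ^ k)" for a x :: complex
  using summable_qpoch[of x a]
  by (intro abs_convergent_prod_imp_convergent_prod summable_imp_abs_convergent_prod) simp

lemma qpoch_LIMSEQ: "norm x < 1 \<Longrightarrow> (\<lambda>n. \<Prod>k<n. 1 - a * x ^ k) \<longlonglongrightarrow> qpoch a x"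
  unfolding qpoch_def
  by (simp only: LIMSEQ_lessThan_iff_atMost) (intro convergent_prod_LIMSEQ convergent_qpoch)

text \<open>Splitting off the factor k = 0. This functional equation is the source of the
  quasi-periodicity of \<open>theta\<close>.\<close>

lemma qpoch_rec:
  assumes "norm x < 1"
  shows "qpoch a x = (1 - a) * qpoch (a * x) x"
proof -
  have "(\<lambda>n. \<Prod>k<Suc n. 1 - a * x ^ k) \<longlonglongrightarrow> qpoch a x"
    using qpoch_LIMSEQ[OF assms] LIMSEQ_Suc by blast
  moreover have "(\<Prod>k<Suc n. 1 - a * x ^ k) = (1 - a) * (\<Prod>k<n. 1 - a * x * x ^ k)" for n
    by (simp only: prod.lessThan_Suc_shift) (simp add: mult.assoc)
  moreover have "(\<lambda>n. (1 - a) * (\<Prod>k<n. 1 - a * x * x ^ k)) \<longlonglongrightarrow> (1 - a) * qpoch (a * x) x"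
    by (intro tendsto_intros qpoch_LIMSEQ assms)
  ultimately show ?thesis using LIMSEQ_unique by simp
qed

text \<open>Factors of even and of odd index are collected separately. For a = x the second product
  is Euler's product in x^2, the factor that cancels in quotients of eta functions.\<close>

lemma qpoch_split:
  assumes "norm x < 1"
  shows "qpoch a x = qpoch a (x\<^sup>2) * qpoch (a * x) (x\<^sup>2)"
proof -
  have x2: "norm (x\<^sup>2) < 1" using assms by (simp add: norm_power power_less_one_iff)
  have eq: "(\<Prod>k<2*n. 1 - a * x ^ k) =
      (\<Prod>k<n. 1 - a * (x\<^sup>2) ^ k) * (\<Prod>k<n. 1 - a * x * (x\<^sup>2) ^ k)" for n
    by (induction n) (simp_all add: power_mult [symmetric] mult_ac)
  have "(\<lambda>n. \<Prod>k<2*n. 1 - a * x ^ k) \<longlonglongrightarrow> qpoch a x"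
    using LIMSEQ_subseq_LIMSEQ[OF qpoch_LIMSEQ[OF assms], of "\<lambda>n. 2 * n"]
    by (simp add: strict_mono_def o_def)
  moreover have "(\<lambda>n. \<Prod>k<2*n. 1 - a * x ^ k) \<longlonglongrightarrow> qpoch a (x\<^sup>2) * qpoch (a * x) (x\<^sup>2)"
    unfolding eq by (intro tendsto_intros qpoch_LIMSEQ x2)
  ultimately show ?thesis using LIMSEQ_unique by blast
qed

text \<open>Factor by factor this is (1 - y)(1 + y) = 1 - y^2.\<close>

lemma qpoch_mult_minus:
  assumes "norm x < 1"
  shows "qpoch a x * qpoch (- a) x = qpoch (a\<^sup>2) (x\<^sup>2)"
proof -
  have x2: "norm (x\<^sup>2) < 1" using assms by (simp add: norm_power power_less_one_iff)
  have "(1 - a * x ^ k) * (1 - (-a) * x ^ k) = 1 - a\<^sup>2 * (x\<^sup>2) ^ k" for k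
    by (simp add: algebra_simps power2_eq_square power_mult_distrib)
  then have "(\<lambda>n. (\<Prod>k<n. 1 - a * x ^ k) * (\<Prod>k<n. 1 - (-a) * x ^ k)) =
      (\<lambda>n. \<Prod>k<n. 1 - a\<^sup>2 * (x\<^sup>2) ^ k)"
    by (simp only: prod.distrib [symmetric])
  moreover have "(\<lambda>n. (\<Prod>k<n. 1 - a * x ^ k) * (\<Prod>k<n. 1 - (-a) * x ^ k)) \<longlonglongrightarrow> qpoch a x * qpoch (-a) x"
    by (intro tendsto_intros qpoch_LIMSEQ assms)
  ultimately show ?thesis using LIMSEQ_unique qpoch_LIMSEQ[OF x2] by metis
qed

lemma qpoch_nonzero:
  assumes "norm x < 1" "norm a < 1"
  shows "qpoch a x \<noteq> 0"
  unfolding qpoch_def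
proof (rule prodinf_nonzero)
  fix k
  have "norm (a * x ^ k) \<le> norm a * 1"
    unfolding norm_mult norm_power using assms by (intro mult_left_mono power_le_one) auto
  then have "norm (a * x ^ k) < 1" using assms by simp
  then show "1 - a * x ^ k \<noteq> 0" by auto
qed (rule convergent_qpoch[OF assms(1)])

lemma qpoch_1 [simp]:
  assumes "norm x < 1"
  shows "qpoch 1 x = 0"
  using qpoch_rec[OF assms, of 1] by simp

text \<open>Both arguments are allowed to vary: theta functions need holomorphy in the first one,
  Weber functions in both together. The partial products converge uniformly on small closed
  discs.\<close>

lemma holomorphic_qpoch [holomorphic_intros]:
  assumes g: "g holomorphic_on S" and h: "h holomorphic_on S" and S: "open S"
    and lt: "\<And>z. z \<in> S \<Longrightarrow> norm (h z) < 1"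
  shows "(\<lambda>z. qpoch (g z) (h z)) holomorphic_on S"
proof (rule holomorphic_uniform_sequence[where f = "\<lambda>n z. \<Prod>k<n. 1 - g z * h z ^ k", OF S])
  show "(\<lambda>z. \<Prod>k<n. 1 - g z * h z ^ k) holomorphic_on S" for n
    by (intro holomorphic_intros g h)
  fix x assume "x \<in> S"
  then obtain d where d: "d > 0" "cball x d \<subseteq> S" using S open_contains_cball by blast
  have cg: "continuous_on (cball x d) g" and ch: "continuous_on (cball x d) h"
    using g h d holomorphic_on_imp_continuous_on continuous_on_subset by blast+
  obtain B where B: "\<And>z. z \<in> cball x d \<Longrightarrow> norm (g z) \<le> B"
    using compact_imp_bounded[OF compact_continuous_image[OF cg compact_cball]]
    by (auto simp: bounded_iff simp del: mem_cball)
  \<comment> \<open>The maximum of |h| over the closed disc is attained and hence still less than 1;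
    it is the ratio of the geometric majorant.\<close>
  obtain y where y: "y \<in> cball x d" "\<And>z. z \<in> cball x d \<Longrightarrow> norm (h z) \<le> norm (h y)"
    using continuous_attains_sup[OF compact_cball _ continuous_on_norm[OF ch]] d
    by (metis cball_eq_empty not_less_iff_gr_or_eq)
  have r: "norm (h y) < 1" using lt y d by auto
  have B0: "0 \<le> B" using B[of x] d norm_ge_zero order_trans by (metis centre_in_cball less_imp_le)
  have "uniformly_convergent_on (cball x d) (\<lambda>N z. \<Sum>k<N. norm (- (g z * h z ^ k)))"
  proof (rule Weierstrass_m_test'[where M = "\<lambda>k. B * norm (h y) ^ k"])
    show "summable (\<lambda>k. B * norm (h y) ^ k)" using r by (intro summable_mult) simp
    show "norm (norm (- (g z * h z ^ k))) \<le> B * norm (h y) ^ k" if "z \<in> cball x d" for k z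
      using B[OF that] y(2)[OF that] B0 by (simp add: norm_mult norm_power mult_mono power_mono)
  qed
  then have "uniformly_convergent_on (cball x d) (\<lambda>N z. \<Prod>k<N. 1 + - (g z * h z ^ k))"
    by (intro uniformly_convergent_on_prod continuous_intros cg ch) auto
  then have "uniformly_convergent_on (cball x d) (\<lambda>N z. \<Prod>k<N. 1 - g z * h z ^ k)" by simp
  then obtain l where l: "uniform_limit (cball x d) (\<lambda>N z. \<Prod>k<N. 1 - g z * h z ^ k) l sequentially"
    by (auto simp: uniformly_convergent_on_def)
  have "l z = qpoch (g z) (h z)" if "z \<in> cball x d" for z
    using tendsto_uniform_limitI[OF l that] qpoch_LIMSEQ[of "h z" "g z"] lt d that LIMSEQ_unique by blast
  then have "uniform_limit (cball x d) (\<lambda>N z. \<Prod>k<N. 1 - g z * h z ^ k) (\<lambda>z. qpoch (g z) (h z)) sequentially"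
    using l uniform_limit_cong' by (smt (verit, ccfv_SIG))
  with d show "\<exists>d>0. cball x d \<subseteq> S \<and>
      uniform_limit (cball x d) (\<lambda>n z. \<Prod>k<n. 1 - g z * h z ^ k) (\<lambda>z. qpoch (g z) (h z)) sequentially"
    by blast
qed

subsection \<open>Theta functions\<close>

lemma holomorphic_mult_eq_0:
  assumes "f holomorphic_on S" "g holomorphic_on S" "open S" "connected S"
    and eq: "\<And>z. z \<in> S \<Longrightarrow> f z * g z = 0"
  shows "(\<forall>z\<in>S. f z = 0) \<or> (\<forall>z\<in>S. g z = 0)"
proof (rule disjCI)
  assume "\<not> (\<forall>z\<in>S. g z = 0)"
  then obtain a where a: "a \<in> S" "g a \<noteq> 0" by blast
  define U where "U = {z \<in> S. g z \<noteq> 0}"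
  have "U = S \<inter> g -` (- {0})" by (auto simp: U_def)
  then have "open U"
    using holomorphic_on_imp_continuous_on[OF assms(2)] assms(3)
    by (metis continuous_on_open_vimage open_Compl closed_singleton Int_commute)
  moreover have "f z = 0" if "z \<in> U" for z using eq[of z] that by (simp add: U_def)
  ultimately show "\<forall>z\<in>S. f z = 0"
    using analytic_continuation_open[of U S f "\<lambda>_. 0"] assms a by (auto simp: U_def)
qed

lemma entire_compose:
  assumes "f holomorphic_on UNIV" "g holomorphic_on S"
  shows "(\<lambda>z. f (g z)) holomorphic_on S"
  using holomorphic_on_compose_gen[OF assms(2,1)] by (simp add: o_def)

text \<open>Near a simple zero a of \<open>P\<close>, the quotient F / P is a quotient of two
  difference quotients at a, both holomorphic because their singularity is removable.\<close>

lemma holomorphic_quotient: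
  assumes F: "F holomorphic_on UNIV" and P: "P holomorphic_on UNIV"
    and zero: "\<And>z. P z = 0 \<Longrightarrow> F z = 0 \<and> deriv P z \<noteq> 0"
  shows "\<exists>h. h holomorphic_on UNIV \<and> (\<forall>z. F z = h z * P z)"
proof -
  define h where "h z = (if P z = 0 then deriv F z / deriv P z else F z / P z)" for z
  define F1 where "F1 a z = (if z = a then deriv F a else (F z - F a) / (z - a))" for a z
  define P1 where "P1 a z = (if z = a then deriv P a else (P z - P a) / (z - a))" for a z
  have F1: "F1 a holomorphic_on UNIV" for a
    using pole_lemma[OF F, of a] by (simp add: F1_def [abs_def])
  have P1: "P1 a holomorphic_on UNIV" for a
    using pole_lemma[OF P, of a] by (simp add: P1_def [abs_def])
  \<comment> \<open>An open neighbourhood of a on which one of the two expressions for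
    \<open>h\<close> has a denominator without zeros.\<close>
  define U where "U a = (if P a = 0 then {z. P1 a z \<noteq> 0} else {z. P z \<noteq> 0})" for a
  have open_nz: "open {z. g z \<noteq> 0}" if "g holomorphic_on UNIV" for g :: "complex \<Rightarrow> complex"
    using holomorphic_on_imp_continuous_on[OF that] by (intro open_Collect_neq continuous_intros)
  have "h holomorphic_on (\<Union>a. U a)"
  proof (rule holomorphic_on_UN_open)
    show "open (U a)" for a by (simp add: U_def open_nz P P1)
    show "h holomorphic_on U a" for a
    proof (cases "P a = 0")
      case True
      have "(\<lambda>z. F1 a z / P1 a z) holomorphic_on U a"
        using F1 P1 by (intro holomorphic_on_divide) (auto simp: U_def True intro: holomorphic_on_subset)
      moreover have "F1 a z / P1 a z = h z" if "z \<in> U a" for z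
        using that zero[OF True] True by (auto simp: h_def U_def F1_def P1_def)
      ultimately show ?thesis by (rule holomorphic_transform)
    next
      case False
      have "(\<lambda>z. F z / P z) holomorphic_on U a"
        using F P by (intro holomorphic_on_divide) (auto simp: U_def False intro: holomorphic_on_subset)
      then show ?thesis by (rule holomorphic_transform) (auto simp: U_def False h_def)
    qed
  qed
  moreover have "a \<in> U a" for a using zero[of a] by (auto simp: U_def P1_def)
  then have "(\<Union>a. U a) = UNIV" by auto
  moreover have "F z = h z * P z" for z using zero[of z] by (simp add: h_def)
  ultimately show ?thesis by metis
qed

text \<open>Every value is already attained on a compact period parallelogram, so \<open>h\<close>
  is bounded and Liouville's theorem applies.\<close>

lemma doubly_periodic_constant:
  assumes h: "h holomorphic_on UNIV" and \<tau>: "Im \<tau> > 0"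
    and p1: "\<And>z. h (z + 1) = h z" and p2: "\<And>z. h (z + \<tau>) = h z"
  shows "\<exists>c. \<forall>z. h z = c"
proof -
  have int1: "h (z + of_int a) = h z" for z a
  proof (induction a rule: int_induct[where k = 0])
    case (step1 i)
    then show ?case using p1[of "z + of_int i"] by (simp add: add.assoc)
  next
    case (step2 i)
    then show ?case using p1[of "z + of_int (i - 1)"] by (simp add: add.assoc)
  qed simp
  have int2: "h (z + of_int a * \<tau>) = h z" for z a
  proof (induction a rule: int_induct[where k = 0])
    case (step1 i)
    then show ?case using p2[of "z + of_int i * \<tau>"] by (simp add: algebra_simps)
  next
    case (step2 i)
    then show ?case using p2[of "z + of_int (i - 1) * \<tau>"] by (simp add: algebra_simps)
  qed simp
  define K where "K = (\<lambda>(x, y). of_real x + of_real y * \<tau>) ` ({0..1} \<times> {0..1::real})"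
  have "compact K" unfolding K_def
    by (intro compact_continuous_image compact_Times compact_Icc)
      (auto simp: case_prod_unfold intro!: continuous_intros)
  then have "bounded (h ` K)"
    by (meson compact_continuous_image compact_imp_bounded continuous_on_subset h
        holomorphic_on_imp_continuous_on top_greatest)
  moreover have "range h \<subseteq> h ` K"
  proof safe
    fix z
    define y where "y = Im z / Im \<tau>"
    define x where "x = Re z - y * Re \<tau>"
    have z: "z = of_real x + of_real y * \<tau>" using \<tau> by (simp add: complex_eq_iff x_def y_def)
    have "of_real (frac x) + of_real (frac y) * \<tau> \<in> K"
      by (auto simp: K_def frac_lt_1 less_imp_le)
    moreover have "h z = h (of_real (frac x) + of_real (frac y) * \<tau> + of_int \<lfloor>x\<rfloor> + of_int \<lfloor>y\<rfloor> * \<tau>)"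
      unfolding z frac_def by (simp add: algebra_simps)
    then have "h z = h (of_real (frac x) + of_real (frac y) * \<tau>)" by (simp only: int1 int2)
    ultimately show "h z \<in> h ` K" by blast
  qed
  ultimately have "bounded (range h)" using bounded_subset by blast
  with Liouville_theorem[OF h] show ?thesis by (auto simp: constant_on_def)
qed

text \<open>Nomes, roots of unity and automorphy factors all become values of this one character, so
  that identities between them reduce to linear identities between arguments.\<close>

definition ee :: "complex \<Rightarrow> complex" where
  "ee z = exp (2 * of_real pi * \<i> * z)"

lemma ee_add: "ee (a + b) = ee a * ee b"
  by (simp add: ee_def ring_distribs exp_add)

lemma ee_minus: "ee (- a) = inverse (ee a)"
  by (simp add: ee_def exp_minus)

lemma ee_diff: "ee (a - b) = ee a / ee b"
  by (simp add: ee_def ring_distribs exp_diff)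

lemma ee_nonzero [simp]: "ee a \<noteq> 0"
  by (simp add: ee_def)

lemma ee_of_int [simp]: "ee (of_int n) = 1"
  using exp_integer_2pi[of "of_int n"] by (simp add: ee_def mult_ac)

lemma ee_simps [simp]: "ee 0 = 1" "ee 1 = 1" "ee (1 / 2) = - 1"
  using ee_of_int[of 1] by (simp_all add: ee_def)

lemma ee_power: "ee a ^ k = ee (of_nat k * a)"
  by (simp add: ee_def exp_of_nat_mult [symmetric] mult_ac)

lemma ee_powi: "ee a powi k = ee (of_int k * a)"
proof (cases "k \<ge> 0")
  case True
  then show ?thesis using ee_power[of a "nat k"] by (simp add: power_int_def)
next
  case False
  then have "ee a powi k = inverse (ee (of_nat (nat (- k)) * a))"
    by (simp add: power_int_def ee_power power_inverse)
  also have "\<dots> = ee (of_int k * a)" using False by (simp add: ee_minus [symmetric])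
  finally show ?thesis .
qed

lemma ee_eq_1D:
  assumes "ee z = 1" obtains n :: int where "z = of_int n"
proof -
  from assms obtain n :: int where "Im (2 * of_real pi * \<i> * z) = of_int (2 * n) * pi"
     "Re (2 * of_real pi * \<i> * z) = 0"
    by (auto simp: exp_eq_1 ee_def)
  then have "z = of_int n" by (auto simp: complex_eq_iff)
  then show ?thesis using that by blast
qed

lemma norm_ee: "norm (ee z) = exp (- 2 * pi * Im z)"
  by (simp add: ee_def)

lemma holomorphic_ee [holomorphic_intros]: "f holomorphic_on S \<Longrightarrow> (\<lambda>z. ee (f z)) holomorphic_on S"
  unfolding ee_def by (intro holomorphic_intros)

lemma DERIV_ee: "(ee has_field_derivative ee z * (2 * of_real pi * \<i>)) (at z)"
  unfolding ee_def[abs_def] by (rule DERIV_chain2[OF DERIV_exp DERIV_cmult_Id])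

text \<open>By the triple product identity this is the theta series with terms exp (pi i n^2 \<tau>
  + 2 pi i n z), divided by Euler's product. In product form the zeros can be read off from the
  factors.\<close>

definition theta :: "complex \<Rightarrow> complex \<Rightarrow> complex" where
  "theta \<tau> z = qpoch (- (ee (\<tau> / 2) * ee z)) (ee \<tau>) * qpoch (- (ee (\<tau> / 2) * ee (- z))) (ee \<tau>)"

section \<open>Quasi-periodicity and zeros of the theta function\<close>

context
  fixes \<tau> :: complex
  assumes \<tau>: "Im \<tau> > 0"
begin

lemma norm_nome: "norm (ee \<tau>) < 1" "norm (ee (\<tau> / 2)) < 1"
  using \<tau> by (simp_all add: norm_ee)

lemma holomorphic_theta: "theta \<tau> holomorphic_on S"
  unfolding theta_def[abs_def]
  by (rule holomorphic_on_subset[of _ UNIV]) (intro holomorphic_intros norm_nome open_UNIV subset_UNIV)+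

lemma theta_minus: "theta \<tau> (- z) = theta \<tau> z"
  by (simp add: theta_def)

lemma theta_plus_1: "theta \<tau> (z + 1) = theta \<tau> z"
  by (simp add: theta_def ee_add ee_diff ee_minus)

text \<open>The shift by \<tau> removes the factor k = 0 from the first product and adds a factor to
  the second; the quotient of these two factors is the exponential.\<close>

lemma theta_plus_tau: "theta \<tau> (z + \<tau>) * ee (\<tau> / 2 + z) = theta \<tau> z"
proof -
  have tau_half: "ee \<tau> = ee (\<tau>/2) * ee (\<tau>/2)" by (simp add: ee_add [symmetric])
  have 1: "qpoch (- (ee (\<tau>/2) * ee z)) (ee \<tau>) = (1 + ee (\<tau>/2 + z)) * qpoch (- (ee (\<tau>/2) * ee (z + \<tau>))) (ee \<tau>)"
    using qpoch_rec[OF norm_nome(1), of "- (ee (\<tau>/2) * ee z)"]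
    by (simp add: ee_add mult_ac del: times_divide_eq_right)
  have shift: "- ee (- (\<tau>/2 + z)) * ee \<tau> = - (ee (\<tau>/2) * ee (- z))"
    "- (ee (\<tau>/2) * ee (- (z + \<tau>))) = - ee (- (\<tau>/2 + z))"
    unfolding minus_add_distrib ee_add ee_minus tau_half by (simp_all add: divide_simps)
  have 2: "qpoch (- (ee (\<tau>/2) * ee (- (z + \<tau>)))) (ee \<tau>) =
      (1 + ee (- (\<tau>/2 + z))) * qpoch (- (ee (\<tau>/2) * ee (- z))) (ee \<tau>)"
    using qpoch_rec[OF norm_nome(1), of "- ee (- (\<tau>/2 + z))"]
    unfolding shift by simp
  have 3: "(1 + ee (- (\<tau>/2 + z))) * ee (\<tau>/2 + z) = 1 + ee (\<tau>/2 + z)"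
    by (simp add: distrib_right ee_add [symmetric])
  have "theta \<tau> (z + \<tau>) * ee (\<tau> / 2 + z) = qpoch (- (ee (\<tau>/2) * ee (z + \<tau>))) (ee \<tau>) *
     ((1 + ee (- (\<tau>/2 + z))) * ee (\<tau>/2 + z)) * qpoch (- (ee (\<tau>/2) * ee (- z))) (ee \<tau>)"
    unfolding theta_def 2 by (simp only: mult_ac)
  also have "\<dots> = theta \<tau> z" unfolding theta_def 1 3 by (simp only: mult_ac)
  finally show ?thesis .
qed

lemma theta_0_nonzero: "theta \<tau> 0 \<noteq> 0"
  unfolding theta_def using norm_nome by (simp add: qpoch_nonzero)

lemma qpoch_eq_0D:
  assumes "norm x < 1" "qpoch a x = 0" shows "\<exists>k. a * x ^ k = 1"
  using assms prodinf_nonzero[OF convergent_qpoch[OF assms(1), of a]] unfolding qpoch_def by auto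

text \<open>A zero of the infinite product is a zero of one factor. The first product yields the
  zeros with negative b, the second those with b \<ge> 0.\<close>

lemma theta_eq_0D:
  assumes "theta \<tau> z = 0"
  obtains a b :: int where "z = (1 + \<tau>) / 2 + of_int a + of_int b * \<tau>"
proof -
  obtain k y where y: "y = z \<or> y = - z" "- (ee (\<tau>/2) * ee y) * ee \<tau> ^ k = 1"
    using assms qpoch_eq_0D[OF norm_nome(1)] unfolding theta_def by (metis mult_eq_0_iff)
  have "- (ee (\<tau>/2) * ee y) * ee \<tau> ^ k = ee (1/2 + \<tau>/2 + y + of_nat k * \<tau>)"
    by (simp add: ee_add ee_power)
  with y(2) have "ee (1/2 + \<tau>/2 + y + of_nat k * \<tau>) = 1" by simp
  then obtain n :: int where n: "1/2 + \<tau>/2 + y + of_nat k * \<tau> = of_int n"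
    by (rule ee_eq_1D)
  from y(1) show ?thesis
  proof
    assume "y = z"
    then have "z = of_int n - (1/2 + \<tau>/2 + of_nat k * \<tau>)" by (simp add: n [symmetric])
    then have "z = (1 + \<tau>) / 2 + of_int (n - 1) + of_int (- int k - 1) * \<tau>"
      by (simp add: field_simps del: of_int_mult)
    then show ?thesis using that by blast
  next
    assume "y = - z"
    then have "z = 1/2 + \<tau>/2 + of_nat k * \<tau> - of_int n" by (simp add: n [symmetric])
    then have "z = (1 + \<tau>) / 2 + of_int (- n) + of_int (int k) * \<tau>"
      by (simp add: add_divide_distrib)
    then show ?thesis using that by blast
  qed
qed


lemma theta_zero: "theta \<tau> ((1 + \<tau>) / 2) = 0"
proof -
  have "ee (\<tau>/2) * ee (- ((1 + \<tau>) / 2)) = ee (- (1 / 2))"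
    unfolding ee_add [symmetric] by (rule arg_cong[of _ _ ee]) (simp add: field_simps)
  then have "ee (\<tau>/2) * ee (- ((1 + \<tau>) / 2)) = - 1" by (simp add: ee_minus)
  then show ?thesis by (simp add: theta_def norm_nome)
qed

text \<open>Only the factor \<open>c\<close>, the one with k = 0 in the second product, vanishes at
  this point. Its derivative there is 2 pi i, and what remains are two copies of Euler's product,
  which is nonzero.\<close>

lemma deriv_theta_nonzero: "deriv (theta \<tau>) ((1 + \<tau>) / 2) \<noteq> 0"
proof -
  define z0 where "z0 = (1 + \<tau>) / 2"
  define A where "A z = qpoch (- (ee (\<tau> / 2) * ee z)) (ee \<tau>)" for z
  define B where "B z = qpoch (- (ee (\<tau> / 2) * ee (- z) * ee \<tau>)) (ee \<tau>)" for z
  define c where "c z = 1 + ee (\<tau>/2 - z)" for z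
  have theta_eq: "theta \<tau> z = c z * (A z * B z)" for z
  proof -
    have "c z = 1 - - (ee (\<tau>/2) * ee (- z))" by (simp add: c_def ee_add [symmetric])
    then have "qpoch (- (ee (\<tau>/2) * ee (- z))) (ee \<tau>) = c z * B z"
      using qpoch_rec[OF norm_nome(1), of "- (ee (\<tau>/2) * ee (-z))"] by (simp only: B_def mult_minus_left)
    then show ?thesis by (simp add: theta_def A_def)
  qed
  have [simp]: "ee (\<tau>/2 - z0) = - 1"
    using ee_minus[of "1/2"] by (simp add: z0_def field_simps)
  have "ee (\<tau>/2) * ee z0 = ee (1 / 2 + \<tau>)"
    unfolding ee_add [symmetric] by (rule arg_cong[of _ _ ee]) (simp add: z0_def field_simps)
  then have A0: "A z0 = qpoch (ee \<tau>) (ee \<tau>)" by (simp add: A_def ee_add)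
  have "ee (\<tau>/2) * ee (- z0) = ee (\<tau>/2 - z0)" by (simp add: ee_add [symmetric])
  then have B0: "B z0 = qpoch (ee \<tau>) (ee \<tau>)" by (simp add: B_def)
  have nz: "A z0 * B z0 \<noteq> 0" using A0 B0 norm_nome by (simp add: qpoch_nonzero)
  have "(\<lambda>z. A z * B z) holomorphic_on UNIV"
    unfolding A_def B_def by (intro holomorphic_intros norm_nome open_UNIV)
  then have dAB: "((\<lambda>z. A z * B z) has_field_derivative deriv (\<lambda>z. A z * B z) z0) (at z0)"
    by (rule holomorphic_derivI) auto
  have dc: "(c has_field_derivative 2 * of_real pi * \<i>) (at z0)"
  proof -
    have "(c has_field_derivative 0 + ee (\<tau>/2 - z0) * (2 * of_real pi * \<i>) * (0 - 1)) (at z0)"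
      unfolding c_def[abs_def]
      by (rule DERIV_add[OF DERIV_const DERIV_chain2[OF DERIV_ee DERIV_diff[OF DERIV_const DERIV_ident]]])
    then show ?thesis by simp
  qed
  have "c z0 = 0" by (simp add: c_def)
  with DERIV_mult[OF dc dAB] have "((\<lambda>z. c z * (A z * B z)) has_field_derivative
      (2 * of_real pi * \<i>) * (A z0 * B z0)) (at z0)"
    by simp
  then have "deriv (theta \<tau>) z0 = (2 * of_real pi * \<i>) * (A z0 * B z0)"
    unfolding theta_eq[abs_def, symmetric] by (rule DERIV_imp_deriv)
  with nz show ?thesis by (simp add: z0_def)
qed

text \<open>The zeros of theta form one coset of the period lattice, so divisibility is checked at
  one of them and the property \<open>good\<close> is carried along the periods. The hypotheses
  speak of the zero set of \<open>F\<close> only, so that they also fit functions with an automorphy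
  factor.\<close>

lemma theta_dvd:
  assumes F: "F holomorphic_on UNIV" and zero: "F ((1 + \<tau>) / 2) = 0"
    and F1: "\<And>z. F (z + 1) = 0 \<longleftrightarrow> F z = 0" and F\<tau>: "\<And>z. F (z + \<tau>) = 0 \<longleftrightarrow> F z = 0"
  shows "\<exists>h. h holomorphic_on UNIV \<and> (\<forall>z. F z = h z * theta \<tau> z)"
proof -
  define z0 where "z0 = (1 + \<tau>) / 2"
  define good where "good z \<longleftrightarrow> F z = 0 \<and> theta \<tau> z = 0 \<and> deriv (theta \<tau>) z \<noteq> 0" for z
  note hol = holomorphic_theta[of UNIV]
  have dth: "(theta \<tau> has_field_derivative deriv (theta \<tau>) z) (at z)" for z
    by (rule holomorphic_derivI[OF hol]) auto
  have good0: "good z0" using theta_zero deriv_theta_nonzero zero by (simp add: good_def z0_def)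
  have good1: "good (z + 1) \<longleftrightarrow> good z" for z
  proof -
    have "((\<lambda>z. theta \<tau> (z + 1)) has_field_derivative deriv (theta \<tau>) (z + 1)) (at z)"
      by (rule DERIV_shift[THEN iffD1, OF dth])
    then have "deriv (theta \<tau>) (z + 1) = deriv (theta \<tau>) z"
      unfolding theta_plus_1 by (rule DERIV_imp_deriv [symmetric])
    then show ?thesis by (simp add: good_def F1 theta_plus_1)
  qed
  have good\<tau>: "good (z + \<tau>) \<longleftrightarrow> good z" for z
  proof (cases "theta \<tau> (z + \<tau>) = 0")
    case True
    have 1: "((\<lambda>z. theta \<tau> (z + \<tau>)) has_field_derivative deriv (theta \<tau>) (z + \<tau>)) (at z)"
      by (rule DERIV_shift[THEN iffD1, OF dth])
    have 2: "((\<lambda>z. ee (\<tau> / 2 + z)) has_field_derivative deriv (\<lambda>z. ee (\<tau> / 2 + z)) z) (at z)"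
      by (rule holomorphic_derivI[of _ UNIV]) (auto intro!: holomorphic_intros)
    have d: "deriv (theta \<tau>) z = deriv (theta \<tau>) (z + \<tau>) * ee (\<tau> / 2 + z)"
      using DERIV_imp_deriv[OF DERIV_mult[OF 1 2]] True by (simp add: theta_plus_tau mult.commute)
    have th: "theta \<tau> z = 0" using True theta_plus_tau[of z] by simp
    show ?thesis unfolding good_def d F\<tau> using True th by simp
  next
    case False
    then have "theta \<tau> z \<noteq> 0" unfolding theta_plus_tau[of z, symmetric] by simp
    with False show ?thesis by (simp add: good_def)
  qed
  have int1: "good (z + of_int a) \<longleftrightarrow> good z" for z a
  proof (induction a rule: int_induct[where k = 0])
    case (step1 i)
    then show ?case using good1[of "z + of_int i"] by (simp add: add.assoc)
  next
    case (step2 i)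
    then show ?case using good1[of "z + of_int (i - 1)"] by (simp add: add.assoc)
  qed simp
  have int2: "good (z + of_int a * \<tau>) \<longleftrightarrow> good z" for z a
  proof (induction a rule: int_induct[where k = 0])
    case (step1 i)
    then show ?case using good\<tau>[of "z + of_int i * \<tau>"] by (simp add: algebra_simps)
  next
    case (step2 i)
    then show ?case using good\<tau>[of "z + of_int (i - 1) * \<tau>"] by (simp add: algebra_simps)
  qed simp
  have good: "good z" if z: "theta \<tau> z = 0" for z
  proof -
    obtain a b :: int where ab: "z = (1 + \<tau>) / 2 + of_int a + of_int b * \<tau>"
      by (rule theta_eq_0D[OF z])
    show ?thesis unfolding ab int2 int1 using good0 unfolding z0_def .
  qed
  have "F z = 0 \<and> deriv (theta \<tau>) z \<noteq> 0" if "theta \<tau> z = 0" for z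
    using good[OF that] by (simp add: good_def)
  from holomorphic_quotient[OF F hol this] show ?thesis .
qed

section \<open>Uniqueness of theta functions and Jacobi's quartic identity\<close>

lemma theta_cancel:
  assumes f: "f holomorphic_on UNIV" and g: "g holomorphic_on UNIV"
    and eq: "\<And>z. f z * theta \<tau> z = g z * theta \<tau> z"
  shows "f = g"
proof -
  have "(f z - g z) * theta \<tau> z = 0" for z
    unfolding left_diff_distrib eq by simp
  then have "(\<forall>z\<in>UNIV. f z - g z = 0) \<or> (\<forall>z\<in>UNIV. theta \<tau> z = 0)"
    by (intro holomorphic_mult_eq_0 holomorphic_on_diff f g holomorphic_theta) auto
  then show ?thesis using theta_0_nonzero by auto
qed

text \<open>The quotient of such a function by \<^term>\<open>theta \<tau>\<close> is entire, since the zeros of the theta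
  function are simple and its evenness forces \<^term>\<open>F\<close> to vanish at them; being doubly
  periodic, it is constant.\<close>

lemma theta_unique:
  assumes F: "F holomorphic_on UNIV" and even: "\<And>z. F (- z) = F z"
    and F1: "\<And>z. F (z + 1) = F z" and F\<tau>: "\<And>z. F (z + \<tau>) * ee (\<tau> / 2 + z) = F z"
  shows "\<exists>c. \<forall>z. F z = c * theta \<tau> z"
proof -
  note hol = holomorphic_theta[of UNIV]
  define z0 where "z0 = (1 + \<tau>) / 2"
  have "F z0 = 0"
  proof -
    \<comment> \<open>At z0 - \<tau> the automorphy factor is ee (1/2) = -1, while z0 - \<tau> and -
      z0 differ by the period 1. With evenness this gives F z0 = - F z0.\<close>
    have "F (z0 - \<tau> + \<tau>) * ee (\<tau> / 2 + (z0 - \<tau>)) = F (z0 - \<tau> - 1 + 1)"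
      using F\<tau>[of "z0 - \<tau>"] by simp
    also have "\<dots> = F (- z0)" unfolding F1 by (rule arg_cong[of _ _ F]) (simp add: z0_def field_simps)
    also have "\<tau> / 2 + (z0 - \<tau>) = 1 / 2" by (simp add: z0_def field_simps)
    finally show ?thesis using even by simp
  qed
  then have "\<exists>h. h holomorphic_on UNIV \<and> (\<forall>z. F z = h z * theta \<tau> z)"
  proof (intro theta_dvd F)
    show "F (z + \<tau>) = 0 \<longleftrightarrow> F z = 0" for z
      unfolding F\<tau>[of z, symmetric] by simp
  qed (simp_all add: F1 z0_def)
  then obtain h where hF: "h holomorphic_on UNIV \<and> (\<forall>z. F z = h z * theta \<tau> z)" ..
  note h = conjunct1[OF hF] and Fh = conjunct2[OF hF, rule_format]
  have shift: "(\<lambda>z. h (z + a)) holomorphic_on UNIV" for a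
    by (rule entire_compose[OF h]) (intro holomorphic_intros)
  have "(\<lambda>z. h (z + 1)) = h"
  proof (intro theta_cancel h shift)
    show "h (z + 1) * theta \<tau> z = h z * theta \<tau> z" for z
      using F1[of z] theta_plus_1[of z] Fh[of z] Fh[of "z + 1"] by metis
  qed
  moreover have "(\<lambda>z. h (z + \<tau>)) = h"
  proof (intro theta_cancel h shift)
    show "h (z + \<tau>) * theta \<tau> z = h z * theta \<tau> z" for z
    proof -
      have "h (z + \<tau>) * theta \<tau> z = F (z + \<tau>) * ee (\<tau> / 2 + z)"
        by (simp only: Fh mult.assoc theta_plus_tau)
      then show ?thesis using F\<tau>[of z] Fh[of z] by simp
    qed
  qed
  ultimately obtain c where "\<And>z. h z = c"
    using doubly_periodic_constant[OF h \<tau>] by (auto dest: fun_cong)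
  then show ?thesis using Fh by auto
qed

lemma theta_plus_tau_half: "theta \<tau> (z + \<tau> / 2) * ee z = theta \<tau> (z - \<tau> / 2)"
  using theta_plus_tau[of "z - \<tau> / 2"] by (simp add: algebra_simps)

lemma theta_half_nonzero: "theta \<tau> (1 / 2) \<noteq> 0"
  unfolding theta_def using norm_nome by (simp add: qpoch_nonzero ee_minus)

text \<open>After division by \<^term>\<open>theta \<tau>\<close> the combination \<open>M\<close> of the squares of two shifted theta
  functions satisfies the hypotheses of \<open>theta_unique\<close>; its coefficients are chosen to make it
  vanish at the zero of \<^term>\<open>theta \<tau>\<close>.\<close>

lemma theta_jacobi:
  "theta \<tau> 0 ^ 4 = theta \<tau> (1 / 2) ^ 4 + ee (\<tau> / 2) * theta \<tau> (\<tau> / 2) ^ 4"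
proof -
  note hol = holomorphic_theta[of UNIV]
  \<comment> \<open>The exponential makes the square of the shift by \<tau>/2 even and gives it the
    same multiplier as theta^2 under z -> z + \<tau>.\<close>
  define R where "R z = ee (\<tau> / 4 + z) * theta \<tau> (z + \<tau> / 2) ^ 2" for z
  define M where "M z = theta \<tau> (1/2) ^ 2 * theta \<tau> (z + 1/2) ^ 2 +
     ee (\<tau> / 4) * theta \<tau> (\<tau> / 2) ^ 2 * R z" for z
  have shift: "(\<lambda>z. theta \<tau> (z + a)) holomorphic_on UNIV" for a
    by (rule entire_compose[OF hol]) (intro holomorphic_intros)
  have Mhol: "M holomorphic_on UNIV"
    unfolding M_def[abs_def] R_def[abs_def]
    by (intro holomorphic_on_add holomorphic_on_mult holomorphic_on_power holomorphic_ee shift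
        holomorphic_on_const holomorphic_on_ident)
  have R1: "R (z + 1) = R z" for z
    using theta_plus_1[of "z + \<tau> / 2"] by (simp add: R_def ee_add add_ac)
  have M1: "M (z + 1) = M z" for z
  proof -
    have "theta \<tau> (z + 1 + 1/2) = theta \<tau> (z + 1/2)"
      using theta_plus_1[of "z + 1/2"] by (simp only: add_ac)
    then show ?thesis by (simp only: M_def R1)
  qed
  have R\<tau>: "R (z + \<tau>) * ee (\<tau> + 2 * z) = R z" for z
  proof -
    have "R z = ee (\<tau> / 4 + z) * (theta \<tau> (z + \<tau> / 2 + \<tau>) * ee (\<tau> / 2 + (z + \<tau> / 2)))\<^sup>2"
      unfolding theta_plus_tau R_def ..
    also have "\<dots> = ee (\<tau> / 4 + z) * ee (\<tau> / 2 + (z + \<tau> / 2)) ^ 2 * (theta \<tau> (z + \<tau> / 2 + \<tau>))\<^sup>2"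
      by (simp add: power_mult_distrib)
    also have "ee (\<tau> / 4 + z) * ee (\<tau> / 2 + (z + \<tau> / 2)) ^ 2 = ee (\<tau> / 4 + (z + \<tau>)) * ee (\<tau> + 2 * z)"
      unfolding ee_power ee_add [symmetric] by (rule arg_cong[of _ _ ee]) (simp add: field_simps)
    finally show ?thesis by (simp add: R_def algebra_simps)
  qed
  have T\<tau>: "theta \<tau> (z + \<tau> + 1/2) ^ 2 * ee (\<tau> + 2 * z) = theta \<tau> (z + 1/2) ^ 2" for z
  proof -
    have "theta \<tau> (z + 1/2) ^ 2 = (theta \<tau> (z + 1/2 + \<tau>) * ee (\<tau> / 2 + (z + 1/2))) ^ 2"
      unfolding theta_plus_tau ..
    also have "\<dots> = theta \<tau> (z + \<tau> + 1/2) ^ 2 * ee (\<tau> / 2 + (z + 1/2)) ^ 2"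
      by (simp add: power_mult_distrib add_ac)
    also have "ee (\<tau> / 2 + (z + 1/2)) ^ 2 = ee (\<tau> + 2 * z + 1)"
      unfolding ee_power by (rule arg_cong[of _ _ ee]) (simp add: field_simps)
    also have "\<dots> = ee (\<tau> + 2 * z)" by (simp add: ee_add)
    finally show ?thesis ..
  qed
  have M\<tau>: "M (z + \<tau>) * ee (\<tau> + 2 * z) = M z" for z
    unfolding M_def distrib_right mult.assoc R\<tau> T\<tau> ..
  have Reven: "R (- z) = R z" for z
  proof -
    have "theta \<tau> (- z + \<tau> / 2) = theta \<tau> (z - \<tau> / 2)" using theta_minus[of "z - \<tau> / 2"] by simp
    also have "\<dots> = theta \<tau> (z + \<tau> / 2) * ee z" by (simp add: theta_plus_tau_half)
    finally have "R (- z) = ee (\<tau> / 4 + - z) * ee z ^ 2 * theta \<tau> (z + \<tau> / 2) ^ 2"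
      by (simp add: R_def power_mult_distrib)
    also have "ee (\<tau> / 4 + - z) * ee z ^ 2 = ee (\<tau> / 4 + z)"
      unfolding ee_power ee_add [symmetric] by (rule arg_cong[of _ _ ee]) simp
    finally show ?thesis by (simp add: R_def)
  qed
  have Meven: "M (- z) = M z" for z
  proof -
    have "theta \<tau> (- z + 1/2) = theta \<tau> (z - 1/2 + 1)"
      using theta_minus[of "z - 1/2"] theta_plus_1[of "z - 1/2"] by simp
    then have "theta \<tau> (- z + 1/2) = theta \<tau> (z + 1/2)" by (simp add: add.commute)
    then show ?thesis by (simp only: M_def Reven)
  qed
  have "M ((1 + \<tau>) / 2) = 0"
  proof -
    have "R ((1 + \<tau>) / 2) = ee (\<tau> / 4 + (1 + \<tau>) / 2) * theta \<tau> (0 + \<tau> + 1/2) ^ 2"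
      by (simp add: R_def field_simps)
    also have "ee (\<tau> / 4 + (1 + \<tau>) / 2) = ee (1/2 - \<tau> / 4) * ee (\<tau> + 2 * 0)"
      unfolding ee_add [symmetric] by (rule arg_cong[of _ _ ee]) (simp add: field_simps)
    finally have "R ((1 + \<tau>) / 2) = - (theta \<tau> (1/2) ^ 2) / ee (\<tau> / 4)"
      using T\<tau>[of 0] by (simp add: ee_diff mult_ac)
    moreover have "theta \<tau> ((1 + \<tau>) / 2 + 1/2) = theta \<tau> (\<tau> / 2)"
      using theta_plus_1[of "\<tau> / 2"] by (simp add: add_divide_distrib add_ac)
    ultimately show ?thesis by (simp add: M_def)
  qed
  moreover have "M (z + \<tau>) = 0 \<longleftrightarrow> M z = 0" for z
    unfolding M\<tau>[of z, symmetric] by simp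
  ultimately have "\<exists>h. h holomorphic_on UNIV \<and> (\<forall>z. M z = h z * theta \<tau> z)"
    by (intro theta_dvd Mhol) (simp_all add: M1)
  then obtain h where hM: "h holomorphic_on UNIV \<and> (\<forall>z. M z = h z * theta \<tau> z)" ..
  note h = conjunct1[OF hM] and Mh = conjunct2[OF hM, rule_format]
  have hshift: "(\<lambda>z. h (z + a)) holomorphic_on UNIV" for a
    by (rule entire_compose[OF h]) (intro holomorphic_intros)
  have hminus: "(\<lambda>z. h (- z)) holomorphic_on UNIV"
    by (rule entire_compose[OF h]) (intro holomorphic_intros)
  have "(\<lambda>z. h (- z)) = h"
  proof (intro theta_cancel h hminus)
    show "h (- z) * theta \<tau> z = h z * theta \<tau> z" for z
      by (metis Mh Meven theta_minus)
  qed
  moreover have "(\<lambda>z. h (z + 1)) = h"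
  proof (intro theta_cancel h hshift)
    show "h (z + 1) * theta \<tau> z = h z * theta \<tau> z" for z
      by (metis Mh M1 theta_plus_1)
  qed
  moreover have "(\<lambda>z. h (z + \<tau>) * ee (\<tau> / 2 + z)) = h"
  proof (intro theta_cancel h)
    show "(\<lambda>z. h (z + \<tau>) * ee (\<tau> / 2 + z)) holomorphic_on UNIV"
      by (intro holomorphic_intros hshift)
    show "h (z + \<tau>) * ee (\<tau> / 2 + z) * theta \<tau> z = h z * theta \<tau> z" for z
    proof -
      have "h z * theta \<tau> z = h (z + \<tau>) * theta \<tau> (z + \<tau>) * ee (\<tau> + 2 * z)"
        by (simp add: Mh [symmetric] M\<tau>)
      also have "ee (\<tau> + 2 * z) = ee (\<tau> / 2 + z) * ee (\<tau> / 2 + z)"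
        unfolding ee_add [symmetric] by (rule arg_cong[of _ _ ee]) simp
      also have "h (z + \<tau>) * theta \<tau> (z + \<tau>) * (ee (\<tau> / 2 + z) * ee (\<tau> / 2 + z)) =
          h (z + \<tau>) * ee (\<tau> / 2 + z) * (theta \<tau> (z + \<tau>) * ee (\<tau> / 2 + z))" by (simp only: mult_ac)
      finally show ?thesis by (simp only: theta_plus_tau)
    qed
  qed
  \<comment> \<open>\<open>M\<close> has the multiplier of theta^2, and one theta has been divided
    out; so \<open>h\<close> has the multiplier of theta and is again a multiple of it.\<close>
  ultimately have "\<exists>a. \<forall>z. h z = a * theta \<tau> z"
    by (intro theta_unique h) (auto dest: fun_cong)
  then obtain a where "\<forall>z. h z = a * theta \<tau> z" ..
  then have M: "M z = a * theta \<tau> z ^ 2" for z using Mh[of z] by (simp add: power2_eq_square)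
  \<comment> \<open>At z = 1/2 the second term of \<open>M\<close> drops out, which determines the
    constant; z = 0 then gives the identity.\<close>
  have "R (1/2) = 0" using theta_zero by (simp add: R_def add_divide_distrib)
  then have "a = theta \<tau> 0 ^ 2"
    using M[of "1/2"] theta_half_nonzero theta_plus_1[of 0] by (simp add: M_def)
  with M[of 0] have "theta \<tau> 0 ^ 2 * theta \<tau> 0 ^ 2 = theta \<tau> (1/2) ^ 2 * theta \<tau> (1/2) ^ 2 +
     (ee (\<tau> / 4) * ee (\<tau> / 4)) * (theta \<tau> (\<tau> / 2) ^ 2 * theta \<tau> (\<tau> / 2) ^ 2)"
    by (simp add: M_def R_def mult_ac)
  then show ?thesis
    by (simp add: ee_add [symmetric] power_add [symmetric])
qed

end

subsection \<open>Weber functions\<close>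

lemma eta_eq: "eta \<tau> = ee (\<tau> / 24) * qpoch (ee \<tau>) (ee \<tau>)"
  by (simp add: eta_def qpoch_def ee_def)

lemma zeta_eq: "\<zeta> k = ee (1 / of_nat k)"
  by (simp add: \<zeta>_def ee_def)

context
  fixes \<tau> :: complex
  assumes \<tau>: "Im \<tau> > 0"
begin

lemma ee_square_half: "ee (\<tau> / 2) ^ 2 = ee \<tau>"
  by (simp add: ee_power)

lemma qpoch_Euler_nonzero: "qpoch (ee \<tau>) (ee \<tau>) \<noteq> 0"
  using norm_nome[OF \<tau>] by (simp add: qpoch_nonzero)

text \<open>The nome of (\<tau> + 1)/2 is - ee (\<tau>/2), with square ee \<tau>. Splitting by
  parity produces Euler's product of \<open>eta \<tau>\<close>, which cancels; the constant \<zeta>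
  48 absorbs the phase ee (1/48).\<close>

lemma weber_f_eq: "weber_f \<tau> = ee (- \<tau> / 48) * qpoch (- ee (\<tau> / 2)) (ee \<tau>)"
proof -
  have x: "ee ((\<tau> + 1) / 2) = - ee (\<tau> / 2)" by (simp add: add_divide_distrib ee_add)
  have "qpoch (- ee (\<tau> / 2)) (- ee (\<tau> / 2)) = qpoch (- ee (\<tau> / 2)) (ee \<tau>) * qpoch (ee \<tau>) (ee \<tau>)"
    using qpoch_split[of "- ee (\<tau> / 2)" "- ee (\<tau> / 2)"] norm_nome[OF \<tau>] ee_square_half
    by (simp add: power2_eq_square)
  then have "eta ((\<tau> + 1) / 2) = ee ((\<tau> + 1) / 2 / 24) * (qpoch (- ee (\<tau> / 2)) (ee \<tau>) * qpoch (ee \<tau>) (ee \<tau>))"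
    by (simp only: eta_eq x)
  then have "weber_f \<tau> = inverse (\<zeta> 48) * ee ((\<tau> + 1) / 2 / 24) / ee (\<tau> / 24) * qpoch (- ee (\<tau> / 2)) (ee \<tau>)"
    using qpoch_Euler_nonzero by (simp add: weber_f_def eta_eq[of \<tau>])
  also have "inverse (\<zeta> 48) * ee ((\<tau> + 1) / 2 / 24) / ee (\<tau> / 24) = ee (- \<tau> / 48)"
    unfolding zeta_eq ee_minus [symmetric] ee_add [symmetric] ee_diff [symmetric]
    by (rule arg_cong[of _ _ ee]) (simp add: field_simps)
  finally show ?thesis .
qed

lemma weber_f1_eq: "weber_f1 \<tau> = ee (- \<tau> / 48) * qpoch (ee (\<tau> / 2)) (ee \<tau>)"
proof -
  have "qpoch (ee (\<tau> / 2)) (ee (\<tau> / 2)) = qpoch (ee (\<tau> / 2)) (ee \<tau>) * qpoch (ee \<tau>) (ee \<tau>)"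
    using qpoch_split[of "ee (\<tau> / 2)" "ee (\<tau> / 2)"] norm_nome[OF \<tau>] ee_square_half
    by (simp add: power2_eq_square)
  then have "weber_f1 \<tau> = ee (\<tau> / 2 / 24) / ee (\<tau> / 24) * qpoch (ee (\<tau> / 2)) (ee \<tau>)"
    using qpoch_Euler_nonzero by (simp add: weber_f1_def eta_eq)
  also have "ee (\<tau> / 2 / 24) / ee (\<tau> / 24) = ee (- \<tau> / 48)"
    unfolding ee_diff [symmetric] by (rule arg_cong[of _ _ ee]) simp
  finally show ?thesis .
qed

lemma weber_f2_eq: "weber_f2 \<tau> = of_real (sqrt 2) * ee (\<tau> / 24) * qpoch (- ee \<tau>) (ee \<tau>)"
proof -
  have "ee (2 * \<tau>) = ee \<tau> ^ 2" by (simp add: ee_power)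
  then have "eta (2 * \<tau>) = ee (2 * \<tau> / 24) * (qpoch (ee \<tau>) (ee \<tau>) * qpoch (- ee \<tau>) (ee \<tau>))"
    using qpoch_mult_minus[OF norm_nome(1)[OF \<tau>], of "ee \<tau>"] by (simp add: eta_eq)
  then have "weber_f2 \<tau> = of_real (sqrt 2) * (ee (2 * \<tau> / 24) / ee (\<tau> / 24)) * qpoch (- ee \<tau>) (ee \<tau>)"
    using qpoch_Euler_nonzero by (simp add: weber_f2_def eta_eq[of \<tau>])
  also have "ee (2 * \<tau> / 24) / ee (\<tau> / 24) = ee (\<tau> / 24)"
    unfolding ee_diff [symmetric] by (rule arg_cong[of _ _ ee]) simp
  finally show ?thesis .
qed

lemma weber_nonzero: "weber_f \<tau> \<noteq> 0" "weber_f1 \<tau> \<noteq> 0" "weber_f2 \<tau> \<noteq> 0"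
  unfolding weber_f_eq weber_f1_eq weber_f2_eq using norm_nome[OF \<tau>]
  by (simp_all add: qpoch_nonzero)

text \<open>Once the first two products are combined, this is Euler's identity: the product of all 1
  + q^k with k > 0 is inverse to that of all 1 - q^k with k odd.\<close>

lemma weber_mult: "weber_f \<tau> * weber_f1 \<tau> * weber_f2 \<tau> = of_real (sqrt 2)"
proof -
  let ?p = "ee (\<tau> / 2)" and ?q = "ee \<tau>"
  have q2: "norm (?q ^ 2) < 1" using norm_nome[OF \<tau>] by (simp add: norm_power power_less_one_iff)
  have 1: "qpoch ?p ?q * qpoch (- ?p) ?q = qpoch ?q (?q ^ 2)"
    using qpoch_mult_minus[OF norm_nome(1)[OF \<tau>], of ?p] ee_square_half by simp
  have 2: "qpoch ?q ?q = qpoch ?q (?q ^ 2) * qpoch (?q ^ 2) (?q ^ 2)"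
    using qpoch_split[OF norm_nome(1)[OF \<tau>], of ?q] by (simp add: power2_eq_square)
  have 3: "qpoch ?q ?q * qpoch (- ?q) ?q = qpoch (?q ^ 2) (?q ^ 2)"
    by (rule qpoch_mult_minus[OF norm_nome(1)[OF \<tau>]])
  have "qpoch (?q ^ 2) (?q ^ 2) * (qpoch ?p ?q * qpoch (- ?p) ?q * qpoch (- ?q) ?q) = qpoch (?q ^ 2) (?q ^ 2) * 1"
    unfolding 1 using 2 3 by (simp add: mult_ac)
  moreover have "qpoch (?q ^ 2) (?q ^ 2) \<noteq> 0" using q2 by (simp add: qpoch_nonzero)
  ultimately have 4: "qpoch ?p ?q * qpoch (- ?p) ?q * qpoch (- ?q) ?q = 1" by (simp only: mult_cancel_left) simp
  have "weber_f \<tau> * weber_f1 \<tau> * weber_f2 \<tau> = of_real (sqrt 2) *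
     (ee (- \<tau> / 48) * ee (- \<tau> / 48) * ee (\<tau> / 24)) * (qpoch ?p ?q * qpoch (- ?p) ?q * qpoch (- ?q) ?q)"
    unfolding weber_f_eq weber_f1_eq weber_f2_eq by (simp only: mult_ac)
  also have "ee (- \<tau> / 48) * ee (- \<tau> / 48) * ee (\<tau> / 24) = 1"
    unfolding ee_add [symmetric] by simp
  finally show ?thesis using 4 by simp
qed

text \<open>The squares of the Weber functions are theta values at 0, 1/2 and \<tau>/2, up to powers
  of the nome. Hence identities of theta in the variable z yield relations between all three
  functions.\<close>

lemma weber_f_sq: "weber_f \<tau> ^ 2 = ee (- \<tau> / 24) * theta \<tau> 0"
  unfolding weber_f_eq theta_def by (simp add: power_mult_distrib ee_power power2_eq_square[of "qpoch _ _"])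

lemma weber_f1_sq: "weber_f1 \<tau> ^ 2 = ee (- \<tau> / 24) * theta \<tau> (1 / 2)"
  unfolding weber_f1_eq theta_def using ee_minus[of "1 / 2"]
  by (simp add: power_mult_distrib ee_power power2_eq_square[of "qpoch _ _"])

lemma weber_f2_sq: "weber_f2 \<tau> ^ 2 = ee (\<tau> / 12) * theta \<tau> (\<tau> / 2)"
proof -
  have "ee (\<tau> / 2) * ee (\<tau> / 2) = ee \<tau>" "ee (\<tau> / 2) * ee (- (\<tau> / 2)) = 1"
    unfolding ee_add [symmetric] by simp_all
  then have "theta \<tau> (\<tau> / 2) = qpoch (- ee \<tau>) (ee \<tau>) * qpoch (- 1) (ee \<tau>)"
    by (simp only: theta_def)
  also have "qpoch (- 1) (ee \<tau>) = 2 * qpoch (- ee \<tau>) (ee \<tau>)"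
    using qpoch_rec[OF norm_nome(1)[OF \<tau>], of "- 1"] by simp
  finally have th: "theta \<tau> (\<tau> / 2) = 2 * qpoch (- ee \<tau>) (ee \<tau>) ^ 2" by (simp add: power2_eq_square)
  have s: "complex_of_real (sqrt 2) ^ 2 = 2"
    by (metis of_real_numeral of_real_power real_sqrt_pow2 zero_le_numeral)
  show ?thesis
    unfolding weber_f2_eq th power_mult_distrib s by (simp add: ee_power)
qed

text \<open>The quartic theta identity in terms of squares; the powers of the nome match because
  4/12 = - 4/24 + 1/2.\<close>

lemma weber_jacobi: "weber_f \<tau> ^ 8 = weber_f1 \<tau> ^ 8 + weber_f2 \<tau> ^ 8"
proof -
  have 8: "x ^ 8 = (x\<^sup>2) ^ 4" for x :: complex by (simp add: power_mult [symmetric])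
  have e: "ee (\<tau> / 12) ^ 4 = ee (- \<tau> / 24) ^ 4 * ee (\<tau> / 2)"
    unfolding ee_power ee_add [symmetric] by (rule arg_cong[of _ _ ee]) simp
  show ?thesis
    unfolding 8 weber_f_sq weber_f1_sq weber_f2_sq power_mult_distrib theta_jacobi[OF \<tau>] e
    by (simp add: algebra_simps)
qed

text \<open>As functions of \<open>z\<close>, \<open>theta (- 1 / \<tau>) (z / \<tau>)\<close> and \<open>theta \<tau> z\<close> agree up to an exponential
  factor and a constant, which is therefore common to the values at the three half periods.\<close>

lemma theta_inversion:
  "\<exists>c. \<forall>z. ee (- z\<^sup>2 / (2 * \<tau>)) * theta (- 1 / \<tau>) (z / \<tau>) = c * theta \<tau> z"
proof (rule theta_unique[OF \<tau>])
  have \<tau>0: "\<tau> \<noteq> 0" using \<tau> by auto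
  define \<tau>' where "\<tau>' = - 1 / \<tau>"
  have \<tau>': "Im \<tau>' > 0" using \<tau> \<tau>0
    by (simp add: \<tau>'_def Im_divide_Reals Im_divide complex_eq_iff sum_power2_gt_zero_iff)
  have "(\<lambda>z. theta \<tau>' (z / \<tau>)) holomorphic_on UNIV"
    using \<tau>0 by (intro entire_compose[OF holomorphic_theta[OF \<tau>']] holomorphic_intros) auto
  then show "(\<lambda>z. ee (- z\<^sup>2 / (2 * \<tau>)) * theta (- 1 / \<tau>) (z / \<tau>)) holomorphic_on UNIV"
    using \<tau>0 unfolding \<tau>'_def by (intro holomorphic_intros) auto
  fix z
  show "ee (- (- z)\<^sup>2 / (2 * \<tau>)) * theta (- 1 / \<tau>) (- z / \<tau>) = ee (- z\<^sup>2 / (2 * \<tau>)) * theta (- 1 / \<tau>) (z / \<tau>)"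
    using theta_minus[OF \<tau>', of "z / \<tau>"] by (simp add: \<tau>'_def)
  show "ee (- (z + \<tau>)\<^sup>2 / (2 * \<tau>)) * theta (- 1 / \<tau>) ((z + \<tau>) / \<tau>) * ee (\<tau> / 2 + z) =
      ee (- z\<^sup>2 / (2 * \<tau>)) * theta (- 1 / \<tau>) (z / \<tau>)"
  proof -
    have "theta \<tau>' ((z + \<tau>) / \<tau>) = theta \<tau>' (z / \<tau>)"
      using theta_plus_1[OF \<tau>', of "z / \<tau>"] \<tau>0 by (simp add: add_divide_distrib)
    moreover have "ee (- (z + \<tau>)\<^sup>2 / (2 * \<tau>)) * ee (\<tau> / 2 + z) = ee (- z\<^sup>2 / (2 * \<tau>))"
      unfolding ee_add [symmetric]
      by (rule arg_cong[of _ _ ee]) (use \<tau>0 in \<open>simp add: field_simps power2_eq_square\<close>)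
    ultimately show ?thesis by (simp add: \<tau>'_def mult_ac)
  qed
  show "ee (- (z + 1)\<^sup>2 / (2 * \<tau>)) * theta (- 1 / \<tau>) ((z + 1) / \<tau>) =
      ee (- z\<^sup>2 / (2 * \<tau>)) * theta (- 1 / \<tau>) (z / \<tau>)"
  proof -
    have "theta \<tau>' ((z + 1) / \<tau>) = theta \<tau>' ((z + 1) / \<tau> + \<tau>') * ee (\<tau>' / 2 + (z + 1) / \<tau>)"
      using theta_plus_tau[OF \<tau>'] by simp
    also have "(z + 1) / \<tau> + \<tau>' = z / \<tau>" using \<tau>0 by (simp add: \<tau>'_def field_simps)
    finally have 1: "theta \<tau>' ((z + 1) / \<tau>) = theta \<tau>' (z / \<tau>) * ee (\<tau>' / 2 + (z + 1) / \<tau>)" .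
    have "ee (- (z + 1)\<^sup>2 / (2 * \<tau>)) * ee (\<tau>' / 2 + (z + 1) / \<tau>) = ee (- z\<^sup>2 / (2 * \<tau>))"
      unfolding ee_add [symmetric]
      by (rule arg_cong[of _ _ ee]) (use \<tau>0 in \<open>simp add: \<tau>'_def field_simps power2_eq_square\<close>)
    then show ?thesis using 1 by (simp add: \<tau>'_def mult_ac)
  qed
qed

lemma Im_inversion: "Im (- 1 / \<tau>) > 0"
proof -
  have "\<tau> \<noteq> 0" using \<tau> by auto
  then show ?thesis using \<tau> by (simp add: Im_divide complex_eq_iff sum_power2_gt_zero_iff)
qed

end

text \<open>The constant of \<open>theta_inversion\<close> is shared by the three theta values, so
  the three squares acquire a common factor \<kappa>. Since the product of the squares is 2 at both
  arguments, \<kappa> is a cube root of unity.\<close>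

lemma weber_sq_inversion:
  assumes \<tau>: "Im \<tau> > 0"
  shows "\<exists>\<kappa>. \<kappa> ^ 3 = 1 \<and> weber_f (- 1 / \<tau>) ^ 2 = \<kappa> * weber_f \<tau> ^ 2 \<and>
     weber_f1 (- 1 / \<tau>) ^ 2 = \<kappa> * weber_f2 \<tau> ^ 2 \<and> weber_f2 (- 1 / \<tau>) ^ 2 = \<kappa> * weber_f1 \<tau> ^ 2"
proof -
  have \<tau>0: "\<tau> \<noteq> 0" using \<tau> by auto
  define \<tau>' where "\<tau>' = - 1 / \<tau>"
  have \<tau>': "Im \<tau>' > 0" unfolding \<tau>'_def by (rule Im_inversion[OF \<tau>])
  obtain c where c: "\<And>z. ee (- z\<^sup>2 / (2 * \<tau>)) * theta \<tau>' (z / \<tau>) = c * theta \<tau> z"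
    using theta_inversion[OF \<tau>] unfolding \<tau>'_def by blast
  have c0: "theta \<tau>' 0 = c * theta \<tau> 0" using c[of 0] by simp
  have c1: "theta \<tau>' (1/2) = c * theta \<tau> (\<tau> / 2) * ee (\<tau> / 8)"
  proof -
    have "ee (- (\<tau> / 2)\<^sup>2 / (2 * \<tau>)) = ee (- (\<tau> / 8))"
      by (rule arg_cong[of _ _ ee]) (use \<tau>0 in \<open>simp add: field_simps power2_eq_square\<close>)
    moreover have "\<tau> / 2 / \<tau> = 1/2" using \<tau>0 by simp
    ultimately have "inverse (ee (\<tau> / 8)) * theta \<tau>' (1/2) = c * theta \<tau> (\<tau> / 2)"
      using c[of "\<tau> / 2"] by (simp only: ee_minus)
    then show ?thesis by (simp add: field_simps)
  qed
  have c2: "theta \<tau>' (\<tau>' / 2) = c * theta \<tau> (1/2) * ee (- \<tau>' / 8)"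
  proof -
    have "ee (- (1/2)\<^sup>2 / (2 * \<tau>)) = ee (\<tau>' / 8)"
      by (rule arg_cong[of _ _ ee]) (use \<tau>0 in \<open>simp add: \<tau>'_def field_simps power2_eq_square\<close>)
    moreover have "theta \<tau>' (1 / 2 / \<tau>) = theta \<tau>' (\<tau>' / 2)"
      using theta_minus[OF \<tau>', of "\<tau>' / 2"] by (simp add: \<tau>'_def mult.commute)
    ultimately have "ee (\<tau>' / 8) * theta \<tau>' (\<tau>' / 2) = c * theta \<tau> (1/2)"
      using c[of "1/2"] by simp
    then show ?thesis by (simp add: ee_minus field_simps)
  qed
  \<comment> \<open>The exponential collects the powers of the nome by which theta values and
    squares of Weber functions differ at \<tau> and at \<tau>'.\<close>
  define \<kappa> where "\<kappa> = c * ee ((\<tau> - \<tau>') / 24)"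
  have swap: "d * (C * t * e) = C * a * (b * t)" if "a * b = d * e" for a b d e t C :: complex
  proof -
    have "d * (C * t * e) = C * t * (d * e)" by (simp only: mult_ac)
    then show ?thesis unfolding that [symmetric] by (simp only: mult_ac)
  qed
  have swap': "d * (C * t) = C * a * (b * t)" if "a * b = d" for a b d t C :: complex
    using that by (simp add: mult_ac)
  have f: "weber_f \<tau>' ^ 2 = \<kappa> * weber_f \<tau> ^ 2"
  proof -
    have "ee ((\<tau> - \<tau>') / 24) * ee (- \<tau> / 24) = ee (- \<tau>' / 24)"
      unfolding ee_add [symmetric] by (rule arg_cong[of _ _ ee]) (simp add: field_simps)
    then show ?thesis
      unfolding weber_f_sq[OF \<tau>] weber_f_sq[OF \<tau>'] c0 \<kappa>_def by (rule swap')
  qed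
  have f1: "weber_f1 \<tau>' ^ 2 = \<kappa> * weber_f2 \<tau> ^ 2"
  proof -
    have "ee ((\<tau> - \<tau>') / 24) * ee (\<tau> / 12) = ee (- \<tau>' / 24) * ee (\<tau> / 8)"
      unfolding ee_add [symmetric] by (rule arg_cong[of _ _ ee]) (simp add: field_simps)
    then show ?thesis
      unfolding weber_f2_sq[OF \<tau>] weber_f1_sq[OF \<tau>'] c1 \<kappa>_def by (rule swap)
  qed
  have f2: "weber_f2 \<tau>' ^ 2 = \<kappa> * weber_f1 \<tau> ^ 2"
  proof -
    have "ee ((\<tau> - \<tau>') / 24) * ee (- \<tau> / 24) = ee (\<tau>' / 12) * ee (- \<tau>' / 8)"
      unfolding ee_add [symmetric] by (rule arg_cong[of _ _ ee]) (simp add: field_simps)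
    then show ?thesis
      unfolding weber_f1_sq[OF \<tau>] weber_f2_sq[OF \<tau>'] c2 \<kappa>_def by (rule swap)
  qed
  have s: "complex_of_real (sqrt 2) ^ 2 = 2"
    by (metis of_real_numeral of_real_power real_sqrt_pow2 zero_le_numeral)
  have "2 = (weber_f \<tau>' * weber_f1 \<tau>' * weber_f2 \<tau>') ^ 2" unfolding weber_mult[OF \<tau>'] s ..
  also have "\<dots> = \<kappa> ^ 3 * (weber_f \<tau> * weber_f1 \<tau> * weber_f2 \<tau>) ^ 2"
    unfolding power_mult_distrib f f1 f2 by (simp add: power2_eq_square power3_eq_cube mult_ac)
  also have "\<dots> = \<kappa> ^ 3 * 2" unfolding weber_mult[OF \<tau>] s ..
  finally have "\<kappa> ^ 3 = 1" by simp
  with f f1 f2 show ?thesis unfolding \<tau>'_def by blast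
qed

section \<open>Transformation laws of the Weber functions themselves\<close>

lemma in_upper_half_plane [simp]: "\<tau> \<in> upper_half_plane \<longleftrightarrow> Im \<tau> > 0"
  by (simp add: upper_half_plane_def)

lemma open_upper_half_plane: "open upper_half_plane"
  unfolding upper_half_plane_def by (rule open_halfspace_Im_gt)

lemma connected_upper_half_plane: "connected upper_half_plane"
  unfolding upper_half_plane_def by (intro convex_connected convex_halfspace_Im_gt)

lemma ii_upper_half_plane: "\<i> \<in> upper_half_plane"
  by simp

lemma holomorphic_weber:
  "weber_f holomorphic_on upper_half_plane" "weber_f1 holomorphic_on upper_half_plane"
  "weber_f2 holomorphic_on upper_half_plane"
proof -
  have "(\<lambda>\<tau>. ee (- \<tau> / 48) * qpoch (- ee (\<tau> / 2)) (ee \<tau>)) holomorphic_on upper_half_plane"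
    by (intro holomorphic_intros open_upper_half_plane) (auto simp: norm_nome)
  then show "weber_f holomorphic_on upper_half_plane"
    by (rule holomorphic_transform) (simp add: weber_f_eq)
  have "(\<lambda>\<tau>. ee (- \<tau> / 48) * qpoch (ee (\<tau> / 2)) (ee \<tau>)) holomorphic_on upper_half_plane"
    by (intro holomorphic_intros open_upper_half_plane) (auto simp: norm_nome)
  then show "weber_f1 holomorphic_on upper_half_plane"
    by (rule holomorphic_transform) (simp add: weber_f1_eq)
  have "(\<lambda>\<tau>. of_real (sqrt 2) * ee (\<tau> / 24) * qpoch (- ee \<tau>) (ee \<tau>)) holomorphic_on upper_half_plane"
    by (intro holomorphic_intros open_upper_half_plane) (auto simp: norm_nome)
  then show "weber_f2 holomorphic_on upper_half_plane"
    by (rule holomorphic_transform) (simp add: weber_f2_eq)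
qed

text \<open>A finite connected set has at most one point. Pointwise knowledge that a ratio is a root
  of unity thus becomes the existence of one constant.\<close>

lemma continuous_root_of_unity_constant:
  fixes f :: "complex \<Rightarrow> complex"
  assumes "connected S" "continuous_on S f" "m > 0" and root: "\<And>z. z \<in> S \<Longrightarrow> f z ^ m = 1"
  shows "\<exists>c. \<forall>z\<in>S. f z = c"
proof -
  have "f ` S \<subseteq> {z. z ^ m = 1}" using root by auto
  then have "finite (f ` S)" using finite_roots_unity[of m] \<open>m > 0\<close> finite_subset by auto
  moreover have "connected (f ` S)" using assms by (intro connected_continuous_image)
  ultimately obtain c where "f ` S \<subseteq> {c}"
    using connected_finite_iff_sing[of "f ` S"] by (cases "S = {}") auto
  then show ?thesis by blast
qed

lemma continuous_inversion: "continuous_on upper_half_plane (\<lambda>\<tau>. - 1 / \<tau>)"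
  by (auto intro!: continuous_intros)

text \<open>Here \<kappa> may depend on \<tau>; the sixth power of the ratio is 1 in any case, which
  makes the ratio constant.\<close>

lemma weber_ratio_constant:
  assumes g: "g holomorphic_on upper_half_plane" "h holomorphic_on upper_half_plane"
    and nz: "\<And>\<tau>. \<tau> \<in> upper_half_plane \<Longrightarrow> h \<tau> \<noteq> 0"
    and eq: "\<And>\<tau>. \<tau> \<in> upper_half_plane \<Longrightarrow> \<exists>\<kappa>. \<kappa> ^ 3 = 1 \<and> g (- 1 / \<tau>) ^ 2 = \<kappa> * h \<tau> ^ 2"
  shows "\<exists>c. c \<noteq> 0 \<and> (\<forall>\<tau>\<in>upper_half_plane. g (- 1 / \<tau>) = c * h \<tau>)"
proof -
  have "\<exists>c. \<forall>\<tau>\<in>upper_half_plane. g (- 1 / \<tau>) / h \<tau> = c"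
  proof (rule continuous_root_of_unity_constant[OF connected_upper_half_plane])
    show "continuous_on upper_half_plane (\<lambda>\<tau>. g (- 1 / \<tau>) / h \<tau>)"
      by (intro continuous_intros holomorphic_on_imp_continuous_on[OF g(2)]
          continuous_on_compose2[OF holomorphic_on_imp_continuous_on[OF g(1)] continuous_inversion])
        (use nz Im_inversion in auto)
    show "(g (- 1 / \<tau>) / h \<tau>) ^ 6 = 1" if \<tau>: "\<tau> \<in> upper_half_plane" for \<tau>
    proof -
      obtain \<kappa> where "\<kappa> ^ 3 = 1" "g (- 1 / \<tau>) ^ 2 = \<kappa> * h \<tau> ^ 2" using eq[OF \<tau>] by blast
      moreover have "(g (- 1 / \<tau>) / h \<tau>) ^ 6 = (g (- 1 / \<tau>) ^ 2) ^ 3 / (h \<tau> ^ 2) ^ 3"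
        by (simp add: power_divide power_mult [symmetric])
      ultimately show ?thesis using nz[OF \<tau>] by (simp only: power_mult_distrib) simp
    qed
  qed simp
  then obtain c where c: "\<And>\<tau>. \<tau> \<in> upper_half_plane \<Longrightarrow> g (- 1 / \<tau>) = c * h \<tau>"
    using nz by (metis nonzero_divide_eq_eq)
  obtain \<kappa> where "\<kappa> ^ 3 = 1" "g (- 1 / \<i>) ^ 2 = \<kappa> * h \<i> ^ 2" using eq[OF ii_upper_half_plane] by blast
  with c[OF ii_upper_half_plane] nz[OF ii_upper_half_plane] have "c \<noteq> 0" by auto
  with c show ?thesis by blast
qed

lemma weber_inversion:
  shows "\<exists>c. c \<noteq> 0 \<and> (\<forall>\<tau>\<in>upper_half_plane. weber_f (- 1 / \<tau>) = c * weber_f \<tau>)"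
    and "\<exists>c. c \<noteq> 0 \<and> (\<forall>\<tau>\<in>upper_half_plane. weber_f1 (- 1 / \<tau>) = c * weber_f2 \<tau>)"
    and "\<exists>c. c \<noteq> 0 \<and> (\<forall>\<tau>\<in>upper_half_plane. weber_f2 (- 1 / \<tau>) = c * weber_f1 \<tau>)"
proof -
  have sq: "\<exists>\<kappa>. \<kappa> ^ 3 = 1 \<and> weber_f (- 1 / \<tau>) ^ 2 = \<kappa> * weber_f \<tau> ^ 2"
    "\<exists>\<kappa>. \<kappa> ^ 3 = 1 \<and> weber_f1 (- 1 / \<tau>) ^ 2 = \<kappa> * weber_f2 \<tau> ^ 2"
    "\<exists>\<kappa>. \<kappa> ^ 3 = 1 \<and> weber_f2 (- 1 / \<tau>) ^ 2 = \<kappa> * weber_f1 \<tau> ^ 2"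
    if "\<tau> \<in> upper_half_plane" for \<tau>
  proof -
    have "Im \<tau> > 0" using that by simp
    from weber_sq_inversion[OF this] obtain \<kappa> where
      "\<kappa> ^ 3 = 1 \<and> weber_f (- 1 / \<tau>) ^ 2 = \<kappa> * weber_f \<tau> ^ 2 \<and>
       weber_f1 (- 1 / \<tau>) ^ 2 = \<kappa> * weber_f2 \<tau> ^ 2 \<and> weber_f2 (- 1 / \<tau>) ^ 2 = \<kappa> * weber_f1 \<tau> ^ 2" ..
    then show "\<exists>\<kappa>. \<kappa> ^ 3 = 1 \<and> weber_f (- 1 / \<tau>) ^ 2 = \<kappa> * weber_f \<tau> ^ 2"
      "\<exists>\<kappa>. \<kappa> ^ 3 = 1 \<and> weber_f1 (- 1 / \<tau>) ^ 2 = \<kappa> * weber_f2 \<tau> ^ 2"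
      "\<exists>\<kappa>. \<kappa> ^ 3 = 1 \<and> weber_f2 (- 1 / \<tau>) ^ 2 = \<kappa> * weber_f1 \<tau> ^ 2" by blast+
  qed
  have nz: "weber_f \<tau> \<noteq> 0" "weber_f1 \<tau> \<noteq> 0" "weber_f2 \<tau> \<noteq> 0" if "\<tau> \<in> upper_half_plane" for \<tau>
    using weber_nonzero[of \<tau>] that by auto
  show "\<exists>c. c \<noteq> 0 \<and> (\<forall>\<tau>\<in>upper_half_plane. weber_f (- 1 / \<tau>) = c * weber_f \<tau>)"
    by (rule weber_ratio_constant[OF holomorphic_weber(1,1) nz(1) sq(1)])
  show "\<exists>c. c \<noteq> 0 \<and> (\<forall>\<tau>\<in>upper_half_plane. weber_f1 (- 1 / \<tau>) = c * weber_f2 \<tau>)"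
    by (rule weber_ratio_constant[OF holomorphic_weber(2,3) nz(3) sq(2)])
  show "\<exists>c. c \<noteq> 0 \<and> (\<forall>\<tau>\<in>upper_half_plane. weber_f2 (- 1 / \<tau>) = c * weber_f1 \<tau>)"
    by (rule weber_ratio_constant[OF holomorphic_weber(3,2) nz(2) sq(3)])
qed

text \<open>The translations are even because \<tau> + 1 exchanges f and f1 up to a constant,
  whereas an element of \<open>Gamma_weber n\<close> must preserve each function up to a
  constant.\<close>

lemma weber_shift:
  assumes "Im \<tau> > 0"
  shows "weber_f (\<tau> + 2 * of_int k) = ee (- of_int k / 24) * weber_f \<tau>"
    and "weber_f1 (\<tau> + 2 * of_int k) = ee (- of_int k / 24) * weber_f1 \<tau>"
    and "weber_f2 (\<tau> + 2 * of_int k) = ee (of_int k / 12) * weber_f2 \<tau>"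
proof -
  have Im: "Im (\<tau> + 2 * of_int k) > 0" using assms by simp
  have e1: "ee ((\<tau> + 2 * of_int k) / 2) = ee (\<tau> / 2)" by (simp add: add_divide_distrib ee_add)
  have e2: "ee (\<tau> + 2 * of_int k) = ee \<tau>" using ee_of_int[of "2 * k"] by (simp add: ee_add)
  have e3: "ee (- (\<tau> + 2 * of_int k) / 48) = ee (- of_int k / 24) * ee (- \<tau> / 48)"
    unfolding ee_add [symmetric] by (rule arg_cong[of _ _ ee]) (simp add: field_simps)
  have e4: "ee ((\<tau> + 2 * of_int k) / 24) = ee (of_int k / 12) * ee (\<tau> / 24)"
    unfolding ee_add [symmetric] by (rule arg_cong[of _ _ ee]) (simp add: field_simps)
  show "weber_f (\<tau> + 2 * of_int k) = ee (- of_int k / 24) * weber_f \<tau>"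
    "weber_f1 (\<tau> + 2 * of_int k) = ee (- of_int k / 24) * weber_f1 \<tau>"
    "weber_f2 (\<tau> + 2 * of_int k) = ee (of_int k / 12) * weber_f2 \<tau>"
    unfolding weber_f_eq[OF Im] weber_f1_eq[OF Im] weber_f2_eq[OF Im]
      weber_f_eq[OF assms] weber_f1_eq[OF assms] weber_f2_eq[OF assms] e1 e2 e3 e4
    by (simp_all only: mult_ac)
qed

text \<open>An index allows the three functions to be treated uniformly; every index from 2 on
  denotes \<open>u2\<close>.\<close>

definition uw :: "nat \<Rightarrow> complex \<Rightarrow> complex" where
  "uw i = (if i = 0 then u0 else if i = 1 then u1 else u2)"

lemma zeta_nonzero [simp]: "\<zeta> k \<noteq> 0"
  by (simp add: zeta_eq)

lemma less_3_cases: "i < 3 \<longleftrightarrow> i = 0 \<or> i = 1 \<or> i = (2::nat)"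
  by auto

lemma uw_holomorphic: "uw i holomorphic_on upper_half_plane"
  unfolding uw_def u0_def u1_def[abs_def] u2_def[abs_def]
  by (auto intro!: holomorphic_intros holomorphic_weber)

lemma uw_nonzero: "Im \<tau> > 0 \<Longrightarrow> uw i \<tau> \<noteq> 0"
  by (simp add: uw_def u0_def u1_def u2_def weber_nonzero)

lemma uw_mult: "Im \<tau> > 0 \<Longrightarrow> uw 0 \<tau> * uw 1 \<tau> * uw 2 \<tau> = of_real (sqrt 2)"
  using weber_mult[of \<tau>] by (simp add: uw_def u0_def u1_def u2_def mult_ac)

text \<open>The constants \<zeta> 16 and its inverse, with eighth power -1, bring Jacobi's identity
  into symmetric form.\<close>

lemma uw_sum: "Im \<tau> > 0 \<Longrightarrow> uw 0 \<tau> ^ 8 + uw 1 \<tau> ^ 8 + uw 2 \<tau> ^ 8 = 0"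
proof -
  assume "Im \<tau> > 0"
  moreover have z: "\<zeta> 16 ^ 8 = - 1" by (simp add: zeta_eq ee_power)
  then have "inverse (\<zeta> 16) ^ 8 = - 1" by (simp add: power_inverse)
  ultimately show ?thesis using weber_jacobi[of \<tau>] z
    by (simp add: uw_def u0_def u1_def u2_def power_mult_distrib)
qed

text \<open>The multiplier of the i-th function under \<tau> -> \<tau> + 2, as an exponent of ee
  (1/24). The three weights have sum 0, in agreement with the constant product, and are equal modulo
  3.\<close>

definition shift_weight :: "nat \<Rightarrow> int" where
  "shift_weight i = (if i = 2 then 2 else - 1)"

lemma uw_shift:
  assumes "Im \<tau> > 0" "i < 3"
  shows "uw i (\<tau> + 2 * of_int k) = ee (of_int (shift_weight i * k) / 24) * uw i \<tau>"
  using weber_shift[OF assms(1), of k] assms(2)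
  by (auto simp: less_3_cases uw_def u0_def u1_def u2_def shift_weight_def)

text \<open>The permutation induced by the inversion: it fixes 0 and exchanges 1 and 2.\<close>

definition inv_index :: "nat \<Rightarrow> nat" where
  "inv_index i = (if i = 0 then 0 else 3 - i)"

lemma uw_inversion:
  assumes "i < 3"
  shows "\<exists>c. c \<noteq> 0 \<and> (\<forall>\<tau>. Im \<tau> > 0 \<longrightarrow> uw i (- 1 / \<tau>) = c * uw (inv_index i) \<tau>)"
proof -
  obtain c0 c1 c2 where c: "c0 \<noteq> 0" "c1 \<noteq> 0" "c2 \<noteq> 0"
    and eq: "\<And>\<tau>. Im \<tau> > 0 \<Longrightarrow> weber_f (- 1 / \<tau>) = c0 * weber_f \<tau>"
     "\<And>\<tau>. Im \<tau> > 0 \<Longrightarrow> weber_f1 (- 1 / \<tau>) = c1 * weber_f2 \<tau>"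
     "\<And>\<tau>. Im \<tau> > 0 \<Longrightarrow> weber_f2 (- 1 / \<tau>) = c2 * weber_f1 \<tau>"
    using weber_inversion by auto
  from assms consider "i = 0" | "i = 1" | "i = 2" by linarith
  then show ?thesis
  proof cases
    case 1
    then show ?thesis using c eq by (intro exI[of _ c0]) (simp add: uw_def inv_index_def u0_def)
  next
    case 2
    then show ?thesis using c eq
      by (intro exI[of _ "\<zeta> 16 ^ 2 * c1"]) (simp add: uw_def inv_index_def u1_def u2_def power2_eq_square)
  next
    case 3
    then show ?thesis using c eq
      by (intro exI[of _ "inverse (\<zeta> 16) ^ 2 * c2"]) (simp add: uw_def inv_index_def u1_def u2_def power2_eq_square)
  qed
qed

text \<open>The matrix \<open>(1 0; - 2 k 1)\<close> is a conjugate of \<open>(1 2 k; 0 1)\<close> by the inversion, so the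
  constants of \<open>uw_inversion\<close> cancel.\<close>

lemma uw_lower_shift:
  assumes "Im \<tau> > 0" "i < 3"
  shows "uw i (\<tau> / (- 2 * of_int k * \<tau> + 1)) = ee (of_int (shift_weight (inv_index i) * k) / 24) * uw i \<tau>"
proof -
  have \<tau>0: "\<tau> \<noteq> 0" using assms by auto
  have i: "inv_index i < 3" using assms by (simp add: inv_index_def)
  define \<sigma> where "\<sigma> = - 1 / \<tau>"
  have \<sigma>: "Im \<sigma> > 0" unfolding \<sigma>_def by (rule Im_inversion) fact
  obtain c where c: "c \<noteq> 0" "\<And>\<tau>. Im \<tau> > 0 \<Longrightarrow> uw i (- 1 / \<tau>) = c * uw (inv_index i) \<tau>"
    using uw_inversion[OF assms(2)] by blast
  have "- 1 / (\<sigma> + 2 * of_int k) = \<tau> / (- 2 * of_int k * \<tau> + 1)"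
  proof -
    have 1: "- 1 / (- X / \<tau>) = \<tau> / X" for X :: complex by simp
    have 2: "- 1 / \<tau> + 2 * K = - (- 2 * K * \<tau> + 1) / \<tau>" for K :: complex
      using \<tau>0 by (simp add: field_simps)
    show ?thesis unfolding \<sigma>_def 2 1 ..
  qed
  then have "uw i (\<tau> / (- 2 * of_int k * \<tau> + 1)) = c * uw (inv_index i) (\<sigma> + 2 * of_int k)"
    using c(2)[of "\<sigma> + 2 * of_int k"] \<sigma> by simp
  also have "\<dots> = ee (of_int (shift_weight (inv_index i) * k) / 24) * (c * uw (inv_index i) \<sigma>)"
    by (simp add: uw_shift[OF \<sigma> i])
  also have "c * uw (inv_index i) \<sigma> = uw i (- 1 / \<sigma>)" using c(2)[OF \<sigma>] by simp
  also have "- 1 / \<sigma> = \<tau>" by (simp add: \<sigma>_def)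
  finally show ?thesis .
qed

text \<open>If a power were constant, connectedness would make the function itself constant; but
  translation by 2 multiplies it by ee (-1/24) or ee (1/12), neither of which is 1.\<close>

lemma uw_not_constant:
  assumes "i < 3" "m > 0"
  shows "\<not> (\<exists>c. \<forall>\<tau>. Im \<tau> > 0 \<longrightarrow> uw i \<tau> ^ m = c)"
proof
  assume "\<exists>c. \<forall>\<tau>. Im \<tau> > 0 \<longrightarrow> uw i \<tau> ^ m = c"
  then obtain c where c: "\<And>\<tau>. Im \<tau> > 0 \<Longrightarrow> uw i \<tau> ^ m = c" by blast
  have "\<exists>d. \<forall>\<tau>\<in>upper_half_plane. uw i \<tau> / uw i \<i> = d"
  proof (rule continuous_root_of_unity_constant[OF connected_upper_half_plane _ assms(2)])
    show "continuous_on upper_half_plane (\<lambda>\<tau>. uw i \<tau> / uw i \<i>)"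
      using holomorphic_on_imp_continuous_on[OF uw_holomorphic] uw_nonzero[of \<i>]
      by (intro continuous_intros) auto
    show "(uw i \<tau> / uw i \<i>) ^ m = 1" if "\<tau> \<in> upper_half_plane" for \<tau>
      using c[of \<tau>] c[of \<i>] that uw_nonzero[of \<i> i] by (auto simp: power_divide)
  qed
  then obtain d where "\<forall>\<tau>\<in>upper_half_plane. uw i \<tau> / uw i \<i> = d" ..
  from bspec[OF this, of "\<i> + 2 * of_int 1"] bspec[OF this, of \<i>]
  have "uw i (\<i> + 2 * of_int 1) / uw i \<i> = uw i \<i> / uw i \<i>" by simp
  then have "ee (of_int (shift_weight i) / 24) = 1"
    using uw_shift[of \<i> i 1] assms uw_nonzero[of \<i> i] by simp
  then obtain n :: int where "of_int (shift_weight i) / 24 = (of_int n :: complex)" by (rule ee_eq_1D)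
  then have "(of_int (shift_weight i) :: complex) = of_int (24 * n)" by (simp add: field_simps)
  then have "shift_weight i = 24 * n" by (simp only: of_int_eq_iff)
  then show False unfolding shift_weight_def by (auto split: if_splits)  presburger+
qed

subsection \<open>Meromorphic functions on the upper half plane\<close>

text \<open>The prescribed value 0 outside the half plane makes equality in the type the same as
  equality on the half plane.\<close>

typedef holo = "{f. f holomorphic_on upper_half_plane \<and> (\<forall>z. z \<notin> upper_half_plane \<longrightarrow> f z = 0)}"
  morphisms hfun Abs_holo
  by (rule exI[of _ "\<lambda>_. 0"]) auto

definition mk_holo :: "(complex \<Rightarrow> complex) \<Rightarrow> holo" where
  "mk_holo f = Abs_holo (\<lambda>z. if z \<in> upper_half_plane then f z else 0)"

lemma holomorphic_hfun: "hfun a holomorphic_on upper_half_plane"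
  using hfun[of a] by simp

lemma hfun_outside: "z \<notin> upper_half_plane \<Longrightarrow> hfun a z = 0"
  using hfun[of a] by simp

lemma holo_eqI:
  assumes "\<And>z. Im z > 0 \<Longrightarrow> hfun a z = hfun b z"
  shows "a = b"
proof -
  have "hfun a z = hfun b z" for z
    using assms[of z] hfun_outside[of z a] hfun_outside[of z b] by (cases "Im z > 0") auto
  then show ?thesis by (simp add: hfun_inject [symmetric] fun_eq_iff)
qed

lemma hfun_mk_holo:
  assumes "f holomorphic_on upper_half_plane" "Im z > 0"
  shows "hfun (mk_holo f) z = f z"
proof -
  have "(\<lambda>z. if z \<in> upper_half_plane then f z else 0) holomorphic_on upper_half_plane"
    using assms(1) by (rule holomorphic_transform) simp
  then show ?thesis using assms(2) by (simp add: mk_holo_def Abs_holo_inverse)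
qed

text \<open>Absence of zero divisors is the identity theorem on a connected set; it takes the place
  of irreducibility of the Weber curves.\<close>

instantiation holo :: idom
begin

definition "0 = mk_holo (\<lambda>_. 0)"
definition "1 = mk_holo (\<lambda>_. 1)"
definition "a + b = mk_holo (\<lambda>z. hfun a z + hfun b z)"
definition "a - b = mk_holo (\<lambda>z. hfun a z - hfun b z)"
definition "- a = mk_holo (\<lambda>z. - hfun a z)"
definition "a * b = mk_holo (\<lambda>z. hfun a z * hfun b z)"

lemma hfun_ops:
  assumes "Im z > 0"
  shows "hfun 0 z = 0" "hfun 1 z = 1" "hfun (a + b) z = hfun a z + hfun b z"
    "hfun (a - b) z = hfun a z - hfun b z" "hfun (- a) z = - hfun a z"
    "hfun (a * b) z = hfun a z * hfun b z"
  unfolding zero_holo_def one_holo_def plus_holo_def minus_holo_def uminus_holo_def times_holo_def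
  by (simp_all add: hfun_mk_holo assms holomorphic_hfun holomorphic_on_add holomorphic_on_diff
      holomorphic_on_mult holomorphic_on_minus)

instance
proof
  show "(0::holo) \<noteq> 1"
    using hfun_ops(1,2)[of \<i>] by (metis imaginary_unit.sel(2) zero_less_one zero_neq_one)
  fix a b :: holo
  assume "a \<noteq> 0" "b \<noteq> 0"
  show "a * b \<noteq> 0"
  proof
    assume 0: "a * b = 0"
    have "hfun a z * hfun b z = 0" if "z \<in> upper_half_plane" for z
      using that arg_cong[OF 0, of "\<lambda>c. hfun c z"] by (simp add: hfun_ops)
    then have "(\<forall>z\<in>upper_half_plane. hfun a z = 0) \<or> (\<forall>z\<in>upper_half_plane. hfun b z = 0)"
      by (intro holomorphic_mult_eq_0 holomorphic_hfun open_upper_half_plane connected_upper_half_plane)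
    then have "a = 0 \<or> b = 0" by (auto intro!: holo_eqI simp: hfun_ops)
    with \<open>a \<noteq> 0\<close> \<open>b \<noteq> 0\<close> show False by blast
  qed
qed (auto intro!: holo_eqI simp: hfun_ops algebra_simps)

end

lemma hfun_power: "Im z > 0 \<Longrightarrow> hfun (a ^ n) z = hfun a z ^ n"
  by (induction n) (simp_all add: hfun_ops)

definition hconst :: "complex \<Rightarrow> holo" where "hconst c = mk_holo (\<lambda>_. c)"

lemma hfun_hconst: "Im z > 0 \<Longrightarrow> hfun (hconst c) z = c"
  by (simp add: hconst_def hfun_mk_holo)

type_synonym mero = "holo fract"

definition emb :: "holo \<Rightarrow> mero" where "emb a = Fract a 1"

lemma emb_simps: "emb 0 = 0" "emb 1 = 1" "emb (a + b) = emb a + emb b" "emb (a - b) = emb a - emb b"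
  "emb (- a) = - emb a" "emb (a * b) = emb a * emb b" "emb a = emb b \<longleftrightarrow> a = b" "emb a = 0 \<longleftrightarrow> a = 0"
  by (simp_all add: emb_def eq_fract Zero_fract_def One_fract_def)

lemma emb_power: "emb (a ^ n) = emb a ^ n"
  by (induction n) (simp_all add: emb_simps)

definition cst :: "complex \<Rightarrow> mero" where "cst c = emb (hconst c)"

lemma cst_simps: "cst 0 = 0" "cst 1 = 1" "cst (a + b) = cst a + cst b" "cst (- a) = - cst a"
  "cst (a * b) = cst a * cst b" "cst a = cst b \<longleftrightarrow> a = b" "cst a = 0 \<longleftrightarrow> a = 0"
proof -
  show *: "cst a = cst b \<longleftrightarrow> a = b" for a b
    unfolding cst_def emb_simps using hfun_hconst[of \<i>] by (metis imaginary_unit.sel(2) zero_less_one)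
  show 0: "cst 0 = 0" unfolding cst_def emb_simps by (rule holo_eqI) (simp add: hfun_hconst hfun_ops)
  show "cst a = 0 \<longleftrightarrow> a = 0" using * 0 by metis
  show "cst 1 = 1" unfolding cst_def emb_simps(2)[symmetric] emb_simps(7)
    by (rule holo_eqI) (simp add: hfun_hconst hfun_ops)
  show "cst (a + b) = cst a + cst b" "cst (- a) = - cst a" "cst (a * b) = cst a * cst b"
    unfolding cst_def emb_simps(3,5,6)[symmetric] emb_simps(7)
    by (rule holo_eqI; simp add: hfun_hconst hfun_ops)+
qed

lemma cst_power: "cst (a ^ n) = cst a ^ n"
  by (induction n) (simp_all add: cst_simps)

lemma cst_of_nat: "cst (of_nat n) = of_nat n"
  by (induction n) (simp_all add: cst_simps)

text \<open>An \<^term>\<open>m\<close>-th root of unity among the meromorphic functions is constant, because there are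
  already \<^term>\<open>m\<close> constant ones.\<close>

lemma root_of_unity_constant:
  fixes a :: mero
  assumes "m > 0" "a ^ m = 1"
  shows "\<exists>c. c ^ m = 1 \<and> a = cst c"
proof -
  define p where "p = Polynomial.monom (1::mero) m - 1"
  have "Polynomial.coeff p m = 1" using assms(1) by (simp add: p_def)
  then have p0: "p \<noteq> 0" by auto
  have dp: "Polynomial.degree p \<le> m"
    unfolding p_def by (intro degree_diff_le) (simp_all add: degree_monom_le)
  have roots: "{a. poly p a = 0} = {a. a ^ m = 1}" by (simp add: p_def poly_monom)
  have "finite {a::mero. a ^ m = 1}" unfolding roots[symmetric] by (rule poly_roots_finite[OF p0])
  moreover have "card {a::mero. a ^ m = 1} \<le> m"
    using card_poly_roots_bound[OF p0] dp unfolding roots by linarith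
  moreover have "cst ` {c. c ^ m = 1} \<subseteq> {a. a ^ m = 1}"
    by (auto simp: cst_power[symmetric] cst_simps)
  moreover have "card (cst ` {c. c ^ m = 1}) = m"
    using assms(1) by (subst card_image) (auto simp: inj_on_def cst_simps card_roots_unity_eq)
  ultimately have "cst ` {c. c ^ m = 1} = {a. a ^ m = 1}" by (intro card_seteq) auto
  with assms(2) show ?thesis by blast
qed

subsection \<open>Kummer extensions\<close>

text \<open>Subfields are plain sets in a type-class field, so that calculations use ordinary field
  arithmetic. Closure under \<open>inverse\<close> can be demanded without exception because inverse
  0 = 0.\<close>

definition subfld :: "'a::field set \<Rightarrow> bool" where
  "subfld L \<longleftrightarrow> 1 \<in> L \<and> (\<forall>a\<in>L. \<forall>b\<in>L. a + b \<in> L \<and> a * b \<in> L) \<and> (\<forall>a\<in>L. - a \<in> L \<and> inverse a \<in> L)"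

inductive_set gen :: "'a::field set \<Rightarrow> 'a set" for S where
  gen_incl: "a \<in> S \<Longrightarrow> a \<in> gen S"
| gen_one: "1 \<in> gen S"
| gen_add: "a \<in> gen S \<Longrightarrow> b \<in> gen S \<Longrightarrow> a + b \<in> gen S"
| gen_mult: "a \<in> gen S \<Longrightarrow> b \<in> gen S \<Longrightarrow> a * b \<in> gen S"
| gen_minus: "a \<in> gen S \<Longrightarrow> - a \<in> gen S"
| gen_inverse: "a \<in> gen S \<Longrightarrow> inverse a \<in> gen S"

lemma subfld_gen: "subfld (gen S)"
  by (simp add: subfld_def gen.intros)

lemma gen_least: "subfld L \<Longrightarrow> S \<subseteq> L \<Longrightarrow> gen S \<subseteq> L"
proof
  fix a assume "subfld L" "S \<subseteq> L" "a \<in> gen S"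
  from this(3) show "a \<in> L"
    by induction (use \<open>subfld L\<close> \<open>S \<subseteq> L\<close> in \<open>auto simp: subfld_def\<close>)
qed

lemma
  assumes "subfld L"
  shows subfld_0: "0 \<in> L" and subfld_1: "1 \<in> L"
    and subfld_add: "a \<in> L \<Longrightarrow> b \<in> L \<Longrightarrow> a + b \<in> L"
    and subfld_diff: "a \<in> L \<Longrightarrow> b \<in> L \<Longrightarrow> a - b \<in> L"
    and subfld_mult: "a \<in> L \<Longrightarrow> b \<in> L \<Longrightarrow> a * b \<in> L"
    and subfld_minus: "a \<in> L \<Longrightarrow> - a \<in> L"
    and subfld_inverse: "a \<in> L \<Longrightarrow> inverse a \<in> L"
    and subfld_divide: "a \<in> L \<Longrightarrow> b \<in> L \<Longrightarrow> a / b \<in> L"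
    and subfld_power: "a \<in> L \<Longrightarrow> a ^ n \<in> L"
    and subfld_sum: "(\<And>i. i \<in> I \<Longrightarrow> f i \<in> L) \<Longrightarrow> sum f I \<in> L"
proof -
  show one: "1 \<in> L" and add: "a \<in> L \<Longrightarrow> b \<in> L \<Longrightarrow> a + b \<in> L"
    and mult: "a \<in> L \<Longrightarrow> b \<in> L \<Longrightarrow> a * b \<in> L" and minus: "a \<in> L \<Longrightarrow> - a \<in> L"
    and inv: "a \<in> L \<Longrightarrow> inverse a \<in> L" for a b
    using assms by (auto simp: subfld_def)
  show zero: "0 \<in> L" using add[OF one minus[OF one]] by simp
  show "a \<in> L \<Longrightarrow> b \<in> L \<Longrightarrow> a - b \<in> L" using add minus by (metis diff_conv_add_uminus)
  show "a \<in> L \<Longrightarrow> b \<in> L \<Longrightarrow> a / b \<in> L" using mult inv by (metis divide_inverse)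
  show "a \<in> L \<Longrightarrow> a ^ n \<in> L" by (induction n) (auto simp: one mult)
  show "(\<And>i. i \<in> I \<Longrightarrow> f i \<in> L) \<Longrightarrow> sum f I \<in> L"
    by (induction I rule: infinite_finite_induct) (auto simp: zero add)
qed

definition field_hom :: "('a::field \<Rightarrow> 'b::field) \<Rightarrow> bool" where
  "field_hom f \<longleftrightarrow> f 1 = 1 \<and> (\<forall>a b. f (a + b) = f a + f b) \<and> (\<forall>a b. f (a * b) = f a * f b)"

lemma
  assumes "field_hom f"
  shows field_hom_1: "f 1 = 1" and field_hom_add: "f (a + b) = f a + f b"
    and field_hom_mult: "f (a * b) = f a * f b" and field_hom_0: "f 0 = 0"
    and field_hom_minus: "f (- a) = - f a" and field_hom_eq_0: "f a = 0 \<longleftrightarrow> a = 0"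
    and field_hom_inverse: "f (inverse a) = inverse (f a)"
    and field_hom_power: "f (a ^ n) = f a ^ n"
    and field_hom_sum: "f (sum g I) = (\<Sum>i\<in>I. f (g i))"
    and field_hom_prod: "f (prod g I) = (\<Prod>i\<in>I. f (g i))"
proof -
  show one: "f 1 = 1" and add: "f (a + b) = f a + f b" and mult: "f (a * b) = f a * f b" for a b
    using assms by (auto simp: field_hom_def)
  have "f 0 + f 0 = f 0 + 0" using add[of 0 0] by simp
  then show zero: "f 0 = 0" by (simp only: add_left_cancel)
  show "f (- a) = - f a" using add[of "- a" a] zero by (simp add: eq_neg_iff_add_eq_0)
  show eq0: "f a = 0 \<longleftrightarrow> a = 0" for a
    using mult[of a "inverse a"] zero one by (cases "a = 0") auto
  show "f (inverse a) = inverse (f a)"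
    using mult[of a "inverse a"] zero one by (cases "a = 0") (auto simp: inverse_unique)
  show "f (a ^ n) = f a ^ n" by (induction n) (simp_all add: one mult)
  show "f (sum g I) = (\<Sum>i\<in>I. f (g i))"
    by (induction I rule: infinite_finite_induct) (simp_all add: zero add)
  show "f (prod g I) = (\<Prod>i\<in>I. f (g i))"
    by (induction I rule: infinite_finite_induct) (simp_all add: one mult)
qed

lemma field_hom_gen_eq:
  assumes "field_hom f" "field_hom g" "\<And>a. a \<in> S \<Longrightarrow> f a = g a" "a \<in> gen S"
  shows "f a = g a"
  using assms(4)
  by induction (simp_all add: assms(3) field_hom_1[OF assms(1)] field_hom_1[OF assms(2)]
      field_hom_add[OF assms(1)] field_hom_add[OF assms(2)]
      field_hom_mult[OF assms(1)] field_hom_mult[OF assms(2)]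
      field_hom_minus[OF assms(1)] field_hom_minus[OF assms(2)]
      field_hom_inverse[OF assms(1)] field_hom_inverse[OF assms(2)])

text \<open>Degree m is forced by \<sigma>: its eigenvalues on the powers of y below y^m are the
  distinct powers of the primitive root of unity \<omega>.\<close>

locale kummer =
  fixes L :: "'a::field set" and y \<omega> :: 'a and m :: nat and \<sigma> :: "'a \<Rightarrow> 'a"
  assumes L: "subfld L" and m: "m > 0" "(of_nat m :: 'a) \<noteq> 0"
    and y: "y \<noteq> 0" "y ^ m \<in> L"
    and \<omega>: "\<omega> \<in> L" "\<omega> ^ m = 1" "\<And>i. 0 < i \<Longrightarrow> i < m \<Longrightarrow> \<omega> ^ i \<noteq> 1"
    and \<sigma>: "field_hom \<sigma>" "\<And>a. a \<in> L \<Longrightarrow> \<sigma> a = a" "\<sigma> y = \<omega> * y"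
begin

text \<open>The length k varies so that the dimension can be counted by adding one power of y at a
  time.\<close>

definition lin :: "nat \<Rightarrow> 'a set" where
  "lin k = {\<Sum>i<k. l i * y ^ i | l. \<forall>i. l i \<in> L}"

lemma iterate_power: "(\<sigma> ^^ k) (\<Sum>i<n. l i * y ^ i) = (\<Sum>i<n. l i * (\<omega> ^ k) ^ i * y ^ i)"
  if "\<forall>i. l i \<in> L"
proof (induction k)
  case (Suc k)
  have "(\<sigma> ^^ Suc k) (\<Sum>i<n. l i * y ^ i) = \<sigma> (\<Sum>i<n. l i * (\<omega> ^ k) ^ i * y ^ i)"
    by (simp add: Suc)
  also have "\<dots> = (\<Sum>i<n. l i * (\<omega> ^ Suc k) ^ i * y ^ i)"
    unfolding field_hom_sum[OF \<sigma>(1)]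
  proof (rule sum.cong)
    fix i
    have "l i * (\<omega> ^ k) ^ i \<in> L" using that \<omega>(1) L by (intro subfld_mult subfld_power) auto
    then have "\<sigma> (l i * (\<omega> ^ k) ^ i * y ^ i) = l i * (\<omega> ^ k) ^ i * (\<omega> * y) ^ i"
      using \<sigma>(2) by (simp only: field_hom_mult[OF \<sigma>(1), of "l i * (\<omega> ^ k) ^ i"] field_hom_power[OF \<sigma>(1)] \<sigma>(3))
    then show "\<sigma> (l i * (\<omega> ^ k) ^ i * y ^ i) = l i * (\<omega> ^ Suc k) ^ i * y ^ i"
      by (simp add: power_mult_distrib mult_ac)
  qed simp
  finally show ?case .
qed simp

lemma omega_power_eq_1: "\<omega> ^ n = 1 \<longleftrightarrow> m dvd n"
proof -
  have "\<omega> ^ n = \<omega> ^ (m * (n div m) + n mod m)" by simp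
  also have "\<dots> = \<omega> ^ (n mod m)" unfolding power_add power_mult \<omega>(2) by simp
  finally have "\<omega> ^ n = \<omega> ^ (n mod m)" .
  moreover have "\<omega> ^ (n mod m) = 1 \<longleftrightarrow> n mod m = 0"
    using \<omega>(3)[of "n mod m"] m(1) by (cases "n mod m = 0") auto
  ultimately show ?thesis by (simp add: dvd_eq_mod_eq_0)
qed

lemma sum_omega_powers: "(\<Sum>k<m. (\<omega> ^ n) ^ k) = (if m dvd n then of_nat m else 0)"
proof (cases "m dvd n")
  case True
  then have "\<omega> ^ n = 1" by (simp add: omega_power_eq_1)
  then show ?thesis using True by simp
next
  case False
  have "(\<omega> ^ n) ^ m = 1" using \<omega>(2) by (metis power_mult mult.commute power_one)
  then have "(\<omega> ^ n - 1) * (\<Sum>k<m. (\<omega> ^ n) ^ k) = 0"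
    using power_diff_1_eq[of "\<omega> ^ n" m] by simp
  then show ?thesis using False by (simp add: omega_power_eq_1)
qed

text \<open>Orthogonality of characters: the iterates of \<sigma>, weighted by powers of the inverse
  of \<omega>^j and summed, project onto m times the j-th term. The exponent m - j stands for -
  j.\<close>

lemma lin_independent:
  assumes l: "\<forall>i. l i \<in> L" and 0: "(\<Sum>i<m. l i * y ^ i) = 0" and j: "j < m"
  shows "l j = 0"
proof -
  have "0 = (\<Sum>k<m. (\<omega> ^ (m - j)) ^ k * (\<sigma> ^^ k) (\<Sum>i<m. l i * y ^ i))"
  proof -
    have "(\<sigma> ^^ k) 0 = 0" for k by (induction k) (simp_all add: field_hom_0[OF \<sigma>(1)])
    then show ?thesis unfolding 0 by simp
  qed
  also have "\<dots> = (\<Sum>k<m. \<Sum>i<m. (\<omega> ^ (m - j + i)) ^ k * (l i * y ^ i))"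
    unfolding iterate_power[OF l] sum_distrib_left
    by (intro sum.cong refl) (simp add: power_add power_mult_distrib power_mult[symmetric] mult_ac)
  also have "\<dots> = (\<Sum>i<m. (\<Sum>k<m. (\<omega> ^ (m - j + i)) ^ k) * (l i * y ^ i))"
    unfolding sum_distrib_right by (rule sum.swap)
  also have "\<dots> = (\<Sum>i<m. if i = j then of_nat m * (l i * y ^ i) else 0)"
  proof (rule sum.cong[OF refl])
    fix i assume "i \<in> {..<m}"
    then have i: "i < m" by simp
    have "m dvd m - j + i \<longleftrightarrow> i = j"
    proof
      assume "m dvd m - j + i"
      then obtain q where q: "m - j + i = m * q" by (elim dvdE)
      \<comment> \<open>As i, j < m, the number m - j + i lies strictly between 0 and 2 m.\<close>
      have "0 < m * q" "m * q < m * 2" using i j q by linarith+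
      then have "q > 0" "q < 2" by auto
      then have "q = 1" by simp
      then show "i = j" using q j i by simp
    qed (use j in simp)
    then show "(\<Sum>k<m. (\<omega> ^ (m - j + i)) ^ k) * (l i * y ^ i) = (if i = j then of_nat m * (l i * y ^ i) else 0)"
      unfolding sum_omega_powers by simp
  qed
  also have "\<dots> = of_nat m * (l j * y ^ j)" using j by simp
  finally show ?thesis using m(2) y(1) by simp
qed

text \<open>The coefficients of a - \<sigma> a are those of a multiplied by 1 - \<omega>^i, which is
  nonzero for 0 < i < m.\<close>

lemma lin_fixed:
  assumes "a \<in> lin m" "\<sigma> a = a"
  shows "a \<in> L"
proof -
  obtain l where l: "\<forall>i. l i \<in> L" and a: "a = (\<Sum>i<m. l i * y ^ i)"
    using assms(1) by (auto simp: lin_def)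
  define l' where "l' i = l i * (1 - \<omega> ^ i)" for i
  have l'L: "\<forall>i. l' i \<in> L" unfolding l'_def using l \<omega>(1) L
    by (auto intro!: subfld_mult subfld_diff subfld_power subfld_1)
  have "\<sigma> a = (\<Sum>i<m. l i * \<omega> ^ i * y ^ i)" using iterate_power[OF l, of 1 m] by (simp add: a)
  then have "(\<Sum>i<m. l' i * y ^ i) = a - \<sigma> a"
    by (simp add: a l'_def algebra_simps sum_subtractf)
  then have "(\<Sum>i<m. l' i * y ^ i) = 0" using assms(2) by simp
  from lin_independent[OF l'L this] have "l i = 0" if "0 < i" "i < m" for i
    using \<omega>(3)[OF that] that by (auto simp: l'_def)
  then have "a = (\<Sum>i<m. if i = 0 then l 0 else 0)" unfolding a by (intro sum.cong) auto
  then show ?thesis using m l by simp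
qed

lemma lin_add: "a \<in> lin k \<Longrightarrow> b \<in> lin k \<Longrightarrow> a + b \<in> lin k"
proof -
  assume "a \<in> lin k" "b \<in> lin k"
  then obtain l l' where l: "\<forall>i. l i \<in> L" "a = (\<Sum>i<k. l i * y ^ i)" "\<forall>i. l' i \<in> L" "b = (\<Sum>i<k. l' i * y ^ i)"
    by (auto simp: lin_def)
  have "a + b = (\<Sum>i<k. (l i + l' i) * y ^ i)" by (simp add: l distrib_right sum.distrib)
  moreover have "\<forall>i. l i + l' i \<in> L" using l subfld_add[OF L] by auto
  ultimately show ?thesis by (auto simp: lin_def)
qed

lemma lin_scale: "c \<in> L \<Longrightarrow> a \<in> lin k \<Longrightarrow> c * a \<in> lin k"
proof -
  assume c: "c \<in> L" and "a \<in> lin k"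
  then obtain l where l: "\<forall>i. l i \<in> L" "a = (\<Sum>i<k. l i * y ^ i)" by (auto simp: lin_def)
  have "c * a = (\<Sum>i<k. (c * l i) * y ^ i)" by (simp add: l sum_distrib_left mult.assoc)
  moreover have "\<forall>i. c * l i \<in> L" using l c subfld_mult[OF L] by auto
  ultimately show ?thesis by (auto simp: lin_def)
qed

lemma lin_0: "0 \<in> lin k"
  using subfld_0[OF L] by (auto simp: lin_def intro!: exI[of _ "\<lambda>_. 0"])

lemma lin_sum: "(\<And>i. i \<in> I \<Longrightarrow> f i \<in> lin k) \<Longrightarrow> sum f I \<in> lin k"
  by (induction I rule: infinite_finite_induct) (auto simp: lin_0 lin_add)

lemma lin_L: "c \<in> L \<Longrightarrow> c \<in> lin m"
proof -
  assume "c \<in> L"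
  moreover have "c = (\<Sum>i<m. (if i = 0 then c else 0) * y ^ i)"
    using m(1) by (simp add: if_distrib[of "\<lambda>x. x * _"] cong: if_cong)
  ultimately show ?thesis using subfld_0[OF L]
    by (auto simp: lin_def intro!: exI[of _ "\<lambda>i. if i = 0 then c else 0"])
qed

text \<open>The coefficients move up by one place; the top one returns to place 0, multiplied by
  y^m, which lies in L.\<close>

lemma lin_mult_y: "a \<in> lin m \<Longrightarrow> y * a \<in> lin m"
proof -
  assume "a \<in> lin m"
  then obtain l where l: "\<forall>i. l i \<in> L" "a = (\<Sum>i<m. l i * y ^ i)" by (auto simp: lin_def)
  obtain k where k: "m = Suc k" using m(1) gr0_implies_Suc by blast
  define l' where "l' i = (case i of 0 \<Rightarrow> l k * y ^ m | Suc j \<Rightarrow> l j)" for i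
  have l': "\<forall>i. l' i \<in> L" using l y(2) L by (auto simp: l'_def subfld_mult split: nat.split)
  have "(\<Sum>i<m. l' i * y ^ i) = l' 0 + (\<Sum>i<k. l' (Suc i) * y ^ Suc i)"
    unfolding k by (subst sum.lessThan_Suc_shift) simp
  also have "\<dots> = y * a"
    unfolding l(2) k sum.lessThan_Suc
    by (simp add: l'_def k distrib_left sum_distrib_left mult_ac)
  finally show ?thesis using l' unfolding lin_def mem_Collect_eq by (intro exI[of _ l']) simp
qed

lemma lin_mult: "a \<in> lin m \<Longrightarrow> b \<in> lin m \<Longrightarrow> a * b \<in> lin m"
proof -
  assume "a \<in> lin m" and b: "b \<in> lin m"
  then obtain l where l: "\<forall>i. l i \<in> L" "a = (\<Sum>i<m. l i * y ^ i)" by (auto simp: lin_def)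
  have yb: "y ^ i * b \<in> lin m" for i
    by (induction i) (use b lin_mult_y in \<open>auto simp: mult.assoc\<close>)
  have "a * b = (\<Sum>i<m. l i * (y ^ i * b))" by (simp add: l sum_distrib_right mult.assoc)
  also have "\<dots> \<in> lin m" by (rule lin_sum, rule lin_scale) (use l yb in auto)
  finally show ?thesis .
qed

lemma lin_prod: "(\<And>i. i \<in> I \<Longrightarrow> f i \<in> lin m) \<Longrightarrow> prod f I \<in> lin m"
  by (induction I rule: infinite_finite_induct) (auto simp: lin_mult lin_L subfld_1[OF L])

lemma lin_iterate: "a \<in> lin m \<Longrightarrow> (\<sigma> ^^ k) a \<in> lin m"
proof -
  assume "a \<in> lin m"
  then obtain l where l: "\<forall>i. l i \<in> L" "a = (\<Sum>i<m. l i * y ^ i)" by (auto simp: lin_def)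
  moreover have "\<forall>i. l i * (\<omega> ^ k) ^ i \<in> L" using l \<omega>(1) L by (auto intro!: subfld_mult subfld_power)
  ultimately show ?thesis unfolding l(2) iterate_power[OF l(1)] lin_def mem_Collect_eq
    by (intro exI[of _ "\<lambda>i. l i * (\<omega> ^ k) ^ i"]) simp
qed

lemma iterate_m: "a \<in> lin m \<Longrightarrow> (\<sigma> ^^ m) a = a"
proof -
  assume "a \<in> lin m"
  then obtain l where l: "\<forall>i. l i \<in> L" "a = (\<Sum>i<m. l i * y ^ i)" by (auto simp: lin_def)
  then show ?thesis unfolding l(2) iterate_power[OF l(1)] \<omega>(2) by simp
qed

text \<open>The inverse is read off from the norm, the product of all conjugates.\<close>

lemma lin_inverse:
  assumes "a \<in> lin m"
  shows "inverse a \<in> lin m"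
proof (cases "a = 0")
  case False
  obtain k where k: "m = Suc k" using m(1) gr0_implies_Suc by blast
  define N where "N = (\<Prod>i<m. (\<sigma> ^^ i) a)"
  define c where "c = (\<Prod>i<k. (\<sigma> ^^ Suc i) a)"
  have Na: "N = a * c" unfolding N_def c_def k prod.lessThan_Suc_shift by simp
  \<comment> \<open>\<sigma> permutes the factors cyclically, since its m-th iterate is the identity
    on \<open>lin m\<close>.\<close>
  have "\<sigma> N = (\<Prod>i<m. (\<sigma> ^^ Suc i) a)" by (simp add: N_def field_hom_prod[OF \<sigma>(1)])
  also have "\<dots> = c * (\<sigma> ^^ m) a" unfolding k prod.lessThan_Suc c_def by simp
  also have "\<dots> = N" using iterate_m[OF assms] Na by simp
  finally have "\<sigma> N = N" .
  moreover have "N \<in> lin m" unfolding N_def using assms by (intro lin_prod lin_iterate)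
  ultimately have "N \<in> L" by (intro lin_fixed)
  have "(\<sigma> ^^ i) a \<noteq> 0" for i using False by (induction i) (simp_all add: field_hom_eq_0[OF \<sigma>(1)])
  then have "N \<noteq> 0" by (simp add: N_def)
  then have "inverse a = inverse N * c" using False by (simp add: Na field_simps)
  moreover have "c \<in> lin m" unfolding c_def using assms by (intro lin_prod lin_iterate)
  ultimately show ?thesis using \<open>N \<in> L\<close> L by (auto intro: lin_scale subfld_inverse)
qed (simp add: lin_0)

lemma subfld_lin: "subfld (lin m)"
  using lin_scale[of "- 1"] subfld_minus[OF L subfld_1[OF L]]
  by (auto simp: subfld_def lin_add lin_mult lin_inverse lin_L subfld_1[OF L])

lemma lin_eq_gen: "lin m = gen (insert y L)"
proof
  show "lin m \<subseteq> gen (insert y L)"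
  proof
    fix a assume "a \<in> lin m"
    then obtain l where l: "\<forall>i. l i \<in> L" "a = (\<Sum>i<m. l i * y ^ i)" by (auto simp: lin_def)
    show "a \<in> gen (insert y L)" unfolding l(2)
      by (intro subfld_sum[OF subfld_gen] subfld_mult[OF subfld_gen] subfld_power[OF subfld_gen])
        (use l in \<open>auto intro: gen_incl\<close>)
  qed
  have "y * 1 \<in> lin m" by (intro lin_mult_y lin_L subfld_1 L)
  then show "gen (insert y L) \<subseteq> lin m"
    by (intro gen_least subfld_lin) (auto simp: lin_L)
qed

lemma gen_fixed: "a \<in> gen (insert y L) \<Longrightarrow> \<sigma> a = a \<Longrightarrow> a \<in> L"
  using lin_fixed by (simp add: lin_eq_gen)

text \<open>Otherwise the powers of y below y^m would satisfy a nontrivial relation. This is what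
  makes each new power raise the dimension by one.\<close>

lemma power_notin_lin: "k < m \<Longrightarrow> y ^ k \<notin> lin k"
proof
  assume k: "k < m" and "y ^ k \<in> lin k"
  then obtain l where l: "\<forall>i. l i \<in> L" "y ^ k = (\<Sum>i<k. l i * y ^ i)" by (auto simp: lin_def)
  define l' where "l' i = (if i < k then l i else if i = k then - 1 else 0)" for i
  have l': "\<forall>i. l' i \<in> L" using l subfld_0[OF L] subfld_minus[OF L subfld_1[OF L]] by (auto simp: l'_def)
  have "(\<Sum>i<m. l' i * y ^ i) = (\<Sum>i<Suc k. l' i * y ^ i)"
    using k by (intro sum.mono_neutral_right) (auto simp: l'_def)
  also have "\<dots> = (\<Sum>i<k. l i * y ^ i) - y ^ k" by (simp add: l'_def)
  finally have "(\<Sum>i<m. l' i * y ^ i) = 0" using l(2) by simp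
  from lin_independent[OF l' this k] show False by (simp add: l'_def)
qed

text \<open>The right-hand side has the shape of a \<open>line_extension\<close>, the step by which
  \<open>dimension\<close> grows.\<close>

lemma lin_Suc: "lin (Suc k) = {c * y ^ k + a | c a. c \<in> L \<and> a \<in> lin k}"
proof safe
  fix a assume "a \<in> lin (Suc k)"
  then obtain l where l: "\<forall>i. l i \<in> L" "a = (\<Sum>i<Suc k. l i * y ^ i)" by (auto simp: lin_def)
  then show "\<exists>c a'. a = c * y ^ k + a' \<and> c \<in> L \<and> a' \<in> lin k"
    by (intro exI[of _ "l k"] exI[of _ "\<Sum>i<k. l i * y ^ i"]) (auto simp: lin_def add.commute)
next
  fix c a assume c: "c \<in> L" and "a \<in> lin k"
  then obtain l where l: "\<forall>i. l i \<in> L" "a = (\<Sum>i<k. l i * y ^ i)" by (auto simp: lin_def)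
  have "c * y ^ k + a = (\<Sum>i<Suc k. (l(k := c)) i * y ^ i)" using l(2) by simp
  moreover have "\<forall>i. (l(k := c)) i \<in> L" using l c by simp
  ultimately show "c * y ^ k + a \<in> lin (Suc k)" unfolding lin_def by blast
qed

end

subsection \<open>Function fields of the Weber curves\<close>

no_notation fps_nth (infixl "$" 75)

section \<open>Points of projective space and forms\<close>

lemma rep_P3_same_line: "same_line (rep_P3 x) (rep_P3 x)"
  using Quotient3_rel_rep[OF Quotient3_P3] by (simp add: Quotient3_rep_reflp[OF Quotient3_P3])

lemma rep_P3_nonzero: "rep_P3 x \<noteq> 0"
  using rep_P3_same_line[of x] by (simp add: same_line_def)

lemma abs_rep_P3: "abs_P3 (rep_P3 x) = x"
  by (rule Quotient3_abs_rep[OF Quotient3_P3])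

lemma same_line_refl: "v \<noteq> 0 \<Longrightarrow> same_line v v"
  by (auto simp: same_line_def intro!: exI[of _ 1])

lemma rep_abs_P3:
  assumes "v \<noteq> 0"
  obtains c where "c \<noteq> 0" "rep_P3 (abs_P3 v) = c *s v"
proof -
  have "same_line v (rep_P3 (abs_P3 v))"
    using rep_abs_rsp[OF Quotient3_P3 same_line_refl[OF assms]] .
  then show ?thesis using that by (auto simp: same_line_def)
qed

lemma abs_P3_eqI:
  assumes "v \<noteq> 0" "c \<noteq> 0" "w = c *s v"
  shows "abs_P3 v = abs_P3 w"
  using assms by (intro Quotient3_rel_abs[OF Quotient3_P3]) (auto simp: same_line_def vec_eq_iff)

lemma abs_P3_eqD:
  assumes "v \<noteq> 0" "w \<noteq> 0" "abs_P3 v = abs_P3 w"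
  obtains c where "c \<noteq> 0" "w = c *s v"
proof -
  have "same_line v w"
    using Quotient3_rel[OF Quotient3_P3, of v w] assms same_line_refl by blast
  then show ?thesis using that by (auto simp: same_line_def)
qed

lemma P3_coords_distinct [simp]: "(0::4) \<noteq> 1" "(0::4) \<noteq> 2" "(0::4) \<noteq> 3" "(1::4) \<noteq> 2" "(1::4) \<noteq> 3"
   "(2::4) \<noteq> 3" "(1::4) \<noteq> 0" "(2::4) \<noteq> 0" "(3::4) \<noteq> 0" "(2::4) \<noteq> 1" "(3::4) \<noteq> 1" "(3::4) \<noteq> 2"
  by simp_all

lemma P3_coord_cases: "(i::4) = 0 \<or> i = 1 \<or> i = 2 \<or> i = 3"
  using exhaust_4[of i] by auto

lemma all_P3_coords: "(\<forall>i::4. P i) \<longleftrightarrow> P 0 \<and> P 1 \<and> P 2 \<and> P 3"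
  using P3_coord_cases by metis

lemma P3_vec_eq_iff: "(v::complex^4) = w \<longleftrightarrow> v $ 0 = w $ 0 \<and> v $ 1 = w $ 1 \<and> v $ 2 = w $ 2 \<and> v $ 3 = w $ 3"
  by (simp only: vec_eq_iff all_P3_coords)

lemma hcoords_nth [simp]: "hcoords a b c d $ 0 = a" "hcoords a b c d $ 1 = b"
  "hcoords a b c d $ 2 = c" "hcoords a b c d $ 3 = d"
  by (simp_all add: hcoords_def)

lemma hpoly_homogeneous: "hpoly d p \<Longrightarrow> p (c *s v) = c ^ d * p v"
  by (induction rule: hpoly.induct) (simp_all add: distrib_left power_add)

lemma hpoly_compose:
  assumes "hpoly d p" "\<And>i. hpoly e (\<lambda>v. F v $ i)"
  shows "hpoly (d * e) (\<lambda>v. p (F v))"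
  using assms(1)
proof induction
  case (hpoly_mult d p d' q)
  then show ?case using hpoly.hpoly_mult[of "d * e" "\<lambda>v. p (F v)" "d' * e" "\<lambda>v. q (F v)"]
    by (simp add: distrib_right)
next
  case (hpoly_const c)
  then show ?case by (simp add: hpoly.hpoly_const)
qed (auto intro: hpoly.intros assms(2))

lemma hpoly_scale: "hpoly d p \<Longrightarrow> hpoly d (\<lambda>v. c * p v)"
  using hpoly_mult[OF hpoly_const, of d p c] by simp

lemma hpoly_diff: "hpoly d p \<Longrightarrow> hpoly d q \<Longrightarrow> hpoly d (\<lambda>v. p v - q v)"
  using hpoly_add[OF _ hpoly_scale[of d q "- 1"], of p] by simp

lemma hpoly_power: "hpoly d p \<Longrightarrow> hpoly (k * d) (\<lambda>v. p v ^ k)"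
proof (induction k)
  case (Suc k)
  then show ?case using hpoly_mult[OF Suc.prems Suc.IH[OF Suc.prems]] by simp
qed (use hpoly_const[of 1] in simp)

lemma hpoly_coord_power: "hpoly k (\<lambda>v. v $ i ^ k)"
  using hpoly_power[OF hpoly_coord[of i], of k] by simp

text \<open>Normalised coordinates that are holomorphic in \<tau>, in contrast to
  \<open>rep_P3\<close>, whose scalar factor is arbitrary.\<close>

definition weber_vec :: "nat \<Rightarrow> complex \<Rightarrow> complex ^ 4" where
  "weber_vec N \<tau> = hcoords (uw 0 \<tau> ^ (24 div N)) (uw 1 \<tau> ^ (24 div N)) (uw 2 \<tau> ^ (24 div N)) 1"

lemma weber_vec_nonzero: "weber_vec N \<tau> \<noteq> 0"
  using hcoords_nth(4) by (metis weber_vec_def zero_index zero_neq_one)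

lemma weber_point_eq: "weber_point N \<tau> = abs_P3 (weber_vec N \<tau>)"
  by (simp add: weber_point_def weber_vec_def uw_def)

lemma weber_point_in_curve: "Im \<tau> > 0 \<Longrightarrow> weber_point N \<tau> \<in> weber_curve N"
  unfolding weber_curve_def zariski_closure_def by auto

lemma rep_weber_point:
  obtains c where "c \<noteq> 0" "rep_P3 (weber_point N \<tau>) = c *s weber_vec N \<tau>"
  using rep_abs_P3[OF weber_vec_nonzero] unfolding weber_point_eq by metis

lemma hpoly_rep_weber_point: "hpoly d p \<Longrightarrow> p (rep_P3 (weber_point N \<tau>)) = 0 \<longleftrightarrow> p (weber_vec N \<tau>) = 0"
proof -
  assume p: "hpoly d p"
  obtain c where "c \<noteq> 0" "rep_P3 (weber_point N \<tau>) = c *s weber_vec N \<tau>" by (rule rep_weber_point)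
  then show ?thesis by (simp add: hpoly_homogeneous[OF p])
qed

definition xh :: "nat \<Rightarrow> nat \<Rightarrow> holo" where
  "xh N i = mk_holo (\<lambda>\<tau>. uw i \<tau> ^ (24 div N))"

definition restr :: "nat \<Rightarrow> (complex ^ 4 \<Rightarrow> complex) \<Rightarrow> holo" where
  "restr N p = mk_holo (\<lambda>\<tau>. p (weber_vec N \<tau>))"

lemma weber_vec_nth: "weber_vec N \<tau> $ 0 = uw 0 \<tau> ^ (24 div N)" "weber_vec N \<tau> $ 1 = uw 1 \<tau> ^ (24 div N)"
  "weber_vec N \<tau> $ 2 = uw 2 \<tau> ^ (24 div N)" "weber_vec N \<tau> $ 3 = 1"
  by (simp_all add: weber_vec_def)

lemma hpoly_holomorphic: "hpoly d p \<Longrightarrow> (\<lambda>\<tau>. p (weber_vec N \<tau>)) holomorphic_on upper_half_plane"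
proof (induction rule: hpoly.induct)
  case (hpoly_coord i)
  from P3_coord_cases[of i] show ?case
    by (elim disjE) (auto simp: weber_vec_nth intro!: holomorphic_intros uw_holomorphic)
qed (auto intro!: holomorphic_intros)

lemma hfun_xh: "Im \<tau> > 0 \<Longrightarrow> hfun (xh N i) \<tau> = uw i \<tau> ^ (24 div N)"
  unfolding xh_def by (rule hfun_mk_holo) (auto intro!: holomorphic_intros uw_holomorphic)

lemma hfun_restr: "hpoly d p \<Longrightarrow> Im \<tau> > 0 \<Longrightarrow> hfun (restr N p) \<tau> = p (weber_vec N \<tau>)"
  unfolding restr_def by (rule hfun_mk_holo[OF hpoly_holomorphic])

lemma restr_const: "restr N (\<lambda>v. c) = hconst c"
  by (simp add: restr_def hconst_def)

lemma restr_add: "hpoly d p \<Longrightarrow> hpoly d q \<Longrightarrow> restr N (\<lambda>v. p v + q v) = restr N p + restr N q"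
  by (rule holo_eqI) (simp add: hfun_ops hfun_restr hfun_restr[OF hpoly_add])

lemma restr_mult: "hpoly d p \<Longrightarrow> hpoly e q \<Longrightarrow> restr N (\<lambda>v. p v * q v) = restr N p * restr N q"
  by (rule holo_eqI) (simp add: hfun_ops hfun_restr hfun_restr[OF hpoly_mult])

lemma restr_diff: "hpoly d p \<Longrightarrow> hpoly d q \<Longrightarrow> restr N (\<lambda>v. p v - q v) = restr N p - restr N q"
  by (rule holo_eqI) (simp add: hfun_ops hfun_restr hfun_restr[OF hpoly_diff])

lemma restr_coord: "restr N (\<lambda>v. v $ 0) = xh N 0" "restr N (\<lambda>v. v $ 1) = xh N 1"
  "restr N (\<lambda>v. v $ 2) = xh N 2" "restr N (\<lambda>v. v $ 3) = 1"
  by (simp_all add: restr_def xh_def weber_vec_nth one_holo_def)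

text \<open>The closure satisfies exactly the homogeneous equations of the image. The points added
  to the image are hereby dealt with once and for all, and later arguments concern functions of
  \<tau>.\<close>

lemma vanishes_on_curve:
  assumes "hpoly d p"
  shows "(\<forall>x\<in>weber_curve N. p (rep_P3 x) = 0) \<longleftrightarrow> restr N p = 0"
proof
  assume 0: "\<forall>x\<in>weber_curve N. p (rep_P3 x) = 0"
  show "restr N p = 0"
  proof (rule holo_eqI)
    fix \<tau> assume \<tau>: "Im \<tau> > 0"
    have "p (weber_vec N \<tau>) = 0"
      using bspec[OF 0 weber_point_in_curve[OF \<tau>]] by (simp only: hpoly_rep_weber_point[OF assms])
    then show "hfun (restr N p) \<tau> = hfun 0 \<tau>"
      using \<tau> by (simp add: hfun_restr[OF assms] hfun_ops)
  qed
next
  assume 0: "restr N p = 0"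
  have "p (rep_P3 y) = 0" if "y \<in> weber_point N ` upper_half_plane" for y
    using that hpoly_rep_weber_point[OF assms] hfun_restr[OF assms, of _ N]
    by (auto simp: 0 hfun_ops)
  then show "\<forall>x\<in>weber_curve N. p (rep_P3 x) = 0"
    using assms unfolding weber_curve_def zariski_closure_def by blast
qed

lemma vanishes_on_curve_iff_points:
  assumes "hpoly d p"
  shows "(\<forall>x\<in>weber_curve N. p (rep_P3 x) = 0) \<longleftrightarrow> (\<forall>\<tau>. Im \<tau> > 0 \<longrightarrow> p (weber_vec N \<tau>) = 0)"
proof -
  have "restr N p = 0 \<longleftrightarrow> (\<forall>\<tau>. Im \<tau> > 0 \<longrightarrow> p (weber_vec N \<tau>) = 0)"
    using hfun_restr[OF assms, of _ N] by (metis holo_eqI hfun_ops(1))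
  then show ?thesis using vanishes_on_curve[OF assms] by simp
qed

section \<open>The function field as a field of meromorphic functions\<close>

lemma fractions_iff:
  "(p, q) \<in> fractions (weber_curve N) \<longleftrightarrow> (\<exists>d. hpoly d p \<and> hpoly d q \<and> restr N q \<noteq> 0)"
proof -
  have "(\<exists>x\<in>weber_curve N. q (rep_P3 x) \<noteq> 0) \<longleftrightarrow> restr N q \<noteq> 0" if "hpoly d q" for d
    using vanishes_on_curve[OF that, of N] by blast
  then show ?thesis unfolding fractions_def by auto
qed

definition val :: "nat \<Rightarrow> (complex ^ 4 \<Rightarrow> complex) \<times> (complex ^ 4 \<Rightarrow> complex) \<Rightarrow> mero" where
  "val N = (\<lambda>(p, q). emb (restr N p) / emb (restr N q))"

definition cls :: "nat \<Rightarrow> mero \<Rightarrow> ratfun" where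
  "cls N a = {pq \<in> fractions (weber_curve N). val N pq = a}"

text \<open>\<open>cls N\<close> embeds the subfield \<open>KK N\<close> of \<^typ>\<open>mero\<close> into the function field of the \<open>N\<close>-th
  Weber curve; its inverse is induced by \<open>val N\<close>, the restriction to the image of the upper half plane.\<close>

definition xx :: "nat \<Rightarrow> nat \<Rightarrow> mero" where
  "xx N i = emb (xh N i)"

definition KK :: "nat \<Rightarrow> mero set" where
  "KK N = gen (range cst \<union> {xx N 0, xx N 1, xx N 2})"

lemma subfld_KK: "subfld (KK N)"
  unfolding KK_def by (rule subfld_gen)

lemma cst_KK: "cst c \<in> KK N"
  unfolding KK_def by (auto intro: gen_incl)

lemma xx_KK: "i < 3 \<Longrightarrow> xx N i \<in> KK N"
  unfolding KK_def less_3_cases by (auto intro: gen_incl)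

lemma emb_restr_KK: "hpoly d p \<Longrightarrow> emb (restr N p) \<in> KK N"
proof (induction rule: hpoly.induct)
  case (hpoly_const c)
  then show ?case using cst_KK[of c N] by (simp add: restr_const cst_def)
next
  case (hpoly_zero d)
  then show ?case using cst_KK[of 0 N] by (simp add: restr_const cst_def)
next
  case (hpoly_coord i)
  from P3_coord_cases[of i] show ?case
    using xx_KK[of 0 N] xx_KK[of 1 N] xx_KK[of 2 N] subfld_1[OF subfld_KK[of N]]
    by (elim disjE) (simp_all add: restr_coord xx_def emb_simps)
next
  case (hpoly_add d p q)
  then show ?case using subfld_add[OF subfld_KK] by (simp add: restr_add emb_simps)
next
  case (hpoly_mult d p e q)
  then show ?case using subfld_mult[OF subfld_KK] by (simp add: restr_mult emb_simps)
qed

lemma val_mult: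
  assumes "(p, q) \<in> fractions (weber_curve N)" "(p', q') \<in> fractions (weber_curve N)"
  shows "((\<lambda>v. p v * p' v), (\<lambda>v. q v * q' v)) \<in> fractions (weber_curve N)"
    and "val N ((\<lambda>v. p v * p' v), (\<lambda>v. q v * q' v)) = val N (p, q) * val N (p', q')"
proof -
  obtain d e where h: "hpoly d p" "hpoly d q" "restr N q \<noteq> 0" "hpoly e p'" "hpoly e q'" "restr N q' \<noteq> 0"
    using assms unfolding fractions_iff by blast
  show "((\<lambda>v. p v * p' v), (\<lambda>v. q v * q' v)) \<in> fractions (weber_curve N)"
    using h hpoly_mult[OF h(1,4)] hpoly_mult[OF h(2,5)] restr_mult[OF h(2,5)]
    unfolding fractions_iff by (intro exI[of _ "d + e"]) simp
  show "val N ((\<lambda>v. p v * p' v), (\<lambda>v. q v * q' v)) = val N (p, q) * val N (p', q')"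
    by (simp add: val_def restr_mult[OF h(1,4)] restr_mult[OF h(2,5)] emb_simps)
qed

lemma val_add:
  assumes "(p, q) \<in> fractions (weber_curve N)" "(p', q') \<in> fractions (weber_curve N)"
  shows "((\<lambda>v. p v * q' v + p' v * q v), (\<lambda>v. q v * q' v)) \<in> fractions (weber_curve N)"
    and "val N ((\<lambda>v. p v * q' v + p' v * q v), (\<lambda>v. q v * q' v)) = val N (p, q) + val N (p', q')"
proof -
  obtain d e where h: "hpoly d p" "hpoly d q" "restr N q \<noteq> 0" "hpoly e p'" "hpoly e q'" "restr N q' \<noteq> 0"
    using assms unfolding fractions_iff by blast
  have 1: "hpoly (d + e) (\<lambda>v. p' v * q v)" using hpoly_mult[OF h(4,2)] by (simp add: add.commute)
  have 2: "hpoly (d + e) (\<lambda>v. p v * q' v)" by (rule hpoly_mult[OF h(1,5)])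
  show "((\<lambda>v. p v * q' v + p' v * q v), (\<lambda>v. q v * q' v)) \<in> fractions (weber_curve N)"
    using h hpoly_add[OF 2 1] hpoly_mult[OF h(2,5)] restr_mult[OF h(2,5)]
    unfolding fractions_iff by (intro exI[of _ "d + e"]) simp
  show "val N ((\<lambda>v. p v * q' v + p' v * q v), (\<lambda>v. q v * q' v)) = val N (p, q) + val N (p', q')"
    using h(3,6)
    by (simp add: val_def restr_add[OF 2 1] restr_mult[OF h(1,5)] restr_mult[OF h(4,2)]
        restr_mult[OF h(2,5)] emb_simps field_simps)
qed

text \<open>The values form a subfield that contains the constants and the values of X_i / X_3,
  which are the generators because the last coordinate restricts to 1.\<close>

lemma val_fractions: "val N ` fractions (weber_curve N) = KK N"
proof (rule antisym)
  show "val N ` fractions (weber_curve N) \<subseteq> KK N"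
  proof safe
    fix p q assume "(p, q) \<in> fractions (weber_curve N)"
    then obtain d where "hpoly d p" "hpoly d q" unfolding fractions_iff by blast
    then show "val N (p, q) \<in> KK N"
      unfolding val_def by (auto intro!: subfld_divide[OF subfld_KK] emb_restr_KK)
  qed
  let ?S = "val N ` fractions (weber_curve N)"
  have c: "cst c \<in> ?S" for c
  proof (rule image_eqI)
    show "((\<lambda>v. c), (\<lambda>v. 1)) \<in> fractions (weber_curve N)"
      unfolding fractions_iff
      by (intro exI[of _ 0]) (metis hpoly_const restr_const cst_def cst_simps(7) emb_simps(8) one_neq_zero)
    show "cst c = val N ((\<lambda>v. c), (\<lambda>v. 1))"
      by (simp add: val_def restr_const cst_def[symmetric] cst_simps)
  qed
  have x: "emb (restr N (\<lambda>v. v $ i)) \<in> ?S" for i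
  proof (rule image_eqI)
    show "((\<lambda>v. v $ i), (\<lambda>v. v $ 3)) \<in> fractions (weber_curve N)"
      unfolding fractions_iff by (intro exI[of _ 1]) (simp add: hpoly_coord[unfolded One_nat_def] restr_coord)
    show "emb (restr N (\<lambda>v. v $ i)) = val N ((\<lambda>v. v $ i), (\<lambda>v. v $ 3))"
      by (simp add: val_def restr_coord emb_simps)
  qed
  have S_cases: "\<exists>p q. (p, q) \<in> fractions (weber_curve N) \<and> a = val N (p, q)" if a: "a \<in> ?S" for a
  proof -
    obtain pq where "a = val N pq" "pq \<in> fractions (weber_curve N)" using a by (rule imageE)
    then show ?thesis by (cases pq) auto
  qed
  have add: "a + b \<in> ?S" and mult: "a * b \<in> ?S" if a: "a \<in> ?S" and b: "b \<in> ?S" for a b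
  proof -
    obtain p q where 1: "(p, q) \<in> fractions (weber_curve N)" "a = val N (p, q)" using S_cases[OF a] by blast
    obtain p' q' where 2: "(p', q') \<in> fractions (weber_curve N)" "b = val N (p', q')" using S_cases[OF b] by blast
    show "a + b \<in> ?S" using imageI[OF val_add(1)[OF 1(1) 2(1)], of "val N"] 1(2) 2(2) val_add(2)[OF 1(1) 2(1)] by simp
    show "a * b \<in> ?S" using imageI[OF val_mult(1)[OF 1(1) 2(1)], of "val N"] 1(2) 2(2) val_mult(2)[OF 1(1) 2(1)] by simp
  qed
  have inv: "inverse a \<in> ?S" if a: "a \<in> ?S" for a
  proof (cases "a = 0")
    case True
    then show ?thesis using a by simp
  next
    case False
    obtain p q where pq: "(p, q) \<in> fractions (weber_curve N)" "a = val N (p, q)" using S_cases[OF a] by blast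
    then obtain d where "hpoly d p" "hpoly d q" unfolding fractions_iff by blast
    moreover have "restr N p \<noteq> 0" using False unfolding pq(2) val_def by (auto simp: emb_simps)
    ultimately have qp: "(q, p) \<in> fractions (weber_curve N)" unfolding fractions_iff by blast
    have "inverse a = val N (q, p)" by (simp add: pq(2) val_def)
    then show ?thesis using imageI[OF qp, of "val N"] by simp
  qed
  have "subfld ?S"
  proof (unfold subfld_def, intro conjI ballI)
    show "1 \<in> ?S" using c[of 1] by (simp only: cst_simps)
    show "- a \<in> ?S" if "a \<in> ?S" for a
    proof -
      have "cst (- 1) * a = - a" by (simp add: cst_simps)
      then show ?thesis using mult[OF c[of "- 1"] that] by (simp only:)
    qed
    show "a + b \<in> ?S" "a * b \<in> ?S" if "a \<in> ?S" "b \<in> ?S" for a b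
      using that by (rule add, rule mult)
    show "inverse a \<in> ?S" if "a \<in> ?S" for a using that by (rule inv)
  qed
  then show "KK N \<subseteq> ?S" unfolding KK_def
    by (rule gen_least) (use c x[of 0] x[of 1] x[of 2] in \<open>auto simp: restr_coord xx_def\<close>)
qed

text \<open>Equality of the cross products on the curve is equality of two restricted forms, hence
  of two quotients in \<open>mero\<close>.\<close>

lemma frac_class_eq:
  assumes "(p, q) \<in> fractions (weber_curve N)"
  shows "frac_class (weber_curve N) p q = cls N (val N (p, q))"
proof -
  obtain d where h: "hpoly d p" "hpoly d q" "restr N q \<noteq> 0" using assms unfolding fractions_iff by blast
  have "(\<forall>x\<in>weber_curve N. p (rep_P3 x) * q' (rep_P3 x) = p' (rep_P3 x) * q (rep_P3 x)) \<longleftrightarrow>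
      val N (p', q') = val N (p, q)" if pq': "(p', q') \<in> fractions (weber_curve N)" for p' q'
  proof -
    obtain e where h': "hpoly e p'" "hpoly e q'" "restr N q' \<noteq> 0" using pq' unfolding fractions_iff by blast
    have 1: "hpoly (d + e) (\<lambda>v. p' v * q v)" using hpoly_mult[OF h'(1) h(2)] by (simp add: add.commute)
    have 2: "hpoly (d + e) (\<lambda>v. p v * q' v)" by (rule hpoly_mult[OF h(1) h'(2)])
    have "(\<forall>x\<in>weber_curve N. p (rep_P3 x) * q' (rep_P3 x) = p' (rep_P3 x) * q (rep_P3 x)) \<longleftrightarrow>
       (\<forall>x\<in>weber_curve N. (\<lambda>v. p v * q' v - p' v * q v) (rep_P3 x) = 0)" by simp
    also have "\<dots> \<longleftrightarrow> restr N p * restr N q' = restr N p' * restr N q"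
      unfolding vanishes_on_curve[OF hpoly_diff[OF 2 1]] restr_diff[OF 2 1]
        restr_mult[OF h(1) h'(2)] restr_mult[OF h'(1) h(2)] by simp
    also have "\<dots> \<longleftrightarrow> emb (restr N p) * emb (restr N q') = emb (restr N p') * emb (restr N q)"
      by (simp add: emb_simps(6)[symmetric] emb_simps(7))
    also have "\<dots> \<longleftrightarrow> val N (p', q') = val N (p, q)"
      using h(3) h'(3) by (auto simp: val_def emb_simps frac_eq_eq)
    finally show ?thesis .
  qed
  then show ?thesis unfolding frac_class_def cls_def by auto
qed

lemma carrier_function_field: "carrier (function_field (weber_curve N)) = cls N ` KK N"
proof -
  have "carrier (function_field (weber_curve N)) =
      (\<lambda>(p, q). frac_class (weber_curve N) p q) ` fractions (weber_curve N)"
    unfolding function_field_def by auto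
  also have "\<dots> = (\<lambda>pq. cls N (val N pq)) ` fractions (weber_curve N)"
    by (rule image_cong) (auto simp: frac_class_eq)
  also have "\<dots> = cls N ` val N ` fractions (weber_curve N)" by (simp add: image_image)
  finally show ?thesis by (simp add: val_fractions)
qed

lemma cls_nonempty:
  assumes "a \<in> KK N" obtains p q where "(p, q) \<in> cls N a"
  using assms unfolding val_fractions[symmetric] by (auto simp: cls_def)

lemma cls_eq_iff: "a \<in> KK N \<Longrightarrow> cls N a = cls N b \<longleftrightarrow> a = b"
  using cls_nonempty[of a N] by (auto simp: cls_def)

text \<open>The operations are unions over all pairs of representatives; every pair contributes the
  same class, because its value in \<open>mero\<close> depends on the two classes only.\<close>

lemma function_field_ops:
  shows "\<one>\<^bsub>function_field (weber_curve N)\<^esub> = cls N 1" "\<zero>\<^bsub>function_field (weber_curve N)\<^esub> = cls N 0"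
    and "a \<in> KK N \<Longrightarrow> b \<in> KK N \<Longrightarrow> cls N a \<otimes>\<^bsub>function_field (weber_curve N)\<^esub> cls N b = cls N (a * b)"
    and "a \<in> KK N \<Longrightarrow> b \<in> KK N \<Longrightarrow> cls N a \<oplus>\<^bsub>function_field (weber_curve N)\<^esub> cls N b = cls N (a + b)"
proof -
  have c: "((\<lambda>v. c), (\<lambda>v. 1)) \<in> fractions (weber_curve N)" for c
    unfolding fractions_iff
    by (intro exI[of _ 0]) (metis hpoly_const restr_const cst_def cst_simps(7) emb_simps(8) one_neq_zero)
  show "\<one>\<^bsub>function_field (weber_curve N)\<^esub> = cls N 1" "\<zero>\<^bsub>function_field (weber_curve N)\<^esub> = cls N 0"
    using frac_class_eq[OF c[of 1]] frac_class_eq[OF c[of 0]]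
    by (simp_all add: function_field_def val_def restr_const cst_def[symmetric] cst_simps)
next
  assume a: "a \<in> KK N" and b: "b \<in> KK N"
  obtain p q where pq: "(p, q) \<in> cls N a" using cls_nonempty[OF a] .
  obtain p' q' where pq': "(p', q') \<in> cls N b" using cls_nonempty[OF b] .
  have "frac_class (weber_curve N) (\<lambda>v. p v * p' v) (\<lambda>v. q v * q' v) = cls N (a * b)"
    "frac_class (weber_curve N) (\<lambda>v. p v * q' v + p' v * q v) (\<lambda>v. q v * q' v) = cls N (a + b)"
    if "(p, q) \<in> cls N a" "(p', q') \<in> cls N b" for p q p' q'
    using that val_mult[of p q N p' q'] val_add[of p q N p' q'] frac_class_eq
    by (simp_all add: cls_def)
  then show "cls N a \<otimes>\<^bsub>function_field (weber_curve N)\<^esub> cls N b = cls N (a * b)"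
    "cls N a \<oplus>\<^bsub>function_field (weber_curve N)\<^esub> cls N b = cls N (a + b)"
    using pq pq' by (fastforce simp: function_field_def)+
qed

lemma field_function_field: "field (function_field (weber_curve N))" (is "field ?R")
proof -
  note K = subfld_KK[of N]
  have car: "\<And>a. a \<in> KK N \<Longrightarrow> cls N a \<in> carrier ?R" "\<And>A. A \<in> carrier ?R \<Longrightarrow> \<exists>a\<in>KK N. A = cls N a"
    unfolding carrier_function_field by auto
  note ops = function_field_ops[where N = N]
  have "cring ?R"
  proof (rule cringI)
    show "abelian_group ?R"
    proof (rule abelian_groupI)
      show "\<exists>y\<in>carrier ?R. y \<oplus>\<^bsub>?R\<^esub> x = \<zero>\<^bsub>?R\<^esub>" if "x \<in> carrier ?R" for x
      proof -
        obtain a where a: "a \<in> KK N" "x = cls N a" using car(2)[OF \<open>x \<in> carrier ?R\<close>] by blast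
        then show ?thesis using car(1)[OF subfld_minus[OF K a(1)]] subfld_minus[OF K a(1)]
          by (intro bexI[of _ "cls N (- a)"]) (simp_all add: ops)
      qed
    qed (auto dest!: car(2) intro!: car(1) simp: ops subfld_add[OF K] subfld_0[OF K] add_ac)
    show "Group.comm_monoid ?R"
      by (rule comm_monoidI) (auto dest!: car(2) intro!: car(1) simp: ops subfld_mult[OF K] subfld_1[OF K] mult_ac)
  qed (auto dest!: car(2) simp: ops subfld_add[OF K] subfld_mult[OF K] distrib_right)
  then show ?thesis
  proof (rule cring.cring_fieldI2)
    show "\<zero>\<^bsub>?R\<^esub> \<noteq> \<one>\<^bsub>?R\<^esub>" by (simp add: ops cls_eq_iff subfld_0[OF K])
    fix x assume "x \<in> carrier ?R" "x \<noteq> \<zero>\<^bsub>?R\<^esub>"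
    then obtain a where a: "a \<in> KK N" "x = cls N a" "a \<noteq> 0" using car(2) ops(2) by blast
    then show "\<exists>y\<in>carrier ?R. x \<otimes>\<^bsub>?R\<^esub> y = \<one>\<^bsub>?R\<^esub>"
      using car(1)[OF subfld_inverse[OF K a(1)]] subfld_inverse[OF K a(1)]
      by (intro bexI[of _ "cls N (inverse a)"]) (simp_all add: ops)
  qed
qed

text \<open>A morphism between Weber curves that is given by one tuple of forms without common zeros, and
  the field homomorphism it induces.\<close>

definition comorph :: "nat \<Rightarrow> nat \<Rightarrow> (P3 \<Rightarrow> P3) \<Rightarrow> (mero \<Rightarrow> mero) \<Rightarrow> bool" where
  "comorph N M f \<Theta> \<longleftrightarrow> field_hom \<Theta> \<and> (\<exists>F e. (\<forall>i. hpoly e (\<lambda>v. F v $ i)) \<and> (\<forall>v. v \<noteq> 0 \<longrightarrow> F v \<noteq> 0) \<and>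
     (\<forall>x\<in>weber_curve N. f x = abs_P3 (F (rep_P3 x))) \<and>
     (\<forall>d p. hpoly d p \<longrightarrow> emb (restr N (\<lambda>v. p (F v))) = \<Theta> (emb (restr M p))))"

lemma comorph_cong:
  assumes "comorph N M f \<Theta>" "\<And>x. x \<in> weber_curve N \<Longrightarrow> f x = g x"
  shows "comorph N M g \<Theta>"
  using assms unfolding comorph_def by simp

text \<open>Since \<Theta> sends 0 to 0, the pullback of an equation of the target is an equation of
  the source.\<close>

lemma comorph_morphism:
  assumes "comorph N M f \<Theta>"
  shows "is_morphism (weber_curve N) (weber_curve M) f"
proof -
  obtain F e where F: "\<And>i. hpoly e (\<lambda>v. F v $ i)" "\<And>v. v \<noteq> 0 \<Longrightarrow> F v \<noteq> 0"
    "\<And>x. x \<in> weber_curve N \<Longrightarrow> f x = abs_P3 (F (rep_P3 x))"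
    and \<Theta>: "\<And>d p. hpoly d p \<Longrightarrow> emb (restr N (\<lambda>v. p (F v))) = \<Theta> (emb (restr M p))" and hom: "field_hom \<Theta>"
    using assms unfolding comorph_def by blast
  have "f x \<in> weber_curve M" if x: "x \<in> weber_curve N" for x
  proof -
    have "p (rep_P3 (f x)) = 0" if p: "hpoly d p" "\<forall>y\<in>weber_point M ` upper_half_plane. p (rep_P3 y) = 0" for d p
    proof -
      have "restr M p = 0"
      proof (rule holo_eqI)
        fix \<tau> assume "Im \<tau> > 0"
        then show "hfun (restr M p) \<tau> = hfun 0 \<tau>"
          using p(2) hpoly_rep_weber_point[OF p(1)] by (auto simp: hfun_restr[OF p(1)] hfun_ops)
      qed
      then have "restr N (\<lambda>v. p (F v)) = 0"
        using \<Theta>[OF p(1)] by (simp add: emb_simps field_hom_0[OF hom])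
      then have "p (F (rep_P3 x)) = 0" using vanishes_on_curve[OF hpoly_compose[OF p(1) F(1)]] x by blast
      moreover obtain c where "rep_P3 (f x) = c *s F (rep_P3 x)"
        using rep_abs_P3[OF F(2)[OF rep_P3_nonzero]] F(3)[OF x] by metis
      ultimately show ?thesis by (simp add: hpoly_homogeneous[OF p(1)])
    qed
    then show ?thesis unfolding weber_curve_def zariski_closure_def by blast
  qed
  then show ?thesis
    unfolding is_morphism_def using F rep_P3_nonzero by blast
qed

text \<open>The scalar between \<open>rep_P3 (f x)\<close> and the lifted vector enters numerator
  and denominator with the same power, as both forms have the same degree.\<close>

lemma comorph_pullback:
  assumes "comorph N M f \<Theta>" "b \<in> KK M"
  shows "pullback (weber_curve N) f (cls M b) = cls N (\<Theta> b)"
proof -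
  obtain F e where F: "\<And>i. hpoly e (\<lambda>v. F v $ i)" "\<And>v. v \<noteq> 0 \<Longrightarrow> F v \<noteq> 0"
    "\<And>x. x \<in> weber_curve N \<Longrightarrow> f x = abs_P3 (F (rep_P3 x))"
    and \<Theta>: "\<And>d p. hpoly d p \<Longrightarrow> emb (restr N (\<lambda>v. p (F v))) = \<Theta> (emb (restr M p))" and hom: "field_hom \<Theta>"
    using assms unfolding comorph_def by blast
  have key: "(\<forall>x\<in>weber_curve N. p (rep_P3 (f x)) * q' (rep_P3 x) = p' (rep_P3 x) * q (rep_P3 (f x))) \<longleftrightarrow>
      val N (p', q') = \<Theta> b" if pq: "(p, q) \<in> cls M b" and pq': "(p', q') \<in> fractions (weber_curve N)" for p q p' q'
  proof -
    obtain d where h: "hpoly d p" "hpoly d q" "restr M q \<noteq> 0" and b: "b = emb (restr M p) / emb (restr M q)"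
    proof -
      have "(p, q) \<in> fractions (weber_curve M)" "val M (p, q) = b" using pq by (simp_all add: cls_def)
      then show ?thesis using that unfolding fractions_iff val_def by auto
    qed
    obtain d' where h': "hpoly d' p'" "hpoly d' q'" "restr N q' \<noteq> 0"
      using pq' unfolding fractions_iff by blast
    have 1: "hpoly (d * e) (\<lambda>v. p (F v))" "hpoly (d * e) (\<lambda>v. q (F v))"
      by (intro hpoly_compose h F)+
    have 2: "hpoly (d * e + d') (\<lambda>v. p (F v) * q' v)" by (intro hpoly_mult 1 h')
    have 3: "hpoly (d * e + d') (\<lambda>v. p' v * q (F v))"
      using hpoly_mult[OF h'(1) 1(2)] by (simp add: add.commute)
    have "p (rep_P3 (f x)) * q' (rep_P3 x) = p' (rep_P3 x) * q (rep_P3 (f x)) \<longleftrightarrow>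
        p (F (rep_P3 x)) * q' (rep_P3 x) - p' (rep_P3 x) * q (F (rep_P3 x)) = 0" if x: "x \<in> weber_curve N" for x
    proof -
      obtain c where c: "c \<noteq> 0" "rep_P3 (f x) = c *s F (rep_P3 x)"
        using rep_abs_P3[OF F(2)[OF rep_P3_nonzero]] F(3)[OF x] by metis
      have "p (rep_P3 (f x)) * q' (rep_P3 x) - p' (rep_P3 x) * q (rep_P3 (f x)) =
          c ^ d * (p (F (rep_P3 x)) * q' (rep_P3 x) - p' (rep_P3 x) * q (F (rep_P3 x)))"
        unfolding c(2) by (simp add: hpoly_homogeneous[OF h(1)] hpoly_homogeneous[OF h(2)] algebra_simps)
      then have "p (rep_P3 (f x)) * q' (rep_P3 x) - p' (rep_P3 x) * q (rep_P3 (f x)) = 0 \<longleftrightarrow>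
          p (F (rep_P3 x)) * q' (rep_P3 x) - p' (rep_P3 x) * q (F (rep_P3 x)) = 0"
        using c(1) by (simp only: mult_eq_0_iff power_eq_0_iff) simp
      then show ?thesis by simp
    qed
    then have "(\<forall>x\<in>weber_curve N. p (rep_P3 (f x)) * q' (rep_P3 x) = p' (rep_P3 x) * q (rep_P3 (f x))) \<longleftrightarrow>
       (\<forall>x\<in>weber_curve N. (\<lambda>v. p (F v) * q' v - p' v * q (F v)) (rep_P3 x) = 0)" by simp
    also have "\<dots> \<longleftrightarrow> restr N (\<lambda>v. p (F v)) * restr N q' = restr N p' * restr N (\<lambda>v. q (F v))"
      unfolding vanishes_on_curve[OF hpoly_diff[OF 2 3]] restr_diff[OF 2 3]
        restr_mult[OF 1(1) h'(2)] restr_mult[OF h'(1) 1(2)] by simp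
    also have "\<dots> \<longleftrightarrow> \<Theta> (emb (restr M p)) * emb (restr N q') = emb (restr N p') * \<Theta> (emb (restr M q))"
      unfolding \<Theta>[OF h(1), symmetric] \<Theta>[OF h(2), symmetric]
      by (simp add: emb_simps(6)[symmetric] emb_simps(7))
    also have "\<dots> \<longleftrightarrow> val N (p', q') = \<Theta> b"
    proof -
      have "\<Theta> b = \<Theta> (emb (restr M p)) / \<Theta> (emb (restr M q))"
        unfolding b divide_inverse field_hom_mult[OF hom] field_hom_inverse[OF hom] ..
      moreover have "\<Theta> (emb (restr M q)) \<noteq> 0" using h(3) by (simp add: field_hom_eq_0[OF hom] emb_simps)
      ultimately show ?thesis using h'(3) by (auto simp: val_def emb_simps frac_eq_eq)
    qed
    finally show ?thesis .
  qed
  obtain p q where pq: "(p, q) \<in> cls M b" using cls_nonempty[OF assms(2)] .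
  have "(\<forall>(p, q)\<in>cls M b. \<forall>x\<in>weber_curve N. p (rep_P3 (f x)) * q' (rep_P3 x) = p' (rep_P3 x) * q (rep_P3 (f x))) \<longleftrightarrow>
      val N (p', q') = \<Theta> b" if "(p', q') \<in> fractions (weber_curve N)" for p' q'
  proof
    assume "\<forall>(p, q)\<in>cls M b. \<forall>x\<in>weber_curve N. p (rep_P3 (f x)) * q' (rep_P3 x) = p' (rep_P3 x) * q (rep_P3 (f x))"
    from bspec[OF this pq] show "val N (p', q') = \<Theta> b" using key[OF pq that] by simp
  next
    assume "val N (p', q') = \<Theta> b"
    then show "\<forall>(p, q)\<in>cls M b. \<forall>x\<in>weber_curve N. p (rep_P3 (f x)) * q' (rep_P3 x) = p' (rep_P3 x) * q (rep_P3 (f x))"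
      using key[OF _ that] by auto
  qed
  note iff = this
  show ?thesis
  proof (rule Set.set_eqI)
    fix r
    show "r \<in> pullback (weber_curve N) f (cls M b) \<longleftrightarrow> r \<in> cls N (\<Theta> b)"
      unfolding pullback_def cls_def[of N] using iff by (cases r) (simp cong: conj_cong)
  qed
qed

subsection \<open>Action of the modular group\<close>

lemma det_SL2: "det (A :: int ^ 2 ^ 2) = A $ 1 $ 1 * A $ 2 $ 2 - A $ 1 $ 2 * A $ 2 $ 1"
  by (rule det_2)

lemma moebius_denominator_nonzero:
  fixes A :: "int ^ 2 ^ 2"
  assumes "det A = 1" "Im \<tau> > 0"
  shows "of_int (A $ 2 $ 1) * \<tau> + of_int (A $ 2 $ 2) \<noteq> 0"
proof
  assume 0: "of_int (A $ 2 $ 1) * \<tau> + of_int (A $ 2 $ 2) = 0"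
  then have "Im (of_int (A $ 2 $ 1) * \<tau> + of_int (A $ 2 $ 2)) = 0" by simp
  then have "A $ 2 $ 1 = 0" using assms(2) by simp
  moreover from this 0 have "A $ 2 $ 2 = 0" by simp
  ultimately show False using assms(1) by (simp add: det_SL2)
qed

lemma Im_moebius_act:
  assumes "det A = 1" "Im \<tau> > 0"
  shows "Im (moebius_act A \<tau>) > 0"
proof -
  define a b c d where "a = real_of_int (A $ 1 $ 1)" "b = real_of_int (A $ 1 $ 2)"
    "c = real_of_int (A $ 2 $ 1)" "d = real_of_int (A $ 2 $ 2)"
  have det: "a * d - b * c = 1"
  proof -
    have "real_of_int (A $ 1 $ 1 * A $ 2 $ 2 - A $ 1 $ 2 * A $ 2 $ 1) = real_of_int 1"
      by (simp only: assms(1)[unfolded det_SL2])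
    then show ?thesis unfolding a_b_c_d_def by (simp only: of_int_diff of_int_mult of_int_1)
  qed
  have nz: "of_real c * \<tau> + of_real d \<noteq> 0"
    using moebius_denominator_nonzero[OF assms] unfolding a_b_c_d_def by (simp only: of_real_of_int_eq not_False_eq_True)
  define w where "w = of_real c * \<tau> + of_real d"
  have "moebius_act A \<tau> = (of_real a * \<tau> + of_real b) / w"
    by (simp add: moebius_act_def a_b_c_d_def w_def)
  also have "\<dots> = (of_real a * \<tau> + of_real b) * cnj w / of_real ((norm w)\<^sup>2)"
    by (rule complex_div_cnj)
  finally have "Im (moebius_act A \<tau>) = Im ((of_real a * \<tau> + of_real b) * cnj w) / (norm w)\<^sup>2"
    by simp
  also have "Im ((of_real a * \<tau> + of_real b) * cnj w) = (a * d - b * c) * Im \<tau>"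
    by (simp add: w_def algebra_simps)
  also have "\<dots> = Im \<tau>" by (simp add: det)
  finally show ?thesis using assms(2) nz by (simp add: w_def)
qed

lemma moebius_act_mult:
  assumes "det A = 1" "det B = 1" "Im \<tau> > 0"
  shows "moebius_act (A ** B) \<tau> = moebius_act A (moebius_act B \<tau>)"
proof -
  define p q r s where "p = complex_of_int (A $ 1 $ 1)" "q = complex_of_int (A $ 1 $ 2)"
    "r = complex_of_int (A $ 2 $ 1)" "s = complex_of_int (A $ 2 $ 2)"
  define u where "u = of_int (B $ 1 $ 1) * \<tau> + of_int (B $ 1 $ 2)"
  define w where "w = of_int (B $ 2 $ 1) * \<tau> + of_int (B $ 2 $ 2)"
  have w: "w \<noteq> 0" unfolding w_def by (rule moebius_denominator_nonzero[OF assms(2,3)])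
  have "moebius_act (A ** B) \<tau> = (p * u + q * w) / (r * u + s * w)"
    by (simp add: moebius_act_def matrix_matrix_mult_def sum_2 p_q_r_s_def u_def w_def algebra_simps)
  also have "\<dots> = (p * (u / w) + q) / (r * (u / w) + s)"
  proof -
    have "p * u + q * w = (p * (u / w) + q) * w" "r * u + s * w = (r * (u / w) + s) * w"
      using w by (simp_all add: distrib_right)
    then show ?thesis using w by simp
  qed
  also have "\<dots> = moebius_act A (moebius_act B \<tau>)"
    by (simp add: moebius_act_def p_q_r_s_def u_def w_def)
  finally show ?thesis .
qed

lemma moebius_act_one: "moebius_act (mat 1) \<tau> = \<tau>"
  by (simp add: moebius_act_def mat_def)

lemma moebius_act_uminus: "moebius_act (- A) \<tau> = moebius_act A \<tau>"
proof -
  have "moebius_act (- A) \<tau> =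
    (- (of_int (A $ 1 $ 1) * \<tau> + of_int (A $ 1 $ 2))) / (- (of_int (A $ 2 $ 1) * \<tau> + of_int (A $ 2 $ 2)))"
    by (simp add: moebius_act_def)
  moreover have "(- x) / (- y) = x / y" for x y :: complex by simp
  ultimately show ?thesis by (simp only: moebius_act_def)
qed

lemma holomorphic_moebius_act:
  assumes "det A = 1"
  shows "moebius_act A holomorphic_on upper_half_plane"
  unfolding moebius_act_def[abs_def]
  using moebius_denominator_nonzero[OF assms] by (auto intro!: holomorphic_intros)

lemma SL2_inverse:
  assumes "det (A :: int ^ 2 ^ 2) = 1"
  obtains B where "det B = 1" "A ** B = mat 1" "B ** A = mat 1"
proof
  define B :: "int ^ 2 ^ 2" where
    "B = vector [vector [A $ 2 $ 2, - A $ 1 $ 2], vector [- A $ 2 $ 1, A $ 1 $ 1]]"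
  have B: "B $ 1 $ 1 = A $ 2 $ 2" "B $ 1 $ 2 = - A $ 1 $ 2" "B $ 2 $ 1 = - A $ 2 $ 1" "B $ 2 $ 2 = A $ 1 $ 1"
    by (simp_all add: B_def)
  have det: "A $ 1 $ 1 * A $ 2 $ 2 - A $ 1 $ 2 * A $ 2 $ 1 = 1" using assms by (simp add: det_SL2)
  show "det B = 1" using det by (simp add: det_SL2 B mult.commute)
  show "A ** B = mat 1" "B ** A = mat 1"
    using det by (simp_all add: vec_eq_iff forall_2 matrix_matrix_mult_def sum_2 mat_def B algebra_simps)
qed

section \<open>Matrices as homomorphisms of holomorphic and meromorphic functions\<close>

definition hact :: "int ^ 2 ^ 2 \<Rightarrow> holo \<Rightarrow> holo" where
  "hact A a = mk_holo (\<lambda>\<tau>. hfun a (moebius_act A \<tau>))"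

lemma hfun_hact:
  assumes "det A = 1" "Im \<tau> > 0"
  shows "hfun (hact A a) \<tau> = hfun a (moebius_act A \<tau>)"
proof -
  have "(\<lambda>\<tau>. hfun a (moebius_act A \<tau>)) holomorphic_on upper_half_plane"
    using holomorphic_on_compose_gen[OF holomorphic_moebius_act[OF assms(1)] holomorphic_hfun[of a]]
    by (simp add: o_def image_subset_iff Im_moebius_act[OF assms(1)])
  then show ?thesis unfolding hact_def by (rule hfun_mk_holo[OF _ assms(2)])
qed

lemma hact_hom:
  assumes "det A = 1"
  shows "hact A 1 = 1" "hact A (a + b) = hact A a + hact A b" "hact A (a * b) = hact A a * hact A b"
    "hact A (hconst c) = hconst c"
  by (rule holo_eqI; simp add: hfun_hact[OF assms] hfun_ops hfun_hconst Im_moebius_act[OF assms])+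

text \<open>Evaluation at the image under the inverse matrix recovers \<open>a\<close>. Injectivity
  is what permits the extension to fractions.\<close>

lemma hact_eq_0:
  assumes "det A = 1" "hact A a = 0"
  shows "a = 0"
proof (rule holo_eqI)
  fix \<tau> assume \<tau>: "Im \<tau> > 0"
  obtain B where B: "det B = 1" "A ** B = mat 1" using SL2_inverse[OF assms(1)] by metis
  have "\<tau> = moebius_act A (moebius_act B \<tau>)"
    by (simp add: moebius_act_mult[OF assms(1) B(1) \<tau>, symmetric] B(2) moebius_act_one)
  then have "hfun a \<tau> = hfun (hact A a) (moebius_act B \<tau>)"
    using hfun_hact[OF assms(1) Im_moebius_act[OF B(1) \<tau>]] by simp
  then show "hfun a \<tau> = hfun 0 \<tau>"
    using assms(2) \<tau> Im_moebius_act[OF B(1) \<tau>] by (simp add: hfun_ops)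
qed

text \<open>Universal property of the fraction field; injectivity keeps the denominators
  nonzero.\<close>

lemma fract_hom_extension:
  fixes \<theta> :: "holo \<Rightarrow> holo"
  assumes one: "\<theta> 1 = 1" and add: "\<And>a b. \<theta> (a + b) = \<theta> a + \<theta> b"
    and mult: "\<And>a b. \<theta> (a * b) = \<theta> a * \<theta> b" and inj: "\<And>a. \<theta> a = 0 \<Longrightarrow> a = 0"
  shows "\<exists>\<Theta>. field_hom \<Theta> \<and> (\<forall>a. \<Theta> (emb a) = emb (\<theta> a))"
proof -
  define \<Theta> :: "mero \<Rightarrow> mero" where
    "\<Theta> x = (let r = (SOME r. snd r \<noteq> 0 \<and> x = Fract (fst r) (snd r)) in Fract (\<theta> (fst r)) (\<theta> (snd r)))" for x
  have nz: "\<theta> b \<noteq> 0" if "b \<noteq> 0" for b using inj[of b] that by blast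
  have \<Theta>: "\<Theta> (Fract a b) = Fract (\<theta> a) (\<theta> b)" if b: "b \<noteq> 0" for a b
  proof -
    define r where "r = (SOME r. snd r \<noteq> 0 \<and> Fract a b = Fract (fst r) (snd r))"
    have "snd r \<noteq> 0 \<and> Fract a b = Fract (fst r) (snd r)"
      unfolding r_def by (rule someI[of _ "(a, b)"]) (use b in simp)
    then have "snd r \<noteq> 0" "a * snd r = fst r * b" using eq_fract(1)[OF b, of "snd r" a "fst r"] by blast+
    then have "\<theta> a * \<theta> (snd r) = \<theta> (fst r) * \<theta> b" by (simp flip: mult)
    then show ?thesis using nz \<open>snd r \<noteq> 0\<close> b
      by (simp add: \<Theta>_def Let_def r_def[symmetric] eq_fract)
  qed
  have "field_hom \<Theta>" unfolding field_hom_def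
  proof (intro conjI allI)
    show "\<Theta> 1 = 1" using \<Theta>[of 1 1] by (simp add: One_fract_def one)
    fix x y :: mero
    obtain a b where x: "x = Fract a b" "b \<noteq> 0" by (cases x)
    obtain c d where y: "y = Fract c d" "d \<noteq> 0" by (cases y)
    show "\<Theta> (x + y) = \<Theta> x + \<Theta> y" "\<Theta> (x * y) = \<Theta> x * \<Theta> y"
      using x y nz by (simp_all add: \<Theta> add mult)
  qed
  moreover have "\<Theta> (emb a) = emb (\<theta> a)" for a by (simp add: emb_def \<Theta> one)
  ultimately show ?thesis by blast
qed

text \<open>Each matrix gives one homomorphism on all of \<open>mero\<close>, so that it can serve
  in Kummer theory over any intermediate field.\<close>

definition mact :: "int ^ 2 ^ 2 \<Rightarrow> mero \<Rightarrow> mero" where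
  "mact A = (SOME \<Theta>. field_hom \<Theta> \<and> (\<forall>a. \<Theta> (emb a) = emb (hact A a)))"

lemma
  assumes "det A = 1"
  shows field_hom_mact: "field_hom (mact A)" and mact_emb: "mact A (emb a) = emb (hact A a)"
    and mact_cst: "mact A (cst c) = cst c"
proof -
  have "\<exists>\<Theta>. field_hom \<Theta> \<and> (\<forall>a. \<Theta> (emb a) = emb (hact A a))"
    by (rule fract_hom_extension) (auto simp: hact_hom[OF assms] dest: hact_eq_0[OF assms])
  then have *: "field_hom (mact A) \<and> (\<forall>a. mact A (emb a) = emb (hact A a))"
    unfolding mact_def by (rule someI_ex)
  then show "field_hom (mact A)" "mact A (emb a) = emb (hact A a)" by simp_all
  show "mact A (cst c) = cst c" using * by (simp add: cst_def hact_hom[OF assms])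
qed

section \<open>Matrices that act on the generators by scalars\<close>

fun coord3 :: "complex \<times> complex \<times> complex \<Rightarrow> nat \<Rightarrow> complex" where
  "coord3 (a, b, c) i = (if i = 0 then a else if i = 1 then b else c)"

lemma coord3_eqI: "coord3 g 0 = coord3 h 0 \<Longrightarrow> coord3 g 1 = coord3 h 1 \<Longrightarrow> coord3 g 2 = coord3 h 2 \<Longrightarrow> g = h"
  by (cases g; cases h) simp

text \<open>\<open>mults N g A\<close>: the functions generating the function field of the \<open>N\<close>-th Weber curve are
  eigenfunctions of \<open>A\<close> with eigenvalues \<open>g\<close>.\<close>

definition mults :: "nat \<Rightarrow> complex \<times> complex \<times> complex \<Rightarrow> int ^ 2 ^ 2 \<Rightarrow> bool" where
  "mults N g A \<longleftrightarrow> det A = 1 \<and> (\<forall>i<3. \<forall>\<tau>. Im \<tau> > 0 \<longrightarrow>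
     uw i (moebius_act A \<tau>) ^ (24 div N) = coord3 g i * uw i \<tau> ^ (24 div N))"

lemma mults_det: "mults N g A \<Longrightarrow> det A = 1"
  by (simp add: mults_def)

lemma multsD: "mults N g A \<Longrightarrow> i < 3 \<Longrightarrow> Im \<tau> > 0 \<Longrightarrow>
    uw i (moebius_act A \<tau>) ^ (24 div N) = coord3 g i * uw i \<tau> ^ (24 div N)"
  by (simp add: mults_def)

lemma mults_unique:
  assumes "mults N g A" "mults N h A" shows "g = h"
proof -
  have "coord3 g i = coord3 h i" if "i < 3" for i
    using multsD[OF assms(1) that, of \<i>] multsD[OF assms(2) that, of \<i>] uw_nonzero[of \<i> i] by simp
  then show ?thesis by (intro coord3_eqI) simp_all
qed

definition tmul :: "complex \<times> complex \<times> complex \<Rightarrow> complex \<times> complex \<times> complex \<Rightarrow> complex \<times> complex \<times> complex" where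
  "tmul g h = (coord3 g 0 * coord3 h 0, coord3 g 1 * coord3 h 1, coord3 g 2 * coord3 h 2)"

lemma coord3_tmul: "i < 3 \<Longrightarrow> coord3 (tmul g h) i = coord3 g i * coord3 h i"
  by (auto simp: tmul_def less_3_cases)

lemma mults_mult:
  assumes g: "mults N g A" and h: "mults N h B"
  shows "mults N (tmul g h) (A ** B)"
  unfolding mults_def
proof (intro conjI allI impI)
  show "det (A ** B) = 1" using mults_det[OF g] mults_det[OF h] by (simp add: det_mul)
  fix i :: nat and \<tau> assume i: "i < 3" and \<tau>: "Im \<tau> > 0"
  show "uw i (moebius_act (A ** B) \<tau>) ^ (24 div N) = coord3 (tmul g h) i * uw i \<tau> ^ (24 div N)"
    unfolding moebius_act_mult[OF mults_det[OF g] mults_det[OF h] \<tau>]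
      multsD[OF g i Im_moebius_act[OF mults_det[OF h] \<tau>]] multsD[OF h i \<tau>] coord3_tmul[OF i]
    by (simp add: mult.assoc)
qed

lemma mults_one: "mults N (1, 1, 1) (mat 1)"
  by (auto simp: mults_def moebius_act_one less_3_cases)

lemma mults_uminus: "mults N g (- A) \<longleftrightarrow> mults N g A"
  unfolding mults_def by (simp add: moebius_act_uminus det_SL2)

lemma mults_nonzero:
  assumes "mults N g A" "i < 3" shows "coord3 g i \<noteq> 0"
proof
  assume "coord3 g i = 0"
  then have "uw i (moebius_act A \<i>) ^ (24 div N) = 0" using multsD[OF assms, of \<i>] by simp
  then show False using uw_nonzero[OF Im_moebius_act[OF mults_det[OF assms(1)], of \<i>], of i] by simp
qed

definition tinv :: "complex \<times> complex \<times> complex \<Rightarrow> complex \<times> complex \<times> complex" where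
  "tinv g = (inverse (coord3 g 0), inverse (coord3 g 1), inverse (coord3 g 2))"

lemma coord3_tinv: "i < 3 \<Longrightarrow> coord3 (tinv g) i = inverse (coord3 g i)"
  by (auto simp: tinv_def less_3_cases)

lemma mults_inverse:
  assumes g: "mults N g A" and B: "det B = 1" "A ** B = mat 1"
  shows "mults N (tinv g) B"
  unfolding mults_def
proof (intro conjI allI impI B)
  fix i :: nat and \<tau> assume i: "i < 3" and \<tau>: "Im \<tau> > 0"
  have "uw i \<tau> ^ (24 div N) = uw i (moebius_act A (moebius_act B \<tau>)) ^ (24 div N)"
    by (simp add: moebius_act_mult[OF mults_det[OF g] B(1) \<tau>, symmetric] B(2) moebius_act_one)
  also have "\<dots> = coord3 g i * uw i (moebius_act B \<tau>) ^ (24 div N)"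
    by (rule multsD[OF g i Im_moebius_act[OF B(1) \<tau>]])
  finally show "uw i (moebius_act B \<tau>) ^ (24 div N) = coord3 (tinv g) i * uw i \<tau> ^ (24 div N)"
    using mults_nonzero[OF g i] by (simp add: coord3_tinv[OF i])
qed

lemma div_24_mult:
  assumes "m * n dvd 24" shows "24 div n = 24 div (m * n) * m" "m > 0" "n > (0::nat)"
proof -
  from assms obtain k where k: "24 = m * n * k" by (elim dvdE)
  show m: "m > 0" and n: "n > 0" using k by (auto intro: gr0I)
  show "24 div n = 24 div (m * n) * m" unfolding k using m n by simp
qed

lemma mults_power:
  assumes "mults (m * n) g A" "m * n dvd 24" "\<And>i. i < 3 \<Longrightarrow> coord3 h i = coord3 g i ^ m"
  shows "mults n h A"
  unfolding mults_def div_24_mult(1)[OF assms(2)]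
  using multsD[OF assms(1)] mults_det[OF assms(1)] assms(3)
  by (simp add: power_mult power_mult_distrib)

lemma mults_exists:
  assumes "mults n (1, 1, 1) A" "m * n dvd 24"
  shows "\<exists>g. (\<forall>i<3. coord3 g i ^ m = 1) \<and> mults (m * n) g A"
proof -
  note det = mults_det[OF assms(1)]
  let ?e = "24 div (m * n)"
  have "\<exists>c. \<forall>\<tau>\<in>upper_half_plane. uw i (moebius_act A \<tau>) ^ ?e / uw i \<tau> ^ ?e = c" if i: "i < 3" for i
  proof (rule continuous_root_of_unity_constant[OF connected_upper_half_plane _ div_24_mult(2)[OF assms(2)]])
    have cu: "continuous_on upper_half_plane (uw i)"
      by (rule holomorphic_on_imp_continuous_on[OF uw_holomorphic])
    have cm: "continuous_on upper_half_plane (moebius_act A)"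
      by (rule holomorphic_on_imp_continuous_on[OF holomorphic_moebius_act[OF det]])
    show "continuous_on upper_half_plane (\<lambda>\<tau>. uw i (moebius_act A \<tau>) ^ ?e / uw i \<tau> ^ ?e)"
      by (intro continuous_intros cu continuous_on_compose2[OF cu cm])
        (auto simp: Im_moebius_act[OF det] uw_nonzero)
    fix \<tau> assume "\<tau> \<in> upper_half_plane"
    then have \<tau>: "Im \<tau> > 0" by simp
    have "coord3 (1, 1, 1) i = 1" by simp
    then have "(uw i (moebius_act A \<tau>) ^ ?e) ^ m = (uw i \<tau> ^ ?e) ^ m"
      using multsD[OF assms(1) i \<tau>] by (simp add: div_24_mult(1)[OF assms(2)] power_mult)
    then show "(uw i (moebius_act A \<tau>) ^ ?e / uw i \<tau> ^ ?e) ^ m = 1"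
      using uw_nonzero[OF \<tau>] by (simp add: power_divide)
  qed
  then obtain c where c: "\<And>i \<tau>. i < 3 \<Longrightarrow> Im \<tau> > 0 \<Longrightarrow> uw i (moebius_act A \<tau>) ^ ?e / uw i \<tau> ^ ?e = c i"
    unfolding Ball_def in_upper_half_plane by metis
  define g where "g = (c 0, c 1, c 2)"
  have g: "coord3 g i = c i" if "i < 3" for i using that by (auto simp: g_def less_3_cases)
  have eq: "uw i (moebius_act A \<tau>) ^ ?e = coord3 g i * uw i \<tau> ^ ?e" if "i < 3" "Im \<tau> > 0" for i \<tau>
    using c[OF that] uw_nonzero[OF that(2), of i] by (simp add: g[OF that(1)] field_simps)
  then have m: "mults (m * n) g A" using det by (simp add: mults_def)
  have one: "coord3 (1, 1, 1) i = 1" for i by simp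
  have "coord3 g i ^ m = 1" if i: "i < 3" for i
  proof -
    have "coord3 g i ^ m * uw i \<i> ^ (24 div n) = uw i \<i> ^ (24 div n)"
      using multsD[OF assms(1) i, of \<i>] eq[OF i, of \<i>] one[of i]
      by (simp del: coord3.simps add: div_24_mult(1)[OF assms(2)] power_mult power_mult_distrib)
    then show ?thesis using uw_nonzero[of \<i> i] by simp
  qed
  with m show ?thesis by blast
qed

lemma hact_xh: "mults N g A \<Longrightarrow> i < 3 \<Longrightarrow> hact A (xh N i) = hconst (coord3 g i) * xh N i"
  by (rule holo_eqI)
    (simp add: hfun_hact mults_det hfun_ops hfun_hconst hfun_xh multsD Im_moebius_act)

lemma mact_xx: "mults N g A \<Longrightarrow> i < 3 \<Longrightarrow> mact A (xx N i) = cst (coord3 g i) * xx N i"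
  by (simp add: xx_def mact_emb[OF mults_det] hact_xh emb_simps cst_def)

definition tvec :: "complex \<times> complex \<times> complex \<Rightarrow> complex ^ 4 \<Rightarrow> complex ^ 4" where
  "tvec g v = hcoords (coord3 g 0 * v $ 0) (coord3 g 1 * v $ 1) (coord3 g 2 * v $ 2) (v $ 3)"

lemma tvec_nth: "tvec g v $ 0 = coord3 g 0 * v $ 0" "tvec g v $ 1 = coord3 g 1 * v $ 1"
  "tvec g v $ 2 = coord3 g 2 * v $ 2" "tvec g v $ 3 = v $ 3"
  by (simp_all add: tvec_def)

lemma hpoly_tvec: "hpoly 1 (\<lambda>v. tvec g v $ i)"
  using P3_coord_cases[of i] by (elim disjE) (simp_all only: tvec_nth hpoly_scale hpoly_coord)

lemma tvec_nonzero: "(\<And>i. i < 3 \<Longrightarrow> coord3 g i \<noteq> 0) \<Longrightarrow> v \<noteq> 0 \<Longrightarrow> tvec g v \<noteq> 0"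
  by (auto simp only: P3_vec_eq_iff tvec_nth zero_index mult_eq_0_iff)

lemma torus_act_eq: "torus_act g x = abs_P3 (tvec g (rep_P3 x))"
  by (cases g) (simp add: tvec_def Let_def)

lemma tvec_scale: "tvec g (c *s v) = c *s tvec g v"
  by (simp add: P3_vec_eq_iff tvec_nth del: coord3.simps)

lemma tvec_tvec: "tvec g (tvec h v) = tvec (tmul g h) v"
  by (simp add: P3_vec_eq_iff tvec_nth coord3_tmul mult.assoc del: coord3.simps)

text \<open>Multiplying the coordinates of the point at \<tau> by \<open>g\<close> gives the point
  at A \<tau>. Hence the torus element preserves the curve and acts on functions as A does.\<close>

lemma comorph_torus:
  assumes "mults N g A"
  shows "comorph N N (torus_act g) (mact A)"
proof -
  have Fw: "tvec g (weber_vec N \<tau>) = weber_vec N (moebius_act A \<tau>)" if "Im \<tau> > 0" for \<tau>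
    using multsD[OF assms _ that, of 0] multsD[OF assms _ that, of 1] multsD[OF assms _ that, of 2]
    by (simp add: P3_vec_eq_iff tvec_nth weber_vec_nth)
  have "emb (restr N (\<lambda>v. p (tvec g v))) = mact A (emb (restr N p))" if p: "hpoly d p" for d p
  proof -
    have "restr N (\<lambda>v. p (tvec g v)) = hact A (restr N p)"
      by (rule holo_eqI) (simp add: hfun_restr[OF hpoly_compose[OF p hpoly_tvec]] Fw
          hfun_hact[OF mults_det[OF assms]] hfun_restr[OF p] Im_moebius_act[OF mults_det[OF assms]])
    then show ?thesis by (simp add: mact_emb[OF mults_det[OF assms]])
  qed
  then show ?thesis
    unfolding comorph_def using field_hom_mact[OF mults_det[OF assms]] hpoly_tvec
      tvec_nonzero[OF mults_nonzero[OF assms]] torus_act_eq by blast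
qed

lemma field_hom_id: "field_hom (\<lambda>a. a)"
  by (simp add: field_hom_def)

text \<open>A function on the lower curve, read as a function of \<tau>, is not changed by the
  pullback; the induced homomorphism is therefore the identity.\<close>

lemma comorph_weber_map:
  assumes "m * n dvd 24"
  shows "comorph (m * n) n (weber_map m) (\<lambda>a. a)"
proof -
  define F :: "complex ^ 4 \<Rightarrow> complex ^ 4" where "F v = (\<chi> i. v $ i ^ m)" for v
  have m: "m > 0" using div_24_mult(2)[OF assms] .
  have hF: "hpoly m (\<lambda>v. F v $ i)" for i by (simp add: F_def hpoly_coord_power)
  have F0: "F v \<noteq> 0" if "v \<noteq> 0" for v using that m by (auto simp: vec_eq_iff F_def)
  have Fw: "F (weber_vec (m * n) \<tau>) = weber_vec n \<tau>" for \<tau>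
    by (simp add: P3_vec_eq_iff F_def weber_vec_nth div_24_mult(1)[OF assms] power_mult)
  have "emb (restr (m * n) (\<lambda>v. p (F v))) = emb (restr n p)" for p by (simp add: restr_def Fw)
  moreover have "weber_map m x = abs_P3 (F (rep_P3 x))" for x by (simp add: weber_map_def F_def)
  ultimately show ?thesis unfolding comorph_def
    by (intro conjI exI[of _ F] exI[of _ m] field_hom_id allI impI ballI hF F0)
qed

section \<open>Algebraic relations between the generators\<close>

lemma xx_nonzero: "xx N i \<noteq> 0"
proof
  assume "xx N i = 0"
  then have "hfun (xh N i) \<i> = hfun 0 \<i>" by (simp add: xx_def emb_simps)
  then show False using uw_nonzero[of \<i> i] by (simp add: hfun_xh hfun_ops)
qed

lemma xx_power:
  assumes "m * n dvd 24" shows "xx (m * n) i ^ m = xx n i"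
  unfolding xx_def emb_power[symmetric] emb_simps(7)
  by (rule holo_eqI) (simp add: hfun_power hfun_xh div_24_mult(1)[OF assms] power_mult)

lemma xx_mult: "xx N 0 * xx N 1 * xx N 2 = cst (of_real (sqrt 2) ^ (24 div N))"
  unfolding xx_def emb_simps(6)[symmetric] cst_def emb_simps(7)
  by (rule holo_eqI) (simp add: hfun_ops hfun_xh hfun_hconst power_mult_distrib[symmetric]
      uw_mult[unfolded One_nat_def])

text \<open>At level 3 n the exponent 24/(3 n), multiplied by n, is 8; so this is the relation
  between the eighth powers of the Weber functions.\<close>

lemma xx_sum:
  assumes "3 * n dvd 24"
  shows "xx (3 * n) 0 ^ n + xx (3 * n) 1 ^ n + xx (3 * n) 2 ^ n = 0"
proof -
  have "24 div (3 * n) * n = 8"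
  proof -
    from assms obtain k where "24 = 3 * n * k" by (elim dvdE)
    then have "3 * (n * k) = 3 * 8" by (simp only: mult.assoc)
    then have "n * k = 8" by linarith
    then have "3 * n \<noteq> 0" by (cases n) auto
    have "24 div (3 * n) = 3 * n * k div (3 * n)" using \<open>24 = 3 * n * k\<close> by (simp only:)
    also have "\<dots> = k" using \<open>3 * n \<noteq> 0\<close> by (rule nonzero_mult_div_cancel_left)
    finally show ?thesis using \<open>n * k = 8\<close> by (simp add: mult.commute)
  qed
  then show ?thesis
    unfolding xx_def emb_power[symmetric] emb_simps(1)[symmetric] emb_simps(3)[symmetric] emb_simps(7)
    by (intro holo_eqI) (simp add: hfun_ops hfun_power hfun_xh power_mult[symmetric] uw_sum[unfolded One_nat_def])
qed

lemma xx_power_not_constant: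
  assumes "N dvd 24" "k > 0" "i < 3" shows "xx N i ^ k \<noteq> cst c"
proof
  assume "xx N i ^ k = cst c"
  then have eq: "xh N i ^ k = hconst c"
    unfolding xx_def cst_def by (simp add: emb_power[symmetric] emb_simps)
  have "uw i \<tau> ^ (24 div N * k) = c" if "Im \<tau> > 0" for \<tau>
    using that arg_cong[OF eq, of "\<lambda>a. hfun a \<tau>"] by (simp add: hfun_power hfun_xh hfun_hconst power_mult)
  moreover have "N > 0" using assms(1) by (auto intro!: Nat.gr0I)
  then have "24 div N * k > 0" using assms(1,2) by (simp add: div_greater_zero_iff dvd_imp_le)
  ultimately show False using uw_not_constant[OF assms(3)] by blast
qed

text \<open>The \<open>n\<close>-th power \<open>s\<close> of the ratio of two of the generators satisfies a quadratic equation over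
  the smaller field, by the two equations of the curve, and its cube lies in that field.\<close>

lemma ratio_mem:
  assumes n: "3 * n dvd 24"
  shows "xx (3 * n) 1 / xx (3 * n) 0 \<in> KK n"
proof -
  define a where "a i = xx (3 * n) i" for i
  define r where "r = a 1 / a 0"
  define s where "s = r ^ n"
  \<comment> \<open>By the product relation this is the n-th power of a_1 a_2 / a_0^2, that is, the
    product of \<open>s\<close> and the n-th power of a_2 / a_0.\<close>
  define B where "B = cst (of_real (sqrt 2) ^ (24 div (3 * n))) ^ n / xx n 0 ^ n"
  note L = subfld_KK[of n]
  have n0: "n > 0" using div_24_mult(3)[OF n] .
  have "n dvd 24" using n by (metis dvd_mult_right)
  have a0: "a i \<noteq> 0" for i by (simp add: a_def xx_nonzero)
  have a3: "a i ^ 3 = xx n i" for i unfolding a_def by (rule xx_power[OF n])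
  have r3: "r ^ 3 = xx n 1 / xx n 0" by (simp add: r_def power_divide a3)
  then have r3L: "r ^ 3 \<in> KK n" using xx_KK[of 0 n] xx_KK[of 1 n] by (simp add: subfld_divide[OF L])
  then have s3L: "s ^ 3 \<in> KK n" unfolding s_def using subfld_power[OF L, of "r ^ 3" n]
    by (metis power_mult mult.commute)
  have BL: "B \<in> KK n" unfolding B_def using xx_KK[of 0 n] cst_KK
    by (intro subfld_divide[OF L] subfld_power[OF L]) auto
  have B: "s * (a 2 / a 0) ^ n = B"
  proof -
    have "r * (a 2 / a 0) = (a 0 * a 1 * a 2) / (a 0 ^ 3)"
      using a0 by (simp add: r_def power3_eq_cube)
    then have "r * (a 2 / a 0) = cst (of_real (sqrt 2) ^ (24 div (3 * n))) / xx n 0"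
      using xx_mult[of "3 * n"] a3[of 0] by (simp add: a_def)
    then show ?thesis by (simp add: s_def B_def power_mult_distrib[symmetric] power_divide[symmetric])
  qed
  have sum: "1 + s + (a 2 / a 0) ^ n = 0"
  proof -
    have "(1 + s + (a 2 / a 0) ^ n) * a 0 ^ n = a 0 ^ n + a 1 ^ n + a 2 ^ n"
      using a0 by (simp add: s_def r_def power_divide distrib_right)
    also have "\<dots> = 0" using xx_sum[OF n] by (simp add: a_def)
    finally show ?thesis using a0[of 0] by simp
  qed
  have t: "(a 2 / a 0) ^ n = - 1 - s" using sum by (simp add: eq_neg_iff_add_eq_0 algebra_simps)
  have quad: "s ^ 2 = - s - B" unfolding B[symmetric] t by (simp add: power2_eq_square algebra_simps)
  \<comment> \<open>Reduction of s^3 modulo the quadratic equation leaves an expression linear in s,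
    which is then solved for s.\<close>
  have "s ^ 3 = s * (- s - B)" unfolding quad[symmetric] by (simp add: power3_eq_cube power2_eq_square)
  also have "\<dots> = - (s ^ 2) - B * s" by (simp add: power2_eq_square algebra_simps)
  also have "\<dots> = s * (1 - B) + B" unfolding quad by (simp add: algebra_simps)
  finally have cub: "s * (1 - B) = s ^ 3 - B" by simp
  have "B \<noteq> 1"
  proof
    assume "B = 1"
    then have "xx n 0 ^ n = cst ((of_real (sqrt 2) ^ (24 div (3 * n))) ^ n)"
      using xx_nonzero[of n 0] by (simp add: B_def cst_power)
    then show False using xx_power_not_constant[OF \<open>n dvd 24\<close> n0, of 0] by simp
  qed
  then have "1 - B \<noteq> 0" by simp
  then have "s = (s ^ 3 - B) / (1 - B)" using cub by (simp only: nonzero_eq_divide_eq not_False_eq_True)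
  then have sL: "s \<in> KK n"
    using s3L BL by (metis subfld_divide[OF L] subfld_diff[OF L] subfld_1[OF L])
  have r0: "r \<noteq> 0" using a0 by (simp add: r_def)
  \<comment> \<open>As 9 does not divide 24, n is prime to 3; so r is a product of integral powers
    of r^3 and r^n.\<close>
  have "n mod 3 \<noteq> 0"
  proof
    assume "n mod 3 = 0"
    then obtain k where "n = 3 * k" by (auto simp: mod_eq_0_iff_dvd elim: dvdE)
    then have "9 dvd 3 * n" by simp
    then have "9 dvd (24::nat)" using n by (rule dvd_trans)
    then show False by simp
  qed
  then consider "n mod 3 = 1" | "n mod 3 = 2" by linarith
  then have "r \<in> KK n"
  proof cases
    case 1
    then have nn: "n = 3 * (n div 3) + 1" by presburger
    have "s = (r ^ 3) ^ (n div 3) * r" unfolding s_def by (subst nn) (simp add: power_add power_mult)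
    then have "r = s / (r ^ 3) ^ (n div 3)" using r0 by simp
    then show ?thesis using sL r3L by (metis subfld_divide[OF L] subfld_power[OF L])
  next
    case 2
    then have nn: "n + 1 = 3 * (n div 3 + 1)" by presburger
    have "s * r = r ^ (n + 1)" by (simp add: s_def)
    also have "\<dots> = (r ^ 3) ^ (n div 3 + 1)" by (subst nn) (simp only: power_mult)
    finally have "r = (r ^ 3) ^ (n div 3 + 1) / s" using r0 by (simp add: s_def field_simps)
    then show ?thesis using sL r3L by (metis subfld_divide[OF L] subfld_power[OF L])
  qed
  then show ?thesis by (simp add: r_def a_def)
qed

lemma KK_mono:
  assumes "m * n dvd 24" shows "KK n \<subseteq> KK (m * n)"
  unfolding KK_def[of n]
proof (rule gen_least[OF subfld_KK])
  have "xx n i \<in> KK (m * n)" if "i < 3" for i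
    using subfld_power[OF subfld_KK xx_KK[OF that]] xx_power[OF assms] by metis
  then show "range cst \<union> {xx n 0, xx n 1, xx n 2} \<subseteq> KK (m * n)"
    using cst_KK by auto
qed

text \<open>The third generator is recovered from the product relation.\<close>

lemma KK_least:
  assumes L: "subfld L" and c: "range cst \<subseteq> L" and x: "xx N 0 \<in> L" "xx N 1 \<in> L"
  shows "KK N \<subseteq> L"
proof -
  have "xx N 2 = cst (of_real (sqrt 2) ^ (24 div N)) / (xx N 0 * xx N 1)"
    using xx_mult[of N] xx_nonzero[of N] by (simp add: eq_divide_eq mult.commute)
  also have "\<dots> \<in> L" using c x by (intro subfld_divide[OF L] subfld_mult[OF L]) auto
  finally show ?thesis unfolding KK_def using c x by (intro gen_least L) auto
qed

text \<open>One cube root suffices: the ratio in \<open>KK n\<close> gives the second generator, the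
  product relation the third.\<close>

lemma KK_3:
  assumes "3 * n dvd 24" shows "KK (3 * n) = gen (insert (xx (3 * n) 0) (KK n))"
proof
  have "KK n \<subseteq> gen (insert (xx (3 * n) 0) (KK n))" by (auto intro: gen_incl)
  moreover have "xx (3 * n) 0 \<in> gen (insert (xx (3 * n) 0) (KK n))" by (auto intro: gen_incl)
  moreover from this have "xx (3 * n) 1 / xx (3 * n) 0 * xx (3 * n) 0 \<in> gen (insert (xx (3 * n) 0) (KK n))"
    using ratio_mem[OF assms] by (intro gen_mult) (auto intro: gen_incl)
  ultimately show "KK (3 * n) \<subseteq> gen (insert (xx (3 * n) 0) (KK n))"
    using xx_nonzero[of "3 * n" 0] cst_KK by (intro KK_least subfld_gen) auto
  show "gen (insert (xx (3 * n) 0) (KK n)) \<subseteq> KK (3 * n)"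
    using KK_mono[OF assms] xx_KK[of 0 "3 * n"] by (intro gen_least subfld_KK) auto
qed

text \<open>Two successive radical extensions; for m dividing 8 each of them has degree m.\<close>

lemma KK_two_step:
  assumes "m * n dvd 24"
  shows "KK (m * n) = gen (insert (xx (m * n) 1) (gen (insert (xx (m * n) 0) (KK n))))" (is "_ = ?R")
proof
  have 1: "gen (insert (xx (m * n) 0) (KK n)) \<subseteq> ?R" by (auto intro: gen_incl)
  have "insert (xx (m * n) 0) (KK n) \<subseteq> gen (insert (xx (m * n) 0) (KK n))" by (auto intro: gen_incl)
  with 1 have "insert (xx (m * n) 0) (KK n) \<subseteq> ?R" by blast
  moreover have "xx (m * n) 1 \<in> ?R" by (auto intro: gen_incl)
  ultimately show "KK (m * n) \<subseteq> ?R" using cst_KK[of _ n] by (intro KK_least subfld_gen) auto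
  have "gen (insert (xx (m * n) 0) (KK n)) \<subseteq> KK (m * n)"
    using KK_mono[OF assms] xx_KK[of 0 "m * n"] by (intro gen_least subfld_KK) auto
  then show "?R \<subseteq> KK (m * n)"
    using xx_KK[of 1 "m * n"] by (intro gen_least subfld_KK) auto
qed

lemma mact_fixes_KK:
  assumes "mults n (1, 1, 1) A" "a \<in> KK n"
  shows "mact A a = a"
proof -
  have "mact A (xx n i) = xx n i" if "i < 3" for i
    using mact_xx[OF assms(1) that] by (simp add: cst_simps)
  then show ?thesis
    using mact_cst[OF mults_det[OF assms(1)]]
    by (intro field_hom_gen_eq[OF field_hom_mact[OF mults_det[OF assms(1)]] field_hom_id _
          assms(2)[unfolded KK_def]]) auto
qed

section \<open>Explicit matrices that realise torus elements\<close>

definition upper_matrix :: "int \<Rightarrow> int ^ 2 ^ 2" where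
  "upper_matrix k = vector [vector [1, 2 * k], vector [0, 1]]"

definition lower_matrix :: "int \<Rightarrow> int ^ 2 ^ 2" where
  "lower_matrix k = vector [vector [1, 0], vector [- 2 * k, 1]]"

text \<open>Translation by 2 n j has multipliers of order dividing 24/n; their powers with exponent
  24/(m n) are m-th roots of unity.\<close>

lemma ee_weight_power:
  assumes "m * n dvd 24"
  shows "ee (of_int (w * (of_nat n * j)) / 24) ^ (24 div (m * n)) = ee (of_int (w * j) / of_nat m)"
proof -
  from assms obtain k where k: "24 = m * n * k" by (elim dvdE)
  have mn: "m > 0" "n > 0" "k > 0" using k by (auto intro: gr0I)
  have "(24 :: complex) = of_nat (m * n * k)" unfolding k[symmetric] by simp
  then have "of_nat k * (of_int (w * (of_nat n * j)) / 24) = (of_int (w * j) / of_nat m :: complex)"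
    using mn by (simp add: field_simps)
  moreover have "24 div (m * n) = k" unfolding k using mn by simp
  ultimately show ?thesis by (simp only: ee_power)
qed

lemma mults_upper:
  assumes "m * n dvd 24"
  shows "mults (m * n) (ee (- of_int j / of_nat m), ee (- of_int j / of_nat m), ee (of_int (2 * j) / of_nat m))
    (upper_matrix (of_nat n * j))" (is "mults _ ?g _")
  unfolding mults_def
proof (intro conjI allI impI)
  show "det (upper_matrix (of_nat n * j)) = 1" by (simp add: det_SL2 upper_matrix_def)
  fix i :: nat and \<tau> assume i: "i < 3" and \<tau>: "Im \<tau> > 0"
  have "moebius_act (upper_matrix (of_nat n * j)) \<tau> = \<tau> + 2 * of_int (of_nat n * j)"
    by (simp add: moebius_act_def upper_matrix_def)
  then have "uw i (moebius_act (upper_matrix (of_nat n * j)) \<tau>) ^ (24 div (m * n)) =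
      ee (of_int (shift_weight i * j) / of_nat m) * uw i \<tau> ^ (24 div (m * n))"
    using uw_shift[OF \<tau> i] ee_weight_power[OF assms] by (simp only: power_mult_distrib)
  moreover have "ee (of_int (shift_weight i * j) / of_nat m) = coord3 ?g i"
    using i by (auto simp: less_3_cases shift_weight_def)
  ultimately show "uw i (moebius_act (upper_matrix (of_nat n * j)) \<tau>) ^ (24 div (m * n)) =
      coord3 ?g i * uw i \<tau> ^ (24 div (m * n))" by simp
qed

lemma mults_lower:
  assumes "m * n dvd 24"
  shows "mults (m * n) (ee (- of_int j / of_nat m), ee (of_int (2 * j) / of_nat m), ee (- of_int j / of_nat m))
    (lower_matrix (of_nat n * j))" (is "mults _ ?g _")
  unfolding mults_def
proof (intro conjI allI impI)
  show "det (lower_matrix (of_nat n * j)) = 1" by (simp add: det_SL2 lower_matrix_def)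
  fix i :: nat and \<tau> assume i: "i < 3" and \<tau>: "Im \<tau> > 0"
  have "moebius_act (lower_matrix (of_nat n * j)) \<tau> = \<tau> / (- 2 * of_int (of_nat n * j) * \<tau> + 1)"
    by (simp add: moebius_act_def lower_matrix_def)
  then have "uw i (moebius_act (lower_matrix (of_nat n * j)) \<tau>) ^ (24 div (m * n)) =
      ee (of_int (shift_weight (inv_index i) * j) / of_nat m) * uw i \<tau> ^ (24 div (m * n))"
    using uw_lower_shift[OF \<tau> i] ee_weight_power[OF assms] by (simp only: power_mult_distrib)
  moreover have "ee (of_int (shift_weight (inv_index i) * j) / of_nat m) = coord3 ?g i"
    using i by (auto simp: less_3_cases shift_weight_def inv_index_def)
  ultimately show "uw i (moebius_act (lower_matrix (of_nat n * j)) \<tau>) ^ (24 div (m * n)) =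
      coord3 ?g i * uw i \<tau> ^ (24 div (m * n))" by simp
qed

text \<open>An upper and a lower matrix together reach all of \<open>nabla m\<close>: on the first
  two coordinates their weights (-1, -1) and (-1, 2) have determinant -3, a unit modulo every
  divisor of 8.\<close>

lemma nabla_mults:
  assumes "m * n dvd 24" "m dvd 8" "g \<in> nabla m"
  shows "\<exists>A. mults (m * n) g A"
proof -
  obtain i j where g: "g = (\<zeta> m powi i, \<zeta> m powi j, \<zeta> m powi (- i - j))"
    using assms(3) by (auto simp: nabla_def)
  \<comment> \<open>The first coordinate requires - a - b = i, and then the second requires 3 b = j
    - i modulo m. Since 3 is its own inverse modulo 8, b = 3 (j - i) is a solution.\<close>
  define b where "b = 3 * (j - i)"
  define a where "a = - i - b"
  let ?t = "(ee (- of_int a / of_nat m), ee (- of_int a / of_nat m), ee (of_int (2 * a) / of_nat m))"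
  let ?s = "(ee (- of_int b / of_nat m), ee (of_int (2 * b) / of_nat m), ee (- of_int b / of_nat m))"
  from assms(2) obtain k where k: "8 = m * k" by (elim dvdE)
  have m0: "m > 0" using div_24_mult(2)[OF assms(1)] .
  have ee8: "ee (of_int (8 * l) / of_nat m) = 1" for l
  proof -
    have "(8 :: int) = int m * int k" using arg_cong[OF k, of int] by simp
    then have "8 * l = int m * (int k * l)" by (simp only: mult.assoc)
    then have e: "of_int (8 * l) = (of_nat m * of_int (int k * l) :: complex)"
      by (metis of_int_mult of_int_of_nat_eq)
    have "of_int (8 * l) / of_nat m = (of_int (int k * l) :: complex)" unfolding e using m0 by simp
    then show ?thesis by (simp only: ee_of_int)
  qed
  have z: "\<zeta> m powi l = ee (of_int l / of_nat m)" for l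
    by (simp add: zeta_eq ee_powi)
  have "tmul ?t ?s = g"
  proof (rule coord3_eqI)
    have "ee (- of_int a / of_nat m) * ee (- of_int b / of_nat m) = ee (of_int i / of_nat m)"
      unfolding ee_add[symmetric] by (rule arg_cong[of _ _ ee]) (simp add: a_def add_divide_distrib)
    then show "coord3 (tmul ?t ?s) 0 = coord3 g 0" by (simp add: coord3_tmul g z)
    have "ee (- of_int a / of_nat m) * ee (of_int (2 * b) / of_nat m) = ee (of_int j / of_nat m) * ee (of_int (8 * (j - i)) / of_nat m)"
      unfolding ee_add[symmetric] by (rule arg_cong[of _ _ ee]) (simp add: a_def b_def flip: add_divide_distrib)
    then show "coord3 (tmul ?t ?s) 1 = coord3 g 1" unfolding ee8 by (simp add: coord3_tmul g z)
    have "ee (of_int (2 * a) / of_nat m) * ee (- of_int b / of_nat m) = ee (of_int (- i - j) / of_nat m) * ee (of_int (8 * (i - j)) / of_nat m)"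
      unfolding ee_add[symmetric] by (rule arg_cong[of _ _ ee]) (simp add: a_def b_def flip: add_divide_distrib)
    then show "coord3 (tmul ?t ?s) 2 = coord3 g 2" unfolding ee8 by (simp add: coord3_tmul g z)
  qed
  with mults_mult[OF mults_upper[OF assms(1), of a] mults_lower[OF assms(1), of b]] show ?thesis by auto
qed

text \<open>The weights -1, -1, 2 of a translation are equal modulo 3, so a translation alone
  realises each diagonal element.\<close>

lemma diagonal_mults:
  assumes "3 * n dvd 24" "g \<in> diagonal 3"
  shows "\<exists>A. mults (3 * n) g A"
proof -
  obtain i where g: "g = (\<zeta> 3 powi i, \<zeta> 3 powi i, \<zeta> 3 powi i)"
    using assms(2) by (auto simp: diagonal_def)
  have "ee (of_int (2 * - i) / of_nat 3) = ee (of_int i / of_nat 3) * ee (of_int (- i))"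
    unfolding ee_add[symmetric] by (rule arg_cong[of _ _ ee]) (simp add: field_simps)
  then have "ee (of_int (2 * - i) / of_nat 3) = ee (of_int i / of_nat 3)" by (simp only: ee_of_int) simp
  then have "g = (ee (- of_int (- i) / of_nat 3), ee (- of_int (- i) / of_nat 3), ee (of_int (2 * - i) / of_nat 3))"
    by (simp add: g zeta_eq ee_powi)
  with mults_upper[OF assms(1), of "- i"] show ?thesis by auto
qed

section \<open>Kummer steps of the cover and its fixed field\<close>

lemma zeta_power: "\<zeta> m ^ m = 1" if "m > 0"
  using that ee_of_int[of 1] by (simp add: zeta_eq ee_power)

lemma zeta_power_neq_1:
  assumes "0 < i" "i < m" shows "\<zeta> m ^ i \<noteq> 1"
proof
  assume "\<zeta> m ^ i = 1"
  then have "ee (of_nat i / of_nat m) = 1" by (simp add: zeta_eq ee_power)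
  then obtain k :: int where "of_nat i / of_nat m = (of_int k :: complex)" by (rule ee_eq_1D)
  then have "(of_nat i :: complex) = of_int (k * of_nat m)" using assms by (simp add: divide_eq_eq)
  then have "int i = k * int m" by (metis of_int_of_nat_eq of_int_eq_iff)
  then have "int m dvd int i" by simp
  then show False using assms by (simp add: nat_dvd_not_less)
qed

lemma mults_trivial:
  assumes "mults (m * n) g A" "m * n dvd 24" "\<And>i. i < 3 \<Longrightarrow> coord3 g i ^ m = 1"
  shows "mults n (1, 1, 1) A"
  using assms by (intro mults_power[OF assms(1,2)]) auto

lemma kummer_KK:
  assumes mn: "m * n dvd 24" and A: "mults (m * n) g A" and g: "\<And>i. i < 3 \<Longrightarrow> coord3 g i ^ m = 1"
    and i: "i < 3" "coord3 g i = \<zeta> m"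
    and L: "subfld L" "KK n \<subseteq> L" "\<And>a. a \<in> L \<Longrightarrow> mact A a = a"
  shows "kummer L (xx (m * n) i) (cst (\<zeta> m)) m (mact A)"
proof
  have m0: "m > 0" using div_24_mult(2)[OF mn] .
  show "subfld L" by fact
  show "m > 0" by fact
  have "of_nat m \<noteq> (0 :: complex)" using m0 by simp
  then show "of_nat m \<noteq> (0 :: mero)" unfolding cst_of_nat[symmetric] cst_simps .
  show "xx (m * n) i \<noteq> 0" by (rule xx_nonzero)
  show "xx (m * n) i ^ m \<in> L" unfolding xx_power[OF mn] using L(2) xx_KK[OF i(1)] by blast
  show "cst (\<zeta> m) \<in> L" using L(2) cst_KK by blast
  show "cst (\<zeta> m) ^ m = 1" by (simp add: cst_power[symmetric] zeta_power[OF m0] cst_simps)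
  show "cst (\<zeta> m) ^ k \<noteq> 1" if "0 < k" "k < m" for k
    unfolding cst_power[symmetric] cst_simps(2)[symmetric] cst_simps(6) by (rule zeta_power_neq_1[OF that])
  show "field_hom (mact A)" by (rule field_hom_mact[OF mults_det[OF A]])
  show "mact A a = a" if "a \<in> L" for a using L(3)[OF that] .
  show "mact A (xx (m * n) i) = cst (\<zeta> m) * xx (m * n) i" using mact_xx[OF A i(1)] i(2) by simp
qed

lemma kummer_3:
  assumes "3 * n dvd 24"
  obtains A where "mults n (1, 1, 1) A" "kummer (KK n) (xx (3 * n) 0) (cst (\<zeta> 3)) 3 (mact A)"
proof -
  have "(\<zeta> 3, \<zeta> 3, \<zeta> 3) \<in> diagonal 3"
    unfolding diagonal_def by (auto intro!: exI[of _ 1])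
  then obtain A where A: "mults (3 * n) (\<zeta> 3, \<zeta> 3, \<zeta> 3) A" using diagonal_mults[OF assms] by blast
  have g: "coord3 (\<zeta> 3, \<zeta> 3, \<zeta> 3) i ^ 3 = 1" for i using zeta_power[of 3] by simp
  have t: "mults n (1, 1, 1) A" by (rule mults_trivial[OF A assms g])
  have "kummer (KK n) (xx (3 * n) 0) (cst (\<zeta> 3)) 3 (mact A)"
    by (rule kummer_KK[OF assms A g _ _ subfld_KK _ mact_fixes_KK[OF t]]) auto
  with t show ?thesis using that by blast
qed

text \<open>The chosen elements of \<open>nabla m\<close> move x_0 and x_1 separately. The second
  one fixes x_0, hence the whole field over which x_1 is adjoined.\<close>

lemma kummer_8:
  assumes mn: "m * n dvd 24" and m: "m dvd 8"
  obtains A B where "mults n (1, 1, 1) A" "kummer (KK n) (xx (m * n) 0) (cst (\<zeta> m)) m (mact A)"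
    "mults n (1, 1, 1) B"
    "kummer (gen (insert (xx (m * n) 0) (KK n))) (xx (m * n) 1) (cst (\<zeta> m)) m (mact B)"
proof -
  have m0: "m > 0" using div_24_mult(2)[OF mn] .
  have "(\<zeta> m, 1, inverse (\<zeta> m)) \<in> nabla m" "(1, \<zeta> m, inverse (\<zeta> m)) \<in> nabla m"
    unfolding nabla_def
    by (rule CollectI, rule exI[of _ 1], rule exI[of _ 0], simp add: power_int_minus)
      (rule CollectI, rule exI[of _ 0], rule exI[of _ 1], simp add: power_int_minus)
  then obtain A B where A: "mults (m * n) (\<zeta> m, 1, inverse (\<zeta> m)) A" and B: "mults (m * n) (1, \<zeta> m, inverse (\<zeta> m)) B"
    using nabla_mults[OF mn m] by blast
  have g: "coord3 (\<zeta> m, 1, inverse (\<zeta> m)) i ^ m = 1" "coord3 (1, \<zeta> m, inverse (\<zeta> m)) i ^ m = 1" for i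
    using zeta_power[OF m0] by (simp_all add: power_inverse)
  have tA: "mults n (1, 1, 1) A" by (rule mults_trivial[OF A mn g(1)])
  have tB: "mults n (1, 1, 1) B" by (rule mults_trivial[OF B mn g(2)])
  have kA: "kummer (KK n) (xx (m * n) 0) (cst (\<zeta> m)) m (mact A)"
    by (rule kummer_KK[OF mn A g(1) _ _ subfld_KK _ mact_fixes_KK[OF tA]]) auto
  have fixB: "mact B a = a" if "a \<in> gen (insert (xx (m * n) 0) (KK n))" for a
    using field_hom_gen_eq[OF field_hom_mact[OF mults_det[OF B]] field_hom_id _ that]
      mact_xx[OF B, of 0] mact_fixes_KK[OF tB] by (auto simp: cst_simps)
  have kB: "kummer (gen (insert (xx (m * n) 0) (KK n))) (xx (m * n) 1) (cst (\<zeta> m)) m (mact B)"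
    by (rule kummer_KK[OF mn B g(2) _ _ subfld_gen _ fixB]) (auto intro: gen_incl)
  show ?thesis using that tA kA tB kB by blast
qed

lemma dvd_24_cases:
  assumes "(m::nat) dvd 24" shows "m dvd 8 \<or> (\<exists>k. m = 3 * k \<and> k dvd 8)"
proof (cases "3 dvd m")
  case True
  then obtain k where k: "m = 3 * k" by (elim dvdE)
  with assms have "3 * k dvd 3 * 8" by simp
  then have "k dvd 8" by (subst (asm) nat_mult_dvd_cancel1) auto
  with k show ?thesis by blast
next
  case False
  moreover have "prime (3::nat)" by simp
  ultimately have "coprime m 3" using prime_imp_coprime coprime_commute by blast
  moreover have "m dvd 3 * 8" using assms by simp
  ultimately show ?thesis using coprime_dvd_mult_right_iff by blast
qed

text \<open>An invariant descends through the Kummer steps: one for a factor 3 of m, two for the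
  part of m that divides 8.\<close>

lemma fixed_field:
  assumes "m * n dvd 24" "a \<in> KK (m * n)" "\<And>A. mults n (1, 1, 1) A \<Longrightarrow> mact A a = a"
  shows "a \<in> KK n"
proof -
  have step8: "a \<in> KK n" if mn: "m * n dvd 24" and m: "m dvd 8" and a: "a \<in> KK (m * n)" for m
  proof -
    obtain A B where AB: "mults n (1, 1, 1) A" "kummer (KK n) (xx (m * n) 0) (cst (\<zeta> m)) m (mact A)"
      "mults n (1, 1, 1) B"
      "kummer (gen (insert (xx (m * n) 0) (KK n))) (xx (m * n) 1) (cst (\<zeta> m)) m (mact B)"
      using kummer_8[OF mn m] by metis
    have "a \<in> gen (insert (xx (m * n) 0) (KK n))"
      using kummer.gen_fixed[OF AB(4)] a assms(3)[OF AB(3)] unfolding KK_two_step[OF mn] by blast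
    then show ?thesis using kummer.gen_fixed[OF AB(2)] assms(3)[OF AB(1)] by blast
  qed
  have "m dvd 24" using assms(1) by (metis dvd_mult_left)
  then consider "m dvd 8" | k where "m = 3 * k" "k dvd 8" using dvd_24_cases by blast
  then show ?thesis
  proof cases
    case 1
    then show ?thesis using step8 assms by blast
  next
    case 2
    have 3: "3 * (k * n) dvd 24" using assms(1) 2(1) by (simp add: mult.assoc)
    have kn: "k * n dvd 24" using 3 by (metis dvd_mult_right)
    obtain A where A: "mults (k * n) (1, 1, 1) A"
      "kummer (KK (k * n)) (xx (3 * (k * n)) 0) (cst (\<zeta> 3)) 3 (mact A)"
      using kummer_3[OF 3] by metis
    \<comment> \<open>The matrix of the top step belongs to the group of level k n, which is
      contained in that of level n.\<close>
    have "mults n (1, 1, 1) A" by (rule mults_trivial[OF A(1) kn]) simp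
    then have "a \<in> KK (k * n)"
      using kummer.gen_fixed[OF A(2)] assms(2,3) 2(1) KK_3[OF 3] by (simp add: mult.assoc)
    then show ?thesis by (rule step8[OF kn 2(2)])
  qed
qed

subsection \<open>Monodromy\<close>

lemma carrier_mu:
  assumes "m > 0" shows "carrier (mu m) = {z. z ^ m = 1}"
proof (intro equalityI subsetI)
  fix z assume "z \<in> carrier (mu m)"
  then obtain i :: int where z: "z = \<zeta> m powi i" by (auto simp: mu_def)
  have "z ^ m = (\<zeta> m ^ m) powi i" unfolding z by (metis power_int_mult power_int_of_nat mult.commute)
  then show "z \<in> {z. z ^ m = 1}" by (simp add: zeta_power[OF assms])
next
  fix z :: complex assume "z \<in> {z. z ^ m = 1}"
  then obtain j where "z = exp (2 * of_real pi * \<i> * of_nat j / of_nat m)"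
    using complex_roots_unity[of m] assms by auto
  then have "z = \<zeta> m powi (int j)" by (simp add: \<zeta>_def exp_of_nat_mult[symmetric] mult_ac)
  then show "z \<in> carrier (mu m)" by (simp only: mu_def partial_object.select_convs rangeI)
qed

lemma group_mu: "m > 0 \<Longrightarrow> group (mu m)"
proof (rule groupI)
  assume m: "m > 0"
  note c = carrier_mu[OF m]
  show "\<exists>y\<in>carrier (mu m). y \<otimes>\<^bsub>mu m\<^esub> x = \<one>\<^bsub>mu m\<^esub>" if "x \<in> carrier (mu m)" for x
  proof (rule bexI[of _ "inverse x"])
    have "x \<noteq> 0" using that m by (auto simp: c zero_power)
    then show "inverse x \<otimes>\<^bsub>mu m\<^esub> x = \<one>\<^bsub>mu m\<^esub>" by (simp add: mu_def)
    show "inverse x \<in> carrier (mu m)" using that by (simp add: c power_inverse)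
  qed
  show "\<one>\<^bsub>mu m\<^esub> \<in> carrier (mu m)" unfolding c by (simp add: mu_def)
  show "x \<otimes>\<^bsub>mu m\<^esub> y \<in> carrier (mu m)" if "x \<in> carrier (mu m)" "y \<in> carrier (mu m)" for x y
    using that unfolding c by (simp add: mu_def power_mult_distrib)
qed (simp_all add: mu_def)

lemma group_mu3: "m > 0 \<Longrightarrow> group (mu3 m)"
  unfolding mu3_def by (intro DirProd_group group_mu)

lemma all_less_3: "(\<forall>i<(3::nat). P i) \<longleftrightarrow> P 0 \<and> P 1 \<and> P 2"
  by (auto simp: less_3_cases)

lemma carrier_mu3:
  assumes "m > 0" shows "carrier (mu3 m) = {g. \<forall>i<3. coord3 g i ^ m = 1}"
proof (rule Set.set_eqI)
  fix g
  show "g \<in> carrier (mu3 m) \<longleftrightarrow> g \<in> {g. \<forall>i<3. coord3 g i ^ m = 1}"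
    by (cases g) (simp add: mu3_def carrier_mu[OF assms] all_less_3)
qed

lemma mult_mu3: "g \<otimes>\<^bsub>mu3 m\<^esub> h = tmul g h"
  by (cases g; cases h) (simp add: mu3_def mu_def tmul_def)

lemma one_mu3: "\<one>\<^bsub>mu3 m\<^esub> = (1, 1, 1)"
  by (simp add: mu3_def mu_def)

lemma tmul_tinv: "(\<And>i. i < 3 \<Longrightarrow> coord3 g i \<noteq> 0) \<Longrightarrow> tmul (tinv g) g = (1, 1, 1)"
   "(\<And>i. i < 3 \<Longrightarrow> coord3 g i \<noteq> 0) \<Longrightarrow> tmul g (tinv g) = (1, 1, 1)"
  by (rule coord3_eqI; simp add: coord3_tmul coord3_tinv del: coord3.simps; simp)+

lemma inv_mu3:
  assumes "m > 0" "g \<in> carrier (mu3 m)" shows "inv\<^bsub>mu3 m\<^esub> g = tinv g"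
proof (rule group.inv_equality[OF group_mu3[OF assms(1)] _ assms(2)])
  have g: "coord3 g i ^ m = 1" if "i < 3" for i using assms(2) that by (simp add: carrier_mu3[OF assms(1)])
  have "coord3 g i \<noteq> 0" if "i < 3" for i using g[OF that] assms(1) by (auto simp: zero_power)
  then show "tinv g \<otimes>\<^bsub>mu3 m\<^esub> g = \<one>\<^bsub>mu3 m\<^esub>" by (simp add: mult_mu3 one_mu3 tmul_tinv)
  show "tinv g \<in> carrier (mu3 m)"
    using g by (simp add: carrier_mu3[OF assms(1)] coord3_tinv power_inverse del: coord3.simps)
qed

lemma nabla_iff:
  assumes "m > 0"
  shows "g \<in> nabla m \<longleftrightarrow> g \<in> carrier (mu3 m) \<and> coord3 g 0 * coord3 g 1 * coord3 g 2 = 1"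
proof
  assume "g \<in> nabla m"
  then obtain i j where g: "g = (\<zeta> m powi i, \<zeta> m powi j, \<zeta> m powi (- i - j))"
    by (auto simp: nabla_def)
  have "\<zeta> m powi i \<in> carrier (mu m)" for i by (simp add: mu_def)
  then have "g \<in> carrier (mu3 m)" by (simp add: g mu3_def)
  moreover have "\<zeta> m powi i * \<zeta> m powi j * \<zeta> m powi (- i - j) = \<zeta> m powi (i + j + (- i - j))"
    by (simp only: power_int_add zeta_nonzero simp_thms)
  then have "coord3 g 0 * coord3 g 1 * coord3 g 2 = 1" by (simp add: g)
  ultimately show "g \<in> carrier (mu3 m) \<and> coord3 g 0 * coord3 g 1 * coord3 g 2 = 1" by blast
next
  assume *: "g \<in> carrier (mu3 m) \<and> coord3 g 0 * coord3 g 1 * coord3 g 2 = 1"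
  obtain a b c where g: "g = (a, b, c)" by (cases g)
  from * obtain i j :: int where ij: "a = \<zeta> m powi i" "b = \<zeta> m powi j"
    by (auto simp: g mu3_def mu_def)
  have "a * b * c = 1" using * by (simp add: g)
  then have "c = inverse (\<zeta> m powi (i + j))"
    using inverse_unique[of "a * b" c] by (simp add: ij power_int_add)
  also have "\<dots> = \<zeta> m powi (- i - j)"
    unfolding power_int_minus[symmetric] by simp
  finally show "g \<in> nabla m" unfolding nabla_def g ij by blast
qed

lemma diagonal_iff:
  assumes "m > 0"
  shows "g \<in> diagonal m \<longleftrightarrow> g \<in> carrier (mu3 m) \<and> coord3 g 1 = coord3 g 0 \<and> coord3 g 2 = coord3 g 0"
proof -
  obtain a b c where g: "g = (a, b, c)" by (cases g)
  show ?thesis by (auto simp: g diagonal_def mu3_def mu_def)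
qed

text \<open>The image of the monodromy homomorphism on \<open>\<Gamma>\<^sub>n\<close>.\<close>

definition monodromy :: "nat \<Rightarrow> nat \<Rightarrow> (complex \<times> complex \<times> complex) set" where
  "monodromy m n = {g \<in> carrier (mu3 m). \<exists>A. mults (m * n) g A}"

lemma subgroup_monodromy:
  assumes "m > 0" shows "subgroup (monodromy m n) (mu3 m)"
proof (rule group.subgroupI[OF group_mu3[OF assms]])
  interpret group "mu3 m" by (rule group_mu3[OF assms])
  show "monodromy m n \<subseteq> carrier (mu3 m)" by (auto simp: monodromy_def)
  have "(1, 1, 1) \<in> monodromy m n"
    using one_closed mults_one[of "m * n"] by (auto simp: monodromy_def one_mu3)
  then show "monodromy m n \<noteq> {}" by blast
  show "inv\<^bsub>mu3 m\<^esub> g \<in> monodromy m n" if "g \<in> monodromy m n" for g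
  proof -
    obtain A where g: "g \<in> carrier (mu3 m)" and A: "mults (m * n) g A" using \<open>g \<in> monodromy m n\<close> by (auto simp: monodromy_def)
    obtain B where "det B = 1" "A ** B = mat 1" using SL2_inverse[OF mults_det[OF A]] by metis
    then have "mults (m * n) (inv\<^bsub>mu3 m\<^esub> g) B" using mults_inverse[OF A] by (simp add: inv_mu3[OF assms g])
    then show ?thesis using inv_closed[OF g] by (auto simp: monodromy_def)
  qed
  show "g \<otimes>\<^bsub>mu3 m\<^esub> h \<in> monodromy m n" if "g \<in> monodromy m n" "h \<in> monodromy m n" for g h
    using that m_closed[of g h] mults_mult[of "m * n" g _ h] unfolding monodromy_def mult_mu3 by blast
qed

text \<open>The product of the three functions is constant, hence invariant under every
  matrix.\<close>

lemma monodromy_product: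
  assumes "mults N g A" shows "coord3 g 0 * coord3 g 1 * coord3 g 2 = 1"
proof -
  let ?e = "24 div N" and ?t = "moebius_act A \<i>"
  have i: "Im \<i> > 0" by simp
  have t: "Im ?t > 0" by (rule Im_moebius_act[OF mults_det[OF assms] i])
  have "(of_real (sqrt 2) :: complex) ^ ?e = (uw 0 ?t * uw 1 ?t * uw 2 ?t) ^ ?e" by (simp only: uw_mult[OF t])
  also have "\<dots> = coord3 g 0 * coord3 g 1 * coord3 g 2 * (uw 0 \<i> * uw 1 \<i> * uw 2 \<i>) ^ ?e"
    using multsD[OF assms, of 0 \<i>] multsD[OF assms, of 1 \<i>] multsD[OF assms, of 2 \<i>]
    by (simp add: power_mult_distrib del: coord3.simps)
  also have "(uw 0 \<i> * uw 1 \<i> * uw 2 \<i>) ^ ?e = of_real (sqrt 2) ^ ?e" by (simp only: uw_mult[OF i])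
  finally show ?thesis by simp
qed

text \<open>Up to a factor, Jacobi's relation is the only linear relation between the three n-th
  powers. Another one would make two of them proportional, and the constant product would then make
  a power of a generator constant.\<close>

lemma xx_linear_relation:
  assumes n: "3 * n dvd 24"
    and rel: "cst a * xx (3 * n) 0 ^ n + cst b * xx (3 * n) 1 ^ n + cst c * xx (3 * n) 2 ^ n = 0"
  shows "a = b" "b = c"
proof -
  have n0: "n > 0" using div_24_mult(3)[OF n] .
  define X Y Z where "X = xx (3 * n) 0 ^ n" "Y = xx (3 * n) 1 ^ n" "Z = xx (3 * n) 2 ^ n"
  have nz: "X \<noteq> 0" "Y \<noteq> 0" "Z \<noteq> 0" by (simp_all add: X_Y_Z_def xx_nonzero)
  have Z: "Z = - X - Y" using xx_sum[OF n] by (simp add: X_Y_Z_def eq_neg_iff_add_eq_0 algebra_simps)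
  have XYZ: "X * Y * Z = cst ((of_real (sqrt 2) ^ (24 div (3 * n))) ^ n)"
    using xx_mult[of "3 * n"] by (simp add: X_Y_Z_def power_mult_distrib[symmetric] cst_power)
  have "cst a * X + cst b * Y + cst c * Z = 0" using rel by (simp add: X_Y_Z_def)
  then have "(cst a + cst (- c)) * X + (cst b + cst (- c)) * Y = 0"
    unfolding Z by (simp add: cst_simps algebra_simps)
  then have XY: "cst (a - c) * X + cst (b - c) * Y = 0" by (simp add: cst_simps(3)[symmetric])
  have "a = c"
  proof (rule ccontr)
    assume "a \<noteq> c"
    define k where "k = - (b - c) / (a - c)"
    have "cst (- (b - c)) * Y = - (cst (b - c) * Y)" by (simp only: cst_simps(4) mult_minus_left)
    then have "cst (a - c) * X = cst (- (b - c)) * Y" using XY by (metis eq_neg_iff_add_eq_0)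
    then have "cst (inverse (a - c)) * (cst (a - c) * X) = cst (inverse (a - c)) * (cst (- (b - c)) * Y)" by simp
    then have X: "X = cst k * Y"
      using \<open>a \<noteq> c\<close> by (simp only: mult.assoc[symmetric] cst_simps(5)[symmetric]) (simp add: k_def cst_simps divide_inverse mult.commute)
    \<comment> \<open>With X = k Y and Z = - X - Y, the product X Y Z is K times Y^3.\<close>
    define K where "K = k * - (k + 1)"
    define C where "C = (complex_of_real (sqrt 2) ^ (24 div (3 * n))) ^ n"
    have "C \<noteq> 0" by (simp add: C_def)
    have e: "cst K = cst k * - (cst k + 1)" by (simp only: K_def cst_simps)
    have "X * Y * Z = cst K * Y ^ 3" unfolding Z X e by (simp add: power3_eq_cube algebra_simps)
    with XYZ have eq: "cst K * Y ^ 3 = cst C" by (simp add: C_def)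
    with \<open>C \<noteq> 0\<close> have "K \<noteq> 0" by (auto simp: cst_simps)
    then have "Y ^ 3 = cst (inverse K) * (cst K * Y ^ 3)"
      by (simp only: mult.assoc[symmetric] cst_simps(5)[symmetric]) (simp add: cst_simps)
    also have "\<dots> = cst (inverse K * C)" unfolding eq by (simp only: cst_simps(5))
    finally have "xx (3 * n) 1 ^ (n * 3) = cst (inverse K * C)" by (simp add: X_Y_Z_def power_mult)
    moreover have "n * 3 > 0" "1 < (3::nat)" using n0 by simp_all
    ultimately show False using xx_power_not_constant[OF n] by blast
  qed
  moreover from this have "b = c" using XY nz by (simp add: cst_simps)
  ultimately show "a = b" "b = c" by simp_all
qed

text \<open>Since 9 does not divide 24, n is prime to 3, and the n-th power is injective on cube
  roots of unity.\<close>

lemma equal_cube_roots: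
  assumes n: "3 * n dvd 24" and "x ^ 3 = 1" "y ^ 3 = (1 :: complex)" "x ^ n = y ^ n"
  shows "x = y"
proof -
  have "n mod 3 \<noteq> 0"
  proof
    assume "n mod 3 = 0"
    then have "9 dvd 3 * n" by auto
    then have "9 dvd (24::nat)" using n by (rule dvd_trans)
    then show False by simp
  qed
  have red: "z ^ n = z ^ (n mod 3)" if "z ^ 3 = 1" for z :: complex
  proof -
    have "z ^ n = z ^ (3 * (n div 3) + n mod 3)" by simp
    also have "\<dots> = z ^ (n mod 3)" unfolding power_add power_mult that by simp
    finally show ?thesis .
  qed
  have eq: "x ^ (n mod 3) = y ^ (n mod 3)" using assms red by metis
  from \<open>n mod 3 \<noteq> 0\<close> consider "n mod 3 = 1" | "n mod 3 = 2" by linarith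
  then show ?thesis
  proof cases
    case 1
    then show ?thesis using eq by simp
  next
    case 2
    then have "x ^ 2 = y ^ 2" using eq by simp
    then have "x ^ 3 * x = y ^ 3 * y" by (simp add: power3_eq_cube power2_eq_square)
    then show ?thesis using assms by simp
  qed
qed

lemma monodromy_nabla:
  assumes "m * n dvd 24" "m dvd 8" shows "monodromy m n = nabla m"
  using nabla_mults[OF assms] monodromy_product nabla_iff[OF div_24_mult(2)[OF assms(1)]]
  unfolding monodromy_def by blast

text \<open>Uniqueness of the linear relation makes the n-th powers of the coordinates of
  \<open>g\<close> agree, and these determine cube roots of unity.\<close>

lemma diagonalI:
  assumes n: "3 * n dvd 24" and g: "g \<in> carrier (mu3 3)"
    and rel: "cst (coord3 g 0 ^ n) * xx (3 * n) 0 ^ n + cst (coord3 g 1 ^ n) * xx (3 * n) 1 ^ n +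
      cst (coord3 g 2 ^ n) * xx (3 * n) 2 ^ n = 0"
  shows "g \<in> diagonal 3"
proof -
  have "coord3 g i ^ 3 = 1" if "i < 3" for i using g that by (simp add: carrier_mu3)
  then show ?thesis
    using g xx_linear_relation[OF n rel] equal_cube_roots[OF n]
    by (simp add: diagonal_iff del: coord3.simps)
qed

text \<open>Applying a matrix to Jacobi's relation produces another linear relation between the n-th
  powers, to which uniqueness applies.\<close>

lemma monodromy_diagonal:
  assumes "3 * n dvd 24" shows "monodromy 3 n = diagonal 3"
proof (intro equalityI subsetI)
  fix g assume "g \<in> diagonal 3"
  then show "g \<in> monodromy 3 n"
    using diagonal_mults[OF assms] by (auto simp: monodromy_def diagonal_iff)
next
  fix g assume "g \<in> monodromy 3 n"
  then obtain A where g: "g \<in> carrier (mu3 3)" and A: "mults (3 * n) g A" by (auto simp: monodromy_def)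
  have "mact A (xx (3 * n) 0 ^ n + xx (3 * n) 1 ^ n + xx (3 * n) 2 ^ n) = 0"
    unfolding xx_sum[OF assms] by (rule field_hom_0[OF field_hom_mact[OF mults_det[OF A]]])
  then have "cst (coord3 g 0 ^ n) * xx (3 * n) 0 ^ n + cst (coord3 g 1 ^ n) * xx (3 * n) 1 ^ n +
      cst (coord3 g 2 ^ n) * xx (3 * n) 2 ^ n = 0"
    using mact_xx[OF A, of 0] mact_xx[OF A, of 1] mact_xx[OF A, of 2]
    by (simp add: field_hom_add[OF field_hom_mact[OF mults_det[OF A]]] field_hom_power[OF field_hom_mact[OF mults_det[OF A]]]
        power_mult_distrib cst_power del: coord3.simps)
  then show "g \<in> diagonal 3" by (rule diagonalI[OF assms g])
qed

section \<open>The modular group and its quotient by \<Gamma> of the higher level\<close>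

definition pm :: "int ^ 2 ^ 2 \<Rightarrow> (int ^ 2 ^ 2) set" where "pm A = {A, - A}"

lemma det_uminus_2: "det (- A) = det (A :: int ^ 2 ^ 2)"
  by (simp add: det_SL2)

lemma matrix_mult_uminus: "(- A) ** B = - (A ** B)" "A ** (- B) = - (A ** B)" for A B :: "int ^ 2 ^ 2"
  by (simp_all add: vec_eq_iff matrix_matrix_mult_def sum_negf)

lemma group_SL2Z: "group SL2Z"
proof (rule groupI)
  show "\<exists>B\<in>carrier SL2Z. B \<otimes>\<^bsub>SL2Z\<^esub> A = \<one>\<^bsub>SL2Z\<^esub>" if A: "A \<in> carrier SL2Z" for A
  proof -
    from A have "det A = 1" by (simp add: SL2Z_def)
    then obtain B where "det B = 1" "B ** A = mat 1" by (rule SL2_inverse)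
    then show ?thesis by (auto simp: SL2Z_def)
  qed
qed (simp_all add: SL2Z_def det_mul matrix_mul_assoc)

lemma normal_center: "{mat 1, - mat 1} \<lhd> SL2Z"
proof (rule group.normal_invI[OF group_SL2Z])
  have 1: "{mat 1, - mat 1} \<subseteq> carrier SL2Z" by (simp add: SL2Z_def det_uminus_2)
  have inv: "inv\<^bsub>SL2Z\<^esub> A = A" if "A \<in> {mat 1, - mat 1}" for A
    by (rule group.inv_equality[OF group_SL2Z]) (use that 1 in \<open>auto simp: SL2Z_def matrix_mult_uminus\<close>)
  show "subgroup {mat 1, - mat 1} SL2Z"
  proof (rule group.subgroupI[OF group_SL2Z 1])
    show "inv\<^bsub>SL2Z\<^esub> A \<in> {mat 1, - mat 1}" if "A \<in> {mat 1, - mat 1}" for A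
      using inv[OF that] that by simp
    show "A \<otimes>\<^bsub>SL2Z\<^esub> B \<in> {mat 1, - mat 1}" if "A \<in> {mat 1, - mat 1}" "B \<in> {mat 1, - mat 1}" for A B
      using that by (auto simp: SL2Z_def matrix_mult_uminus)
  qed simp
  fix A H :: "int ^ 2 ^ 2" assume A: "A \<in> carrier SL2Z" and H: "H \<in> {mat 1, - mat 1}"
  have r: "A ** inv\<^bsub>SL2Z\<^esub> A = mat 1" using group.r_inv[OF group_SL2Z A] by (simp add: SL2Z_def)
  show "A \<otimes>\<^bsub>SL2Z\<^esub> H \<otimes>\<^bsub>SL2Z\<^esub> inv\<^bsub>SL2Z\<^esub> A \<in> {mat 1, - mat 1}"
    using H r by (auto simp: SL2Z_def matrix_mult_uminus)
qed

lemma group_PSL2Z: "group PSL2Z"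
  unfolding PSL2Z_def by (rule normal.factorgroup_is_group[OF normal_center])

lemma carrier_PSL2Z: "carrier PSL2Z = pm ` {A. det A = 1}"
  unfolding PSL2Z_def FactGroup_def RCOSETS_def r_coset_def pm_def
  by (auto simp: SL2Z_def matrix_mult_uminus insert_commute)

lemma mult_PSL2Z: "pm A \<otimes>\<^bsub>PSL2Z\<^esub> pm B = pm (A ** B)"
  unfolding PSL2Z_def FactGroup_def set_mult_def pm_def
  by (auto simp: SL2Z_def matrix_mult_uminus)

lemma one_PSL2Z: "\<one>\<^bsub>PSL2Z\<^esub> = pm (mat 1)"
  by (simp add: PSL2Z_def FactGroup_def pm_def)

lemma Gamma_weber_eq: "Gamma_weber n = pm ` {A. mults n (1, 1, 1) A}"
proof -
  define P where "P A \<longleftrightarrow> (\<forall>\<tau>\<in>upper_half_plane. \<forall>u\<in>{u0, u1, u2}.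
    u (moebius_act A \<tau>) ^ (24 div n) = u \<tau> ^ (24 div n))" for A
  have P: "P A \<longleftrightarrow> mults n (1, 1, 1) A" if "det A = 1" for A
    using that by (auto simp: P_def mults_def less_3_cases uw_def)
  have all: "(\<forall>B\<in>pm A. P B) \<longleftrightarrow> mults n (1, 1, 1) A" if "det A = 1" for A
    using P[of A] P[of "- A"] that by (simp add: pm_def det_uminus_2 mults_uminus)
  have G: "Gamma_weber n = {c \<in> carrier PSL2Z. \<forall>A\<in>c. P A}"
    by (simp add: Gamma_weber_def P_def)
  show ?thesis
  proof (intro equalityI subsetI)
    fix c assume "c \<in> Gamma_weber n"
    then obtain A where "c = pm A" "det A = 1" "\<forall>B\<in>pm A. P B" by (auto simp: G carrier_PSL2Z)
    then show "c \<in> pm ` {A. mults n (1, 1, 1) A}" using all by simp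
  next
    fix c assume "c \<in> pm ` {A. mults n (1, 1, 1) A}"
    then obtain A where "c = pm A" "mults n (1, 1, 1) A" by auto
    then show "c \<in> Gamma_weber n" using all[of A] mults_det by (simp add: G carrier_PSL2Z)
  qed
qed

lemma pm_in_Gamma_weber: "pm A \<in> Gamma_weber n \<longleftrightarrow> mults n (1, 1, 1) A"
proof
  assume "pm A \<in> Gamma_weber n"
  then obtain B where B: "pm A = pm B" "mults n (1, 1, 1) B" unfolding Gamma_weber_eq by blast
  from B(1) have "A = B \<or> A = - B" by (auto simp: pm_def doubleton_eq_iff)
  with B(2) show "mults n (1, 1, 1) A" by (auto simp: mults_uminus)
qed (auto simp: Gamma_weber_eq)

lemma tmul_one: "tmul (1, 1, 1) g = g" "tmul g (1, 1, 1) = g"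
  by (cases g, simp add: tmul_def)+

lemma subgroup_Gamma_weber: "subgroup (Gamma_weber n) PSL2Z"
proof (rule group.subgroupI[OF group_PSL2Z])
  show sub: "Gamma_weber n \<subseteq> carrier PSL2Z" by (auto simp: Gamma_weber_def)
  show "Gamma_weber n \<noteq> {}" using mults_one[of n] by (auto simp: Gamma_weber_eq)
  show "inv\<^bsub>PSL2Z\<^esub> c \<in> Gamma_weber n" if c: "c \<in> Gamma_weber n" for c
  proof -
    obtain A where A: "c = pm A" "mults n (1, 1, 1) A" using c by (auto simp: Gamma_weber_eq)
    obtain B where B: "det B = 1" "A ** B = mat 1" "B ** A = mat 1" using SL2_inverse[OF mults_det[OF A(2)]] by metis
    have "mults n (1, 1, 1) B" using mults_inverse[OF A(2) B(1,2)] by (simp add: tinv_def)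
    then have "pm B \<in> Gamma_weber n" by (simp add: pm_in_Gamma_weber)
    moreover have "inv\<^bsub>PSL2Z\<^esub> c = pm B"
      by (rule group.inv_equality[OF group_PSL2Z])
        (use A B sub c \<open>pm B \<in> Gamma_weber n\<close> in \<open>auto simp: mult_PSL2Z one_PSL2Z\<close>)
    ultimately show ?thesis by simp
  qed
  show "c \<otimes>\<^bsub>PSL2Z\<^esub> d \<in> Gamma_weber n" if c: "c \<in> Gamma_weber n" and d: "d \<in> Gamma_weber n" for c d
  proof -
    obtain A B where "c = pm A" "mults n (1, 1, 1) A" "d = pm B" "mults n (1, 1, 1) B"
      using c d unfolding Gamma_weber_eq by blast
    then show ?thesis using mults_mult[of n "(1, 1, 1)" A "(1, 1, 1)" B]
      by (simp add: mult_PSL2Z pm_in_Gamma_weber tmul_one)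
  qed
qed

text \<open>First isomorphism theorem for the map that sends an element of
  \<open>Gamma_weber n\<close> to its triple of eigenvalues at level m n.\<close>

lemma monodromy_iso:
  assumes mn: "m * n dvd 24"
  shows "(mu3 m)\<lparr>carrier := monodromy m n\<rparr> \<cong> (PSL2Z\<lparr>carrier := Gamma_weber n\<rparr>) Mod (Gamma_weber (m * n))"
proof -
  have m0: "m > 0" using div_24_mult(2)[OF mn] .
  let ?G = "PSL2Z\<lparr>carrier := Gamma_weber n\<rparr>" and ?H = "(mu3 m)\<lparr>carrier := monodromy m n\<rparr>"
  \<comment> \<open>A matrix determines its eigenvalues, and A and - A have the same ones, so the
    description is unique.\<close>
  define h where "h c = (THE g. \<exists>A\<in>c. mults (m * n) g A)" for c
  have h: "h (pm A) = g" if "mults (m * n) g A" for g A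
    unfolding h_def
  proof (rule the_equality)
    show "\<exists>B\<in>pm A. mults (m * n) g B" using that by (auto simp: pm_def)
    fix g' assume "\<exists>B\<in>pm A. mults (m * n) g' B"
    then have "mults (m * n) g' A" by (auto simp: pm_def mults_uminus)
    then show "g' = g" using mults_unique that by blast
  qed
  have ex: "\<exists>A g. c = pm A \<and> mults n (1, 1, 1) A \<and> mults (m * n) g A \<and> g \<in> monodromy m n \<and> h c = g"
    if c: "c \<in> Gamma_weber n" for c
  proof -
    obtain A where A: "c = pm A" "mults n (1, 1, 1) A" using c by (auto simp: Gamma_weber_eq)
    obtain g where g: "\<forall>i<3. coord3 g i ^ m = 1" "mults (m * n) g A" using mults_exists[OF A(2) mn] by blast
    then have "g \<in> monodromy m n" using carrier_mu3[OF m0] by (auto simp: monodromy_def)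
    with A g h show ?thesis by blast
  qed
  have G: "group ?G" by (rule group.subgroup_imp_group[OF group_PSL2Z subgroup_Gamma_weber])
  have H: "group ?H" by (rule group.subgroup_imp_group[OF group_mu3[OF m0] subgroup_monodromy[OF m0]])
  have "h \<in> hom ?G ?H"
  proof (rule homI)
    show "h c \<in> carrier ?H" if "c \<in> carrier ?G" for c using ex[of c] that by auto
    show "h (c \<otimes>\<^bsub>?G\<^esub> d) = h c \<otimes>\<^bsub>?H\<^esub> h d" if c: "c \<in> carrier ?G" and d: "d \<in> carrier ?G" for c d
    proof -
      obtain A g where A: "c = pm A" "mults (m * n) g A" "h c = g" using ex[of c] c by auto
      obtain B g' where B: "d = pm B" "mults (m * n) g' B" "h d = g'" using ex[of d] d by auto
      show ?thesis using h[OF mults_mult[OF A(2) B(2)]] A B by (simp add: mult_PSL2Z mult_mu3)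
    qed
  qed
  then have hom: "group_hom ?G ?H h" using G H by (simp add: group_hom_def group_hom_axioms_def)
  have "h ` carrier ?G = carrier ?H"
  proof (intro equalityI subsetI)
    fix g assume "g \<in> carrier ?H"
    then obtain A where g: "g \<in> carrier (mu3 m)" and A: "mults (m * n) g A" by (auto simp: monodromy_def)
    \<comment> \<open>The eigenvalues at level n are the m-th powers of those at level m n, which
      are m-th roots of unity.\<close>
    have "mults n (1, 1, 1) A" by (rule mults_trivial[OF A mn]) (use g in \<open>simp add: carrier_mu3[OF m0]\<close>)
    then show "g \<in> h ` carrier ?G" using h[OF A] by (auto simp: pm_in_Gamma_weber intro!: image_eqI[of _ _ "pm A"])
  next
    fix g assume "g \<in> h ` carrier ?G"
    then obtain c where "c \<in> Gamma_weber n" "g = h c" by auto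
    then show "g \<in> carrier ?H" using ex[of c] by auto
  qed
  then have "?G Mod (kernel ?G ?H h) \<cong> ?H" by (rule group_hom.FactGroup_iso[OF hom])
  moreover have "kernel ?G ?H h = Gamma_weber (m * n)"
  proof (intro equalityI subsetI)
    fix c assume "c \<in> kernel ?G ?H h"
    then have c: "c \<in> Gamma_weber n" "h c = (1, 1, 1)" by (simp_all add: kernel_def one_mu3)
    then show "c \<in> Gamma_weber (m * n)" using ex[OF c(1)] pm_in_Gamma_weber by auto
  next
    fix c assume "c \<in> Gamma_weber (m * n)"
    then obtain A where A: "c = pm A" "mults (m * n) (1, 1, 1) A" by (auto simp: Gamma_weber_eq)
    have "mults n (1, 1, 1) A" by (rule mults_trivial[OF A(2) mn]) simp
    then show "c \<in> kernel ?G ?H h" using A h[OF A(2)] by (simp add: kernel_def one_mu3 pm_in_Gamma_weber)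
  qed
  ultimately have iso: "?G Mod (Gamma_weber (m * n)) \<cong> ?H" by simp
  have "group (?G Mod (Gamma_weber (m * n)))"
    using normal.factorgroup_is_group[OF group_hom.normal_kernel[OF hom]] \<open>kernel ?G ?H h = _\<close> by simp
  then show ?thesis using group.iso_sym[OF _ iso] by blast
qed

subsection \<open>Automorphisms of the cover\<close>

lemma torus_act_one: "torus_act (1, 1, 1) x = x"
proof -
  have "tvec (1, 1, 1) v = v" for v by (simp add: P3_vec_eq_iff tvec_nth)
  then show ?thesis by (simp only: torus_act_eq abs_rep_P3)
qed

lemma torus_act_mult:
  assumes g: "\<And>i. i < 3 \<Longrightarrow> coord3 g i \<noteq> 0" and h: "\<And>i. i < 3 \<Longrightarrow> coord3 h i \<noteq> 0"
  shows "torus_act g (torus_act h x) = torus_act (tmul g h) x"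
proof -
  have 1: "tvec h (rep_P3 x) \<noteq> 0" using tvec_nonzero[OF h rep_P3_nonzero] .
  have 2: "tvec g (tvec h (rep_P3 x)) \<noteq> 0" using tvec_nonzero[OF g 1] .
  obtain c where c: "c \<noteq> 0" "rep_P3 (torus_act h x) = c *s tvec h (rep_P3 x)"
    unfolding torus_act_eq[of h] by (rule rep_abs_P3[OF 1])
  have "abs_P3 (tvec g (tvec h (rep_P3 x))) = torus_act g (torus_act h x)"
    unfolding torus_act_eq[of g] c(2) by (rule abs_P3_eqI[OF 2 c(1) tvec_scale])
  then show ?thesis by (simp only: tvec_tvec torus_act_eq[of "tmul g h"])
qed

lemma torus_act_curve: "mults N g A \<Longrightarrow> x \<in> weber_curve N \<Longrightarrow> torus_act g x \<in> weber_curve N"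
  using comorph_morphism[OF comorph_torus] unfolding is_morphism_def by blast

lemma comorph_torus_aut: "mults N g A \<Longrightarrow> comorph N N (torus_aut (weber_curve N) g) (mact A)"
  by (rule comorph_cong[OF comorph_torus]) (simp_all add: torus_aut_def)

text \<open>The inverse matrix provides the inverse morphism.\<close>

lemma torus_aut_carrier:
  assumes "mults N g A"
  shows "torus_aut (weber_curve N) g \<in> carrier (aut_group (weber_curve N))"
proof -
  let ?X = "weber_curve N"
  obtain B where B: "det B = 1" "A ** B = mat 1" using SL2_inverse[OF mults_det[OF assms]] by metis
  have inv: "mults N (tinv g) B" by (rule mults_inverse[OF assms B])
  have gi: "torus_act g (torus_act (tinv g) x) = x" "torus_act (tinv g) (torus_act g x) = x" for x
    by (simp_all only: torus_act_mult[OF mults_nonzero[OF assms] mults_nonzero[OF inv]]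
        torus_act_mult[OF mults_nonzero[OF inv] mults_nonzero[OF assms]]
        tmul_tinv[OF mults_nonzero[OF assms]] torus_act_one)
  have bij: "bij_betw (torus_aut ?X g) ?X ?X"
    unfolding torus_aut_def bij_betw_restrict_eq
    by (rule bij_betw_byWitness[of _ "torus_act (tinv g)"])
      (use gi torus_act_curve[OF assms] torus_act_curve[OF inv] in auto)
  have inv_eq: "inv_into ?X (torus_aut ?X g) x = torus_act (tinv g) x" if "x \<in> ?X" for x
    using that bij torus_act_curve[OF inv that] gi(1)[of x]
    by (intro inv_into_f_eq) (auto simp: bij_betw_def torus_aut_def)
  have "is_morphism ?X ?X (inv_into ?X (torus_aut ?X g))"
    by (rule comorph_morphism[OF comorph_cong[OF comorph_torus[OF inv]]]) (simp only: inv_eq)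
  moreover have "is_morphism ?X ?X (torus_aut ?X g)"
    by (rule comorph_morphism[OF comorph_torus_aut[OF assms]])
  ultimately show ?thesis
    using bij by (simp add: aut_group_def Bij_def torus_aut_def)
qed

lemma mult_aut_group:
  assumes "f \<in> carrier (aut_group X)" "g \<in> carrier (aut_group X)"
  shows "f \<otimes>\<^bsub>aut_group X\<^esub> g = compose X f g"
  using assms by (simp add: aut_group_def BijGroup_def)

lemma torus_aut_mult:
  assumes "mults N g A" "mults N h B"
  shows "torus_aut (weber_curve N) g \<otimes>\<^bsub>aut_group (weber_curve N)\<^esub> torus_aut (weber_curve N) h =
    torus_aut (weber_curve N) (tmul g h)"
  unfolding mult_aut_group[OF torus_aut_carrier[OF assms(1)] torus_aut_carrier[OF assms(2)]]
  using torus_act_mult[OF mults_nonzero[OF assms(1)] mults_nonzero[OF assms(2)]] torus_act_curve[OF assms(2)]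
  by (auto simp: compose_def torus_aut_def restrict_def fun_eq_iff simp del: torus_act.simps)

lemma torus_aut_one: "torus_aut (weber_curve N) (1, 1, 1) = \<one>\<^bsub>aut_group (weber_curve N)\<^esub>"
  by (simp add: torus_aut_def aut_group_def BijGroup_def restrict_def torus_act_one fun_eq_iff del: torus_act.simps)

text \<open>At the point belonging to \<tau> = i all coordinates are nonzero, and the last one,
  which the torus leaves alone, fixes the scalar.\<close>

lemma torus_aut_inj:
  assumes g: "mults N g A" and h: "mults N h B" and eq: "torus_aut (weber_curve N) g = torus_aut (weber_curve N) h"
  shows "g = h"
proof -
  have i: "Im \<i> > 0" by simp
  let ?x = "weber_point N \<i>"
  obtain c where c: "c \<noteq> 0" "rep_P3 ?x = c *s weber_vec N \<i>" by (rule rep_weber_point)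
  have "torus_act g ?x = torus_act h ?x"
    using fun_cong[OF eq, of ?x] weber_point_in_curve[OF i, of N] by (simp add: torus_aut_def del: torus_act.simps)
  then have "abs_P3 (tvec g (rep_P3 ?x)) = abs_P3 (tvec h (rep_P3 ?x))" by (simp only: torus_act_eq)
  then obtain k where k: "tvec h (rep_P3 ?x) = k *s tvec g (rep_P3 ?x)"
    using abs_P3_eqD tvec_nonzero[OF mults_nonzero[OF g] rep_P3_nonzero] tvec_nonzero[OF mults_nonzero[OF h] rep_P3_nonzero]
    by metis
  have "k = 1" using k c by (simp add: P3_vec_eq_iff tvec_nth weber_vec_nth del: coord3.simps)
  with k c show ?thesis using uw_nonzero[OF i]
    by (intro coord3_eqI) (simp_all add: P3_vec_eq_iff tvec_nth weber_vec_nth del: coord3.simps)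
qed

lemma weber_map_torus:
  assumes m: "m > 0" and g: "\<And>i. i < 3 \<Longrightarrow> coord3 g i ^ m = 1"
  shows "weber_map m (torus_act g x) = weber_map m x"
proof -
  have g0: "coord3 g i \<noteq> 0" if "i < 3" for i using g[OF that] m by (auto simp: zero_power)
  obtain c where c: "c \<noteq> 0" "rep_P3 (torus_act g x) = c *s tvec g (rep_P3 x)"
    unfolding torus_act_eq by (rule rep_abs_P3[OF tvec_nonzero[OF g0 rep_P3_nonzero]])
  have "(\<chi> i. rep_P3 (torus_act g x) $ i ^ m) = c ^ m *s (\<chi> i. rep_P3 x $ i ^ m)"
    using g[of 0] g[of 1] g[of 2] by (simp add: c(2) P3_vec_eq_iff tvec_nth power_mult_distrib del: coord3.simps)
  moreover have "(\<chi> i. rep_P3 x $ i ^ m) \<noteq> 0" using rep_P3_nonzero[of x] m by (auto simp: vec_eq_iff)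
  ultimately show ?thesis
    unfolding weber_map_def using c(1) by (intro abs_P3_eqI[symmetric]) auto
qed

section \<open>Regular automorphisms over the base are torus elements\<close>

lemma weber_vec_power:
  assumes "m * n dvd 24" shows "weber_vec (m * n) \<tau> $ j ^ m = weber_vec n \<tau> $ j"
  using P3_coord_cases[of j]
  by (elim disjE) (simp_all add: weber_vec_nth div_24_mult(1)[OF assms] power_mult)

lemma weber_vec_nth_nonzero: "Im \<tau> > 0 \<Longrightarrow> weber_vec N \<tau> $ j \<noteq> 0"
  using P3_coord_cases[of j] by (elim disjE) (simp_all add: weber_vec_nth uw_nonzero)

lemma weber_map_point:
  assumes "m * n dvd 24" shows "weber_map m (weber_point (m * n) \<tau>) = weber_point n \<tau>"
proof -
  obtain c where c: "c \<noteq> 0" "rep_P3 (weber_point (m * n) \<tau>) = c *s weber_vec (m * n) \<tau>" by (rule rep_weber_point)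
  have "(\<chi> i. rep_P3 (weber_point (m * n) \<tau>) $ i ^ m) = c ^ m *s weber_vec n \<tau>"
    by (simp add: c(2) vec_eq_iff power_mult_distrib weber_vec_power[OF assms])
  then show ?thesis
    unfolding weber_map_def weber_point_eq[of n] using c(1) weber_vec_nonzero
    by (intro abs_P3_eqI[symmetric]) auto
qed

text \<open>Proportionality is expressed by 2 by 2 minors, a polynomial condition that passes from
  the image of the half plane to the whole curve.\<close>

lemma abs_P3_eq_cross:
  assumes v: "v \<noteq> 0" and w: "w \<noteq> 0" and cross: "\<And>i j. v $ i * w $ j = v $ j * w $ i"
  shows "abs_P3 v = abs_P3 w"
proof -
  obtain j where j: "v $ j \<noteq> 0" using v by (auto simp: vec_eq_iff)
  have eq: "w $ i = w $ j / v $ j * v $ i" for i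
  proof -
    have "w $ j / v $ j * v $ i = (v $ i * w $ j) / v $ j" by simp
    also have "\<dots> = w $ i" unfolding cross[of i j] using j by simp
    finally show ?thesis ..
  qed
  have "w $ j \<noteq> 0"
  proof
    assume 0: "w $ j = 0"
    have "w $ i = 0" for i using eq[of i] unfolding 0 by simp
    then have "w = 0" by (simp add: vec_eq_iff)
    with w show False by simp
  qed
  then have "w $ j / v $ j \<noteq> 0" using j by simp
  moreover have "w = (w $ j / v $ j) *s v"
    unfolding vec_eq_iff vector_smult_component by (intro allI eq)
  ultimately show ?thesis by (rule abs_P3_eqI[OF v])
qed

text \<open>Along the image of the upper half plane an automorphism of the cover multiplies the
  coordinates by roots of unity; these depend continuously on the point, so they are constant.\<close>

lemma cover_automorphism_torus:
  assumes mn: "m * n dvd 24"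
    and mor: "is_morphism (weber_curve (m * n)) (weber_curve (m * n)) \<sigma>"
    and \<pi>: "\<And>x. x \<in> weber_curve (m * n) \<Longrightarrow> weber_map m (\<sigma> x) = weber_map m x"
  shows "\<exists>g. (\<forall>i<3. coord3 g i ^ m = 1) \<and> (\<forall>x\<in>weber_curve (m * n). \<sigma> x = torus_act g x)"
proof -
  let ?N = "m * n"
  let ?X = "weber_curve ?N"
  have m0: "m > 0" using div_24_mult(2)[OF mn] .
  define y where "y \<tau> = rep_P3 (\<sigma> (weber_point ?N \<tau>))" for \<tau>
  define W where "W = weber_vec ?N"
  \<comment> \<open>The image point lies over the point of level n at \<tau>, whose last coordinate
    is nonzero. So it has affine coordinates, with the same m-th powers as those of the original
    point.\<close>
  have pow: "y \<tau> $ 3 \<noteq> 0 \<and> (y \<tau> $ j / y \<tau> $ 3) ^ m = W \<tau> $ j ^ m" if \<tau>: "Im \<tau> > 0" for \<tau> j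
  proof -
    have "abs_P3 (\<chi> i. y \<tau> $ i ^ m) = abs_P3 (weber_vec n \<tau>)"
      using \<pi>[OF weber_point_in_curve[OF \<tau>]] weber_map_point[OF mn]
      by (simp add: weber_map_def[of _ "\<sigma> _"] y_def weber_point_eq)
    moreover have "(\<chi> i. y \<tau> $ i ^ m) \<noteq> 0" using rep_P3_nonzero m0 by (auto simp: y_def vec_eq_iff)
    ultimately obtain k where k: "weber_vec n \<tau> = k *s (\<chi> i. y \<tau> $ i ^ m)"
      using abs_P3_eqD[OF _ weber_vec_nonzero] by metis
    have kj: "W \<tau> $ j ^ m = k * y \<tau> $ j ^ m" for j
      unfolding W_def weber_vec_power[OF mn] k by simp
    have 3: "1 = k * y \<tau> $ 3 ^ m" using kj[of 3] by (simp add: W_def weber_vec_nth)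
    then have "y \<tau> $ 3 \<noteq> 0" using m0 by (auto simp: zero_power)
    moreover from this 3 have "k = 1 / y \<tau> $ 3 ^ m" by (simp add: field_simps)
    ultimately show ?thesis using kj[of j] by (simp add: power_divide)
  qed
  have repF: "\<exists>c. c \<noteq> 0 \<and> F (rep_P3 (weber_point ?N \<tau>)) = c *s F (W \<tau>)"
    if F: "\<And>i. hpoly d (\<lambda>v. F v $ i)" for d F \<tau>
  proof -
    obtain c where c: "c \<noteq> 0" "rep_P3 (weber_point ?N \<tau>) = c *s weber_vec ?N \<tau>" by (rule rep_weber_point)
    have "F (rep_P3 (weber_point ?N \<tau>)) = c ^ d *s F (W \<tau>)"
      unfolding c(2) W_def vec_eq_iff by (simp add: hpoly_homogeneous[OF F])
    then show ?thesis using c(1) by (intro exI[of _ "c ^ d"]) simp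
  qed
  have local: "\<exists>k. k \<noteq> 0 \<and> y \<tau> = k *s F (W \<tau>)"
    if F: "\<And>i. hpoly d (\<lambda>v. F v $ i)" "\<And>y. y \<in> ?X \<Longrightarrow> F (rep_P3 y) \<noteq> 0 \<Longrightarrow> \<sigma> y = abs_P3 (F (rep_P3 y))"
      and \<tau>: "Im \<tau> > 0" and nz: "F (W \<tau>) \<noteq> 0" for d F \<tau>
  proof -
    obtain c where c: "c \<noteq> 0" "F (rep_P3 (weber_point ?N \<tau>)) = c *s F (W \<tau>)" using repF[OF F(1)] by blast
    then have "F (rep_P3 (weber_point ?N \<tau>)) \<noteq> 0" using nz by simp
    moreover from F(2)[OF weber_point_in_curve[OF \<tau>] this]
    have "y \<tau> = rep_P3 (abs_P3 (F (rep_P3 (weber_point ?N \<tau>))))" by (simp add: y_def)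
    ultimately obtain l where "l \<noteq> 0" "y \<tau> = l *s F (rep_P3 (weber_point ?N \<tau>))" by (metis rep_abs_P3)
    then show ?thesis using c by (intro exI[of _ "l * c"]) simp
  qed
  have morD: "\<exists>d F. (\<forall>i. hpoly d (\<lambda>v. F v $ i)) \<and> F (rep_P3 x) \<noteq> 0 \<and>
        (\<forall>y\<in>?X. F (rep_P3 y) \<noteq> 0 \<longrightarrow> \<sigma> y = abs_P3 (F (rep_P3 y)))" if "x \<in> ?X" for x
    using mor that unfolding is_morphism_def by blast
  \<comment> \<open>The vector \<open>y \<tau>\<close> involves an arbitrary choice and need not be
    continuous; the quotients of its coordinates are free of this choice and locally given by
    quotients of holomorphic functions.\<close>
  have cont: "continuous_on upper_half_plane (\<lambda>\<tau>. y \<tau> $ j / y \<tau> $ 3)" for j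
    unfolding continuous_on_eq_continuous_at[OF open_upper_half_plane]
  proof
    fix \<tau>0 assume "\<tau>0 \<in> upper_half_plane"
    then have \<tau>0: "Im \<tau>0 > 0" by simp
    obtain d F where F: "\<And>i. hpoly d (\<lambda>v. F v $ i)" "F (rep_P3 (weber_point ?N \<tau>0)) \<noteq> 0"
      "\<And>y. y \<in> ?X \<Longrightarrow> F (rep_P3 y) \<noteq> 0 \<Longrightarrow> \<sigma> y = abs_P3 (F (rep_P3 y))"
      using morD[OF weber_point_in_curve[OF \<tau>0]] by blast
    have cF: "continuous_on upper_half_plane (\<lambda>\<tau>. F (W \<tau>) $ i)" for i
      unfolding W_def by (rule holomorphic_on_imp_continuous_on[OF hpoly_holomorphic[OF F(1)]])
    define U where "U = {\<tau> \<in> upper_half_plane. F (W \<tau>) $ 3 \<noteq> 0}"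
    have "U = upper_half_plane \<inter> (\<lambda>\<tau>. F (W \<tau>) $ 3) -` (- {0})" by (auto simp: U_def)
    then have "open U"
      using cF[of 3] open_upper_half_plane
      by (metis continuous_on_open_vimage open_Compl closed_singleton Int_commute)
    have "F (W \<tau>0) \<noteq> 0"
    proof
      assume 0: "F (W \<tau>0) = 0"
      then have "F (rep_P3 (weber_point ?N \<tau>0)) = 0" using repF[OF F(1), of \<tau>0] by auto
      then show False using F(2) by blast
    qed
    with local[OF F(1,3) \<tau>0] pow[OF \<tau>0] have "F (W \<tau>0) $ 3 \<noteq> 0" by auto
    then have "\<tau>0 \<in> U" using \<tau>0 by (simp add: U_def)
    have "continuous_on U (\<lambda>\<tau>. F (W \<tau>) $ j / F (W \<tau>) $ 3)"
      by (intro continuous_intros continuous_on_subset[OF cF]) (auto simp: U_def)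
    moreover have "F (W \<tau>) $ j / F (W \<tau>) $ 3 = y \<tau> $ j / y \<tau> $ 3" if "\<tau> \<in> U" for \<tau>
    proof -
      have "F (W \<tau>) \<noteq> 0" using that by (auto simp: U_def)
      then obtain k where "k \<noteq> 0" "y \<tau> = k *s F (W \<tau>)" using local[OF F(1,3)] \<open>\<tau> \<in> U\<close> by (auto simp: U_def)
      then show ?thesis by simp
    qed
    ultimately have "continuous_on U (\<lambda>\<tau>. y \<tau> $ j / y \<tau> $ 3)" by (simp cong: continuous_on_cong)
    then show "isCont (\<lambda>\<tau>. y \<tau> $ j / y \<tau> $ 3) \<tau>0"
      using continuous_on_eq_continuous_at[OF \<open>open U\<close>] \<open>\<tau>0 \<in> U\<close> by blast
  qed
  have root: "(y \<tau> $ j / y \<tau> $ 3 / W \<tau> $ j) ^ m = 1" if \<tau>: "Im \<tau> > 0" for \<tau> j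
    by (subst power_divide) (use pow[OF \<tau>, of j] weber_vec_nth_nonzero[OF \<tau>, of ?N j] in \<open>simp add: W_def\<close>)
  have "\<exists>c. \<forall>\<tau>\<in>upper_half_plane. y \<tau> $ j / y \<tau> $ 3 / W \<tau> $ j = c" for j
  proof (rule continuous_root_of_unity_constant[OF connected_upper_half_plane _ m0])
    have "continuous_on upper_half_plane (\<lambda>\<tau>. W \<tau> $ j)"
      unfolding W_def by (rule holomorphic_on_imp_continuous_on[OF hpoly_holomorphic[OF hpoly_coord]])
    then show "continuous_on upper_half_plane (\<lambda>\<tau>. y \<tau> $ j / y \<tau> $ 3 / W \<tau> $ j)"
      by (intro continuous_on_divide[OF cont]) (simp_all add: W_def weber_vec_nth_nonzero)
    fix \<tau> assume "\<tau> \<in> upper_half_plane"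
    then have \<tau>: "Im \<tau> > 0" by simp
    show "(y \<tau> $ j / y \<tau> $ 3 / W \<tau> $ j) ^ m = 1" by (rule root[OF \<tau>])
  qed
  then obtain c where c: "\<And>j \<tau>. Im \<tau> > 0 \<Longrightarrow> y \<tau> $ j / y \<tau> $ 3 / W \<tau> $ j = c j"
    unfolding Ball_def in_upper_half_plane by metis
  have yc: "y \<tau> $ j = y \<tau> $ 3 * (c j * W \<tau> $ j)" if "Im \<tau> > 0" for \<tau> j
  proof -
    have "y \<tau> $ 3 \<noteq> 0" using pow[OF that] by blast
    then show ?thesis
      using c[OF that, of j] weber_vec_nth_nonzero[OF that, of ?N j] unfolding W_def by (simp add: divide_eq_eq)
  qed
  define g where "g = (c 0, c 1, c 2)"
  have c3: "c 3 = 1" using c[of \<i> 3] pow[of \<i> 3] by (simp add: W_def weber_vec_nth)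
  have yg: "y \<tau> = y \<tau> $ 3 *s tvec g (W \<tau>)" if \<tau>: "Im \<tau> > 0" for \<tau>
    using yc[OF \<tau>, of 0] yc[OF \<tau>, of 1] yc[OF \<tau>, of 2] c3
    by (simp add: P3_vec_eq_iff tvec_nth g_def W_def weber_vec_nth)
  have cm: "c j ^ m = 1" for j using c[of \<i> j] root[of \<i> j] by simp
  have gm: "coord3 g i ^ m = 1" for i using cm by (simp add: g_def)
  then have g0: "coord3 g i \<noteq> 0" for i using m0 by (metis power_eq_0_iff zero_neq_one)
  have "\<sigma> x = torus_act g x" if x: "x \<in> ?X" for x
  proof -
    obtain d F where F: "\<And>i. hpoly d (\<lambda>v. F v $ i)" "F (rep_P3 x) \<noteq> 0"
      "\<And>y. y \<in> ?X \<Longrightarrow> F (rep_P3 y) \<noteq> 0 \<Longrightarrow> \<sigma> y = abs_P3 (F (rep_P3 y))"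
      using morD[OF x] by blast
    \<comment> \<open>The minors of the local expression and the torus image vanish on the image of
      the half plane, hence also at the added points of the closure. Where the local expression is
      zero, they vanish trivially.\<close>
    have "F (rep_P3 x) $ i * tvec g (rep_P3 x) $ j = F (rep_P3 x) $ j * tvec g (rep_P3 x) $ i" for i j
    proof -
      define p where "p v = F v $ i * tvec g v $ j - F v $ j * tvec g v $ i" for v
      have p: "hpoly (d + 1) p"
        unfolding p_def[abs_def] by (intro hpoly_diff hpoly_mult F(1) hpoly_tvec)
      have "p (W \<tau>) = 0" if \<tau>: "Im \<tau> > 0" for \<tau>
      proof (cases "F (W \<tau>) = 0")
        case False
        then obtain k where k: "k \<noteq> 0" "y \<tau> = k *s F (W \<tau>)" using local[OF F(1,3) \<tau>] by blast
        have e: "k * F (W \<tau>) $ i = y \<tau> $ 3 * tvec g (W \<tau>) $ i" for i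
          using arg_cong[OF yg[OF \<tau>], of "\<lambda>v. v $ i"] arg_cong[OF k(2), of "\<lambda>v. v $ i"]
          by (simp only: vector_smult_component)
        have "k * (F (W \<tau>) $ i * tvec g (W \<tau>) $ j) = y \<tau> $ 3 * tvec g (W \<tau>) $ i * tvec g (W \<tau>) $ j" for i j
          by (simp only: mult.assoc[symmetric] e)
        from this[of i j] this[of j i]
        have "k * (F (W \<tau>) $ i * tvec g (W \<tau>) $ j) = k * (F (W \<tau>) $ j * tvec g (W \<tau>) $ i)"
          by (simp only: mult_ac)
        then show ?thesis using k(1) by (simp add: p_def)
      qed (simp add: p_def)
      then have "p (rep_P3 x) = 0" using vanishes_on_curve_iff_points[OF p, of ?N] x unfolding W_def by blast
      then show ?thesis by (simp add: p_def)
    qed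
    then have "abs_P3 (F (rep_P3 x)) = abs_P3 (tvec g (rep_P3 x))"
      by (intro abs_P3_eq_cross F(2) tvec_nonzero g0 rep_P3_nonzero)
    then show ?thesis using F(3)[OF x F(2)] by (simp only: torus_act_eq)
  qed
  with gm show ?thesis by blast
qed

text \<open>What the equations demand of a triple that multiplies the generators: it preserves the
  product relation and, for m = 3, Jacobi's relation. Regular automorphisms and field automorphisms
  both lead to this condition.\<close>

definition compatible :: "nat \<Rightarrow> nat \<Rightarrow> complex \<times> complex \<times> complex \<Rightarrow> bool" where
  "compatible m n g \<longleftrightarrow>
     (cst (coord3 g 0) * xx (m * n) 0) * (cst (coord3 g 1) * xx (m * n) 1) * (cst (coord3 g 2) * xx (m * n) 2) =
       cst (of_real (sqrt 2) ^ (24 div (m * n))) \<and>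
     (m = 3 \<longrightarrow> (cst (coord3 g 0) * xx (m * n) 0) ^ n + (cst (coord3 g 1) * xx (m * n) 1) ^ n +
       (cst (coord3 g 2) * xx (m * n) 2) ^ n = 0)"

text \<open>For m dividing 8 the product relation confines \<open>g\<close> to
  \<open>nabla m\<close>; for m = 3 Jacobi's relation confines it to
  \<open>diagonal 3\<close>.\<close>

lemma compatible_monodromy:
  assumes mn: "m * n dvd 24" and m: "m = 3 \<or> m dvd 8"
    and g: "\<And>i. i < 3 \<Longrightarrow> coord3 g i ^ m = 1" and compat: "compatible m n g"
  shows "g \<in> monodromy m n"
proof -
  have m0: "m > 0" using div_24_mult(2)[OF mn] .
  have gm: "g \<in> carrier (mu3 m)" using g by (simp add: carrier_mu3[OF m0])
  from m show ?thesis
  proof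
    assume "m = 3"
    then show ?thesis
      using compat gm mn monodromy_diagonal[of n] diagonalI[of n g]
      by (simp add: compatible_def power_mult_distrib cst_power del: coord3.simps)
  next
    assume m8: "m dvd 8"
    have "cst (coord3 g 0 * coord3 g 1 * coord3 g 2) * (xx (m * n) 0 * xx (m * n) 1 * xx (m * n) 2) =
        (cst (coord3 g 0) * xx (m * n) 0) * (cst (coord3 g 1) * xx (m * n) 1) * (cst (coord3 g 2) * xx (m * n) 2)"
      by (simp only: cst_simps(5) mult_ac)
    also have "\<dots> = 1 * (xx (m * n) 0 * xx (m * n) 1 * xx (m * n) 2)"
      unfolding xx_mult using compat by (simp only: compatible_def) simp
    finally have "cst (coord3 g 0 * coord3 g 1 * coord3 g 2) * (xx (m * n) 0 * xx (m * n) 1 * xx (m * n) 2) =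
        1 * (xx (m * n) 0 * xx (m * n) 1 * xx (m * n) 2)" .
    then have "cst (coord3 g 0 * coord3 g 1 * coord3 g 2) = cst 1"
      using xx_nonzero[of "m * n"] by (simp only: mult_cancel_right mult_eq_0_iff cst_simps(2)) simp
    then have "coord3 g 0 * coord3 g 1 * coord3 g 2 = 1" by (simp only: cst_simps(6))
    then show ?thesis using gm by (simp only: monodromy_nabla[OF mn m8] nabla_iff[OF m0] simp_thms)
  qed
qed

text \<open>Both relations are forms that vanish on the curve, hence also at the torus images of its
  points.\<close>

lemma compatible_torus:
  assumes mn: "m * n dvd 24" and g: "\<And>x. x \<in> weber_curve (m * n) \<Longrightarrow> torus_act g x \<in> weber_curve (m * n)"
    and g0: "\<And>i. i < 3 \<Longrightarrow> coord3 g i \<noteq> 0"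
  shows "compatible m n g"
proof -
  let ?N = "m * n"
  define w where "w i = hconst (coord3 g i) * xh ?N i" for i
  have hw: "hfun (w i) \<tau> = coord3 g i * uw i \<tau> ^ (24 div ?N)" if "Im \<tau> > 0" for i \<tau>
    using that by (simp add: w_def hfun_ops hfun_hconst hfun_xh)
  have ew: "emb (w i) = cst (coord3 g i) * xx ?N i" for i
    by (simp add: w_def emb_simps cst_def xx_def)
  have key: "p (tvec g (weber_vec ?N \<tau>)) = 0" if p: "hpoly d p" "\<And>\<tau>. Im \<tau> > 0 \<Longrightarrow> p (weber_vec ?N \<tau>) = 0" and \<tau>: "Im \<tau> > 0"
    for d p \<tau>
  proof -
    obtain c where c: "c \<noteq> 0" "rep_P3 (weber_point ?N \<tau>) = c *s weber_vec ?N \<tau>" by (rule rep_weber_point)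
    have t0: "tvec g (rep_P3 (weber_point ?N \<tau>)) \<noteq> 0" by (rule tvec_nonzero[OF g0 rep_P3_nonzero])
    obtain c' where c': "c' \<noteq> 0" "rep_P3 (torus_act g (weber_point ?N \<tau>)) = c' *s tvec g (rep_P3 (weber_point ?N \<tau>))"
      unfolding torus_act_eq by (rule rep_abs_P3[OF t0])
    have "p (rep_P3 (torus_act g (weber_point ?N \<tau>))) = 0"
      using g[OF weber_point_in_curve[OF \<tau>]] vanishes_on_curve_iff_points[OF p(1), of ?N] p(2) by blast
    then show ?thesis
      using c c' by (simp add: c'(2) c(2) tvec_scale hpoly_homogeneous[OF p(1)])
  qed
  have "w 0 * w 1 * w 2 = hconst (of_real (sqrt 2) ^ (24 div ?N))"
  proof (rule holo_eqI)
    fix \<tau> assume \<tau>: "Im \<tau> > 0"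
    \<comment> \<open>The product relation, made homogeneous by the cube of the last
      coordinate.\<close>
    define p :: "complex ^ 4 \<Rightarrow> complex" where
      "p v = v $ 0 * v $ 1 * v $ 2 - of_real (sqrt 2) ^ (24 div ?N) * v $ 3 ^ 3" for v
    have "hpoly (1 + 1 + 1) p" unfolding p_def[abs_def]
      using hpoly_coord_power[of 3 3] by (intro hpoly_diff hpoly_mult hpoly_coord hpoly_scale) (simp add: numeral_3_eq_3)
    moreover have "p (weber_vec ?N \<tau>) = 0" if "Im \<tau> > 0" for \<tau>
      by (simp add: p_def weber_vec_nth power_mult_distrib[symmetric] uw_mult[OF that, unfolded One_nat_def])
    ultimately have "p (tvec g (weber_vec ?N \<tau>)) = 0" using key \<tau> by blast
    then show "hfun (w 0 * w 1 * w 2) \<tau> = hfun (hconst (of_real (sqrt 2) ^ (24 div ?N))) \<tau>"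
      using \<tau> by (simp add: p_def tvec_nth weber_vec_nth hfun_ops hw hfun_hconst del: coord3.simps)
  qed
  then have 1: "emb (w 0) * emb (w 1) * emb (w 2) = cst (of_real (sqrt 2) ^ (24 div ?N))"
    by (simp add: cst_def emb_simps(6)[symmetric])
  have 2: "emb (w 0) ^ n + emb (w 1) ^ n + emb (w 2) ^ n = 0" if "m = 3"
  proof -
    have N: "?N = 3 * n" using that by simp
    have s: "xh ?N 0 ^ n + xh ?N 1 ^ n + xh ?N 2 ^ n = 0"
      using xx_sum[of n] mn unfolding N xx_def by (simp add: emb_power[symmetric] emb_simps(3)[symmetric] emb_simps(8))
    have "w 0 ^ n + w 1 ^ n + w 2 ^ n = 0"
    proof (rule holo_eqI)
      fix \<tau> assume \<tau>: "Im \<tau> > 0"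
      define p :: "complex ^ 4 \<Rightarrow> complex" where "p v = v $ 0 ^ n + v $ 1 ^ n + v $ 2 ^ n" for v
      have "hpoly n p" unfolding p_def[abs_def] by (intro hpoly_add hpoly_coord_power)
      moreover have "p (weber_vec ?N \<tau>) = 0" if "Im \<tau> > 0" for \<tau>
        using arg_cong[OF s, of "\<lambda>a. hfun a \<tau>"] that by (simp add: p_def weber_vec_nth hfun_ops hfun_power hfun_xh)
      ultimately have "p (tvec g (weber_vec ?N \<tau>)) = 0" using key \<tau> by blast
      then show "hfun (w 0 ^ n + w 1 ^ n + w 2 ^ n) \<tau> = hfun 0 \<tau>"
        using \<tau> by (simp add: p_def tvec_nth weber_vec_nth hfun_ops hfun_power hw del: coord3.simps)
    qed
    then have "emb (w 0 ^ n + w 1 ^ n + w 2 ^ n) = 0" by (simp only: emb_simps(1))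
    then show ?thesis by (simp only: emb_simps(3) emb_power)
  qed
  from 1 2 show ?thesis unfolding compatible_def ew[symmetric] by blast
qed

lemma monodromyD:
  assumes "g \<in> monodromy m n" "m > 0"
  shows "\<And>i. i < 3 \<Longrightarrow> coord3 g i ^ m = 1" "\<exists>A. mults (m * n) g A"
  using assms by (auto simp: monodromy_def carrier_mu3)

lemma mult_cover_aut_group: "mult (cover_aut_group X \<pi>) = mult (aut_group X)"
  by (simp add: cover_aut_group_def)

text \<open>Surjectivity is the point: an automorphism of the cover is a torus element by
  \<open>cover_automorphism_torus\<close>, and as it preserves the curve, that element is compatible
  and lies in the monodromy group.\<close>

lemma torus_aut_iso:
  assumes mn: "m * n dvd 24" and m: "m = 3 \<or> m dvd 8"
  shows "torus_aut (weber_curve (m * n)) \<in>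
    iso ((mu3 m)\<lparr>carrier := monodromy m n\<rparr>) (cover_aut_group (weber_curve (m * n)) (weber_map m))"
proof -
  let ?N = "m * n"
  let ?X = "weber_curve ?N"
  let ?A = "cover_aut_group ?X (weber_map m)"
  have m0: "m > 0" using div_24_mult(2)[OF mn] .
  have car: "torus_aut ?X g \<in> carrier ?A" if g: "g \<in> monodromy m n" for g
  proof -
    obtain A where A: "mults ?N g A" using monodromyD(2)[OF g m0] by blast
    show ?thesis
      using torus_aut_carrier[OF A] weber_map_torus[OF m0 monodromyD(1)[OF g m0]]
      by (simp add: cover_aut_group_def torus_aut_def del: torus_act.simps)
  qed
  have hom: "torus_aut ?X \<in> hom ((mu3 m)\<lparr>carrier := monodromy m n\<rparr>) ?A"
  proof (rule homI)
    show "torus_aut ?X g \<in> carrier ?A" if "g \<in> carrier ((mu3 m)\<lparr>carrier := monodromy m n\<rparr>)" for g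
      using car that by simp
    fix g h assume "g \<in> carrier ((mu3 m)\<lparr>carrier := monodromy m n\<rparr>)" "h \<in> carrier ((mu3 m)\<lparr>carrier := monodromy m n\<rparr>)"
    then have "g \<in> monodromy m n" "h \<in> monodromy m n" by simp_all
    from monodromyD(2)[OF this(1) m0] monodromyD(2)[OF this(2) m0]
    obtain A B where "mults ?N g A" "mults ?N h B" by blast
    then show "torus_aut ?X (g \<otimes>\<^bsub>(mu3 m)\<lparr>carrier := monodromy m n\<rparr>\<^esub> h) = torus_aut ?X g \<otimes>\<^bsub>?A\<^esub> torus_aut ?X h"
      by (simp add: mult_mu3 mult_cover_aut_group torus_aut_mult)
  qed
  have inj: "inj_on (torus_aut ?X) (monodromy m n)"
    by (rule inj_onI) (use torus_aut_inj monodromyD(2)[OF _ m0] in blast)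
  have "carrier ?A \<subseteq> torus_aut ?X ` monodromy m n"
  proof
    fix \<sigma> assume \<sigma>: "\<sigma> \<in> carrier ?A"
    then have mor: "is_morphism ?X ?X \<sigma>" and ext: "\<sigma> \<in> extensional ?X" and \<pi>: "\<And>x. x \<in> ?X \<Longrightarrow> weber_map m (\<sigma> x) = weber_map m x"
      by (auto simp: cover_aut_group_def aut_group_def Bij_def)
    obtain g where g: "\<And>i. i < 3 \<Longrightarrow> coord3 g i ^ m = 1" "\<And>x. x \<in> ?X \<Longrightarrow> \<sigma> x = torus_act g x"
      using cover_automorphism_torus[OF mn mor \<pi>] by blast
    have g0: "coord3 g i \<noteq> 0" if "i < 3" for i using g(1)[OF that] m0 by (auto simp: zero_power)
    have "torus_act g x \<in> ?X" if "x \<in> ?X" for x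
      using mor that g(2)[OF that] unfolding is_morphism_def by force
    then have "g \<in> monodromy m n"
      by (intro compatible_monodromy[OF mn m g(1)] compatible_torus[OF mn _ g0])
    moreover have "\<sigma> = torus_aut ?X g"
      unfolding torus_aut_def by (rule extensionalityI[OF ext]) (simp_all add: g(2) del: torus_act.simps)
    ultimately show "\<sigma> \<in> torus_aut ?X ` monodromy m n" by blast
  qed
  with hom car inj show ?thesis by (auto simp: iso_def bij_betw_def)
qed

subsection \<open>Field automorphisms and the degree\<close>

lemma pulled_back_field_weber:
  assumes "m * n dvd 24"
  shows "pulled_back_field (weber_curve (m * n)) (weber_curve n) (weber_map m) = cls (m * n) ` KK n"
proof -
  have "pullback (weber_curve (m * n)) (weber_map m) (cls n b) = cls (m * n) b" if "b \<in> KK n" for b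
    using comorph_pullback[OF comorph_weber_map[OF assms] that] .
  then show ?thesis
    unfolding pulled_back_field_def carrier_function_field by (simp add: image_image cong: image_cong)
qed

lemma mact_KK:
  assumes A: "mults N g A" and a: "a \<in> KK N"
  shows "mact A a \<in> KK N"
proof -
  note hom = field_hom_mact[OF mults_det[OF A]] and K = subfld_KK[of N]
  have gen: "mact A (cst c) \<in> KK N" "i < 3 \<Longrightarrow> mact A (xx N i) \<in> KK N" for c i
    using cst_KK xx_KK mact_cst[OF mults_det[OF A]] mact_xx[OF A] by (auto intro: subfld_mult[OF K])
  have "subfld {a. mact A a \<in> KK N}"
    by (simp add: subfld_def field_hom_1[OF hom] field_hom_add[OF hom] field_hom_mult[OF hom]
        field_hom_minus[OF hom] field_hom_inverse[OF hom] subfld_1[OF K] subfld_add[OF K]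
        subfld_mult[OF K] subfld_minus[OF K] subfld_inverse[OF K])
  from gen_least[OF this, of "range cst \<union> {xx N 0, xx N 1, xx N 2}", folded KK_def]
  have "KK N \<subseteq> {a. mact A a \<in> KK N}" using gen by auto
  then show ?thesis using a by blast
qed

text \<open>Composition with matrices in general reverses the order of products. On
  \<open>KK N\<close> the order does not matter, because both sides multiply each generator by the
  same product of eigenvalues.\<close>

lemma mact_mact:
  assumes A: "mults N g A" and B: "mults N h B" and a: "a \<in> KK N"
  shows "mact A (mact B a) = mact (A ** B) a"
proof -
  note AB = mults_mult[OF A B]
  have hom: "field_hom (\<lambda>a. mact A (mact B a))"
    using field_hom_mact[OF mults_det[OF A]] field_hom_mact[OF mults_det[OF B]] by (simp add: field_hom_def)
  have "mact A (mact B (cst c)) = mact (A ** B) (cst c)" for c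
    by (simp add: mact_cst mults_det[OF A] mults_det[OF B] mults_det[OF AB])
  moreover have "mact A (mact B (xx N i)) = mact (A ** B) (xx N i)" if "i < 3" for i
    using that by (simp add: mact_xx[OF A] mact_xx[OF B] mact_xx[OF AB] coord3_tmul cst_simps
        field_hom_mult[OF field_hom_mact[OF mults_det[OF A]]] mact_cst[OF mults_det[OF A]] mult_ac del: coord3.simps)
  ultimately show ?thesis
    by (intro field_hom_gen_eq[OF hom field_hom_mact[OF mults_det[OF AB]] _ a[unfolded KK_def]]) auto
qed

lemma pullback_torus_cls:
  "mults N g A \<Longrightarrow> a \<in> KK N \<Longrightarrow> pullback (weber_curve N) (torus_act g) (cls N a) = cls N (mact A a)"
  by (rule comorph_pullback[OF comorph_torus])

lemma cls_carrier: "a \<in> KK N \<Longrightarrow> cls N a \<in> carrier (function_field (weber_curve N))"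
  by (simp add: carrier_function_field)

lemma carrier_cases:
  assumes "A \<in> carrier (function_field (weber_curve N))"
  obtains a where "a \<in> KK N" "A = cls N a"
  using assms by (auto simp: carrier_function_field)

lemma torus_field_aut_cls:
  "mults N g A \<Longrightarrow> a \<in> KK N \<Longrightarrow> torus_field_aut (weber_curve N) g (cls N a) = cls N (mact A a)"
  by (simp add: torus_field_aut_def cls_carrier pullback_torus_cls)

lemma torus_field_aut_carrier:
  assumes mn: "m * n dvd 24" and g: "\<And>i. i < 3 \<Longrightarrow> coord3 g i ^ m = 1" and A: "mults (m * n) g A"
  shows "torus_field_aut (weber_curve (m * n)) g \<in>
    carrier (cover_galois_group (weber_curve (m * n)) (weber_curve n) (weber_map m))"
proof -
  let ?N = "m * n"
  let ?X = "weber_curve ?N"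
  let ?F = "function_field ?X"
  let ?t = "torus_field_aut ?X"
  obtain B where B: "det B = 1" "A ** B = mat 1" "B ** A = mat 1" using SL2_inverse[OF mults_det[OF A]] by metis
  have inv: "mults ?N (tinv g) B" by (rule mults_inverse[OF A B(1,2)])
  have id: "mact (mat 1) a = a" if "a \<in> KK ?N" for a by (rule mact_fixes_KK[OF mults_one that])
  have t: "?t g (cls ?N a) = cls ?N (mact A a)" "?t (tinv g) (cls ?N a) = cls ?N (mact B a)" if "a \<in> KK ?N" for a
    by (rule torus_field_aut_cls[OF A that], rule torus_field_aut_cls[OF inv that])
  have bij: "bij_betw (?t g) (carrier ?F) (carrier ?F)"
  proof (rule bij_betw_byWitness[of _ "?t (tinv g)"])
    show "\<forall>x\<in>carrier ?F. ?t (tinv g) (?t g x) = x"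
      by (auto elim!: carrier_cases simp: t mact_KK[OF A] mact_mact[OF inv A] B(3) id)
    show "\<forall>x\<in>carrier ?F. ?t g (?t (tinv g) x) = x"
      by (auto elim!: carrier_cases simp: t mact_KK[OF inv] mact_mact[OF A inv] B(2) id)
    show "?t g ` carrier ?F \<subseteq> carrier ?F"
      by (auto elim!: carrier_cases simp: t intro!: cls_carrier mact_KK[OF A])
    show "?t (tinv g) ` carrier ?F \<subseteq> carrier ?F"
      by (auto elim!: carrier_cases simp: t intro!: cls_carrier mact_KK[OF inv])
  qed
  note hom = field_hom_mact[OF mults_det[OF A]] and K = subfld_KK[of ?N]
  have "?t g \<in> ring_iso ?F ?F"
  proof (rule ring_iso_memI)
    show "?t g x \<in> carrier ?F" if "x \<in> carrier ?F" for x using bij that by (auto simp: bij_betw_def)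
    show "?t g (x \<otimes>\<^bsub>?F\<^esub> y) = ?t g x \<otimes>\<^bsub>?F\<^esub> ?t g y" if x: "x \<in> carrier ?F" and y: "y \<in> carrier ?F" for x y
    proof -
      obtain a where a: "a \<in> KK ?N" "x = cls ?N a" using x by (rule carrier_cases)
      obtain b where b: "b \<in> KK ?N" "y = cls ?N b" using y by (rule carrier_cases)
      show ?thesis
        using a b by (simp add: function_field_ops t mact_KK[OF A] subfld_mult[OF K] field_hom_mult[OF hom])
    qed
    show "?t g (x \<oplus>\<^bsub>?F\<^esub> y) = ?t g x \<oplus>\<^bsub>?F\<^esub> ?t g y" if x: "x \<in> carrier ?F" and y: "y \<in> carrier ?F" for x y
    proof -
      obtain a where a: "a \<in> KK ?N" "x = cls ?N a" using x by (rule carrier_cases)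
      obtain b where b: "b \<in> KK ?N" "y = cls ?N b" using y by (rule carrier_cases)
      show ?thesis
        using a b by (simp add: function_field_ops t mact_KK[OF A] subfld_add[OF K] field_hom_add[OF hom])
    qed
    show "?t g \<one>\<^bsub>?F\<^esub> = \<one>\<^bsub>?F\<^esub>"
      by (simp add: function_field_ops(1) t(1) subfld_1[OF K] field_hom_1[OF hom])
    show "bij_betw (?t g) (carrier ?F) (carrier ?F)" by (rule bij)
  qed
  moreover have "?t g x = x" if x: "x \<in> pulled_back_field ?X (weber_curve n) (weber_map m)" for x
  proof -
    obtain a where a: "a \<in> KK n" "x = cls ?N a" using x by (auto simp: pulled_back_field_weber[OF mn])
    then have "mact A a = a" by (intro mact_fixes_KK[OF mults_trivial[OF A mn g]])
    then show ?thesis using a KK_mono[OF mn] by (auto simp: t(1))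
  qed
  moreover have "?t g \<in> Bij (carrier ?F)"
    using bij by (simp add: Bij_def torus_field_aut_def)
  ultimately show ?thesis by (simp add: cover_galois_group_def)
qed

text \<open>A field automorphism over the base preserves the m-th powers of the generators, so it
  multiplies each generator by an m-th root of unity in \<open>mero\<close>, which is constant. That
  a matrix realises the triple follows only from compatibility, hence the conditional last
  clause.\<close>

lemma galois_element_compatible:
  assumes mn: "m * n dvd 24"
    and \<sigma>: "\<sigma> \<in> carrier (cover_galois_group (weber_curve (m * n)) (weber_curve n) (weber_map m))"
  shows "\<exists>g. (\<forall>i<3. coord3 g i ^ m = 1) \<and> compatible m n g \<and>
    (\<forall>A. mults (m * n) g A \<longrightarrow> \<sigma> = torus_field_aut (weber_curve (m * n)) g)"
proof -
  let ?N = "m * n"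
  let ?X = "weber_curve ?N"
  let ?F = "function_field ?X"
  note K = subfld_KK[of ?N]
  have m0: "m > 0" using div_24_mult(2)[OF mn] .
  have iso: "\<sigma> \<in> ring_iso ?F ?F" and ext: "\<sigma> \<in> extensional (carrier ?F)"
    and fix\<sigma>: "\<And>a. a \<in> KK n \<Longrightarrow> \<sigma> (cls ?N a) = cls ?N a"
    using \<sigma> by (auto simp: cover_galois_group_def Bij_def pulled_back_field_weber[OF mn])
  have "\<exists>b. b \<in> KK ?N \<and> \<sigma> (cls ?N a) = cls ?N b" if "a \<in> KK ?N" for a
    using ring_iso_memE(1)[OF iso cls_carrier[OF that]] by (auto elim: carrier_cases)
  then obtain \<phi> where \<phi>: "\<And>a. a \<in> KK ?N \<Longrightarrow> \<phi> a \<in> KK ?N" "\<And>a. a \<in> KK ?N \<Longrightarrow> \<sigma> (cls ?N a) = cls ?N (\<phi> a)"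
    by metis
  have add: "\<phi> (a + b) = \<phi> a + \<phi> b" if a: "a \<in> KK ?N" and b: "b \<in> KK ?N" for a b
  proof -
    have "cls ?N (\<phi> (a + b)) = cls ?N (\<phi> a + \<phi> b)"
      using ring_iso_memE(3)[OF iso cls_carrier[OF a] cls_carrier[OF b]]
      by (simp add: function_field_ops a b \<phi> subfld_add[OF K])
    then show ?thesis by (simp add: cls_eq_iff a b \<phi> subfld_add[OF K])
  qed
  have mult: "\<phi> (a * b) = \<phi> a * \<phi> b" if a: "a \<in> KK ?N" and b: "b \<in> KK ?N" for a b
  proof -
    have "cls ?N (\<phi> (a * b)) = cls ?N (\<phi> a * \<phi> b)"
      using ring_iso_memE(2)[OF iso cls_carrier[OF a] cls_carrier[OF b]]
      by (simp add: function_field_ops a b \<phi> subfld_mult[OF K])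
    then show ?thesis by (simp add: cls_eq_iff a b \<phi> subfld_mult[OF K])
  qed
  have fix\<phi>: "\<phi> a = a" if "a \<in> KK n" for a
    using fix\<sigma>[OF that] \<phi>[of a] KK_mono[OF mn] that cls_eq_iff[of a ?N "\<phi> a"] by auto
  have pow: "\<phi> (a ^ k) = \<phi> a ^ k" if "a \<in> KK ?N" for a k
    by (induction k) (use fix\<phi>[OF subfld_1[OF subfld_KK]] in \<open>simp_all add: mult that subfld_power[OF K]\<close>)
  have "\<exists>c. c ^ m = 1 \<and> \<phi> (xx ?N i) = cst c * xx ?N i" if i: "i < 3" for i
  proof -
    have "\<phi> (xx ?N i) ^ m = xx ?N i ^ m"
      using pow[OF xx_KK[OF i], of m] fix\<phi>[OF xx_KK[OF i]] by (simp add: xx_power[OF mn])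
    then have "(\<phi> (xx ?N i) / xx ?N i) ^ m = 1" using xx_nonzero[of ?N i] by (simp add: power_divide)
    then obtain c where "c ^ m = 1" "\<phi> (xx ?N i) / xx ?N i = cst c" using root_of_unity_constant[OF m0] by blast
    then show ?thesis using xx_nonzero[of ?N i] by (auto simp: divide_eq_eq)
  qed
  then obtain c where c: "\<And>i. i < 3 \<Longrightarrow> c i ^ m = 1" "\<And>i. i < 3 \<Longrightarrow> \<phi> (xx ?N i) = cst (c i) * xx ?N i" by metis
  define g where "g = (c 0, c 1, c 2)"
  have gc: "coord3 g i = c i" if "i < 3" for i using that by (auto simp: g_def less_3_cases)
  have x: "xx ?N i \<in> KK ?N" if "i < 3" for i by (rule xx_KK[OF that])
  have xg: "\<phi> (xx ?N i) = cst (coord3 g i) * xx ?N i" if "i < 3" for i using c(2)[OF that] gc[OF that] by simp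
  have "compatible m n g" unfolding compatible_def
  proof (intro conjI impI)
    have "\<phi> (xx ?N 0 * xx ?N 1 * xx ?N 2) = cst (of_real (sqrt 2) ^ (24 div ?N))"
      unfolding xx_mult by (rule fix\<phi>[OF cst_KK])
    moreover have "\<phi> (xx ?N 0 * xx ?N 1 * xx ?N 2) = \<phi> (xx ?N 0) * \<phi> (xx ?N 1) * \<phi> (xx ?N 2)"
      using x[of 0] x[of 1] x[of 2] by (simp add: mult subfld_mult[OF K])
    ultimately show "(cst (coord3 g 0) * xx ?N 0) * (cst (coord3 g 1) * xx ?N 1) * (cst (coord3 g 2) * xx ?N 2) =
       cst (of_real (sqrt 2) ^ (24 div ?N))" by (simp add: xg del: coord3.simps)
  next
    assume "m = 3"
    then have N: "?N = 3 * n" by simp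
    have "\<phi> (xx ?N 0 ^ n + xx ?N 1 ^ n + xx ?N 2 ^ n) = 0"
      using xx_sum[of n] mn fix\<phi>[OF subfld_0[OF subfld_KK]] by (simp add: N)
    moreover have "\<phi> (xx ?N 0 ^ n + xx ?N 1 ^ n + xx ?N 2 ^ n) = \<phi> (xx ?N 0) ^ n + \<phi> (xx ?N 1) ^ n + \<phi> (xx ?N 2) ^ n"
      using x[of 0] x[of 1] x[of 2] by (simp add: add pow subfld_add[OF K] subfld_power[OF K])
    ultimately show "(cst (coord3 g 0) * xx ?N 0) ^ n + (cst (coord3 g 1) * xx ?N 1) ^ n + (cst (coord3 g 2) * xx ?N 2) ^ n = 0"
      using xg[of 0] xg[of 1] xg[of 2] by (simp del: coord3.simps)
  qed
  moreover have "coord3 g i ^ m = 1" if "i < 3" for i using c(1)[OF that] gc[OF that] by simp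
  moreover have "\<sigma> = torus_field_aut ?X g" if A: "mults ?N g A" for A
  proof -
    note hom = field_hom_mact[OF mults_det[OF A]]
    \<comment> \<open>The elements on which the two homomorphisms agree form a subfield containing
      the generators.\<close>
    define L where "L = {a \<in> KK ?N. \<phi> a = mact A a}"
    have \<phi>1: "\<phi> 1 = 1" by (rule fix\<phi>[OF subfld_1[OF subfld_KK]])
    have \<phi>c: "\<phi> (cst c) = cst c" for c by (rule fix\<phi>[OF cst_KK])
    have "subfld L" unfolding subfld_def
    proof (intro conjI ballI)
      show "1 \<in> L" by (simp add: L_def subfld_1[OF K] \<phi>1 field_hom_1[OF hom])
      fix a assume "a \<in> L"
      then have a: "a \<in> KK ?N" "\<phi> a = mact A a" by (simp_all add: L_def)
      show "a + b \<in> L" "a * b \<in> L" if "b \<in> L" for b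
        using that a by (simp_all add: L_def add mult subfld_add[OF K] subfld_mult[OF K] field_hom_add[OF hom] field_hom_mult[OF hom])
      have "\<phi> (cst (- 1) * a) = cst (- 1) * \<phi> a" by (simp only: mult cst_KK a \<phi>c)
      then show "- a \<in> L"
        using a by (simp add: L_def subfld_minus[OF K] field_hom_minus[OF hom] cst_simps)
      show "inverse a \<in> L"
      proof (cases "a = 0")
        case True
        then show ?thesis using \<open>a \<in> L\<close> by simp
      next
        case False
        then have "\<phi> a * \<phi> (inverse a) = 1"
          using mult[OF a(1) subfld_inverse[OF K a(1)]] \<phi>1 by simp
        then show ?thesis using a subfld_inverse[OF K a(1)]
          by (simp add: L_def field_hom_inverse[OF hom] inverse_unique)
      qed
    qed
    moreover have "range cst \<union> {xx ?N 0, xx ?N 1, xx ?N 2} \<subseteq> L"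
      using xg mact_xx[OF A] x by (auto simp: L_def cst_KK \<phi>c mact_cst[OF mults_det[OF A]] simp del: coord3.simps)
    ultimately have "KK ?N \<subseteq> L" unfolding KK_def[of ?N] by (rule gen_least)
    then have eq: "\<sigma> (cls ?N a) = torus_field_aut ?X g (cls ?N a)" if "a \<in> KK ?N" for a
      using that \<phi>(2)[OF that] by (auto simp: torus_field_aut_cls[OF A] L_def)
    show ?thesis
    proof (rule extensionalityI[OF ext])
      show "torus_field_aut ?X g \<in> extensional (carrier ?F)" by (simp add: torus_field_aut_def)
      show "\<sigma> y = torus_field_aut ?X g y" if "y \<in> carrier ?F" for y
        using that eq by (auto elim!: carrier_cases)
    qed
  qed
  ultimately show ?thesis by blast
qed

lemma mult_cover_galois_group:
  assumes "f \<in> carrier (cover_galois_group X Y \<pi>)" "g \<in> carrier (cover_galois_group X Y \<pi>)"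
  shows "f \<otimes>\<^bsub>cover_galois_group X Y \<pi>\<^esub> g = compose (carrier (function_field X)) f g"
  using assms by (simp add: cover_galois_group_def BijGroup_def)

lemma torus_field_aut_iso:
  assumes mn: "m * n dvd 24" and m: "m = 3 \<or> m dvd 8"
  shows "torus_field_aut (weber_curve (m * n)) \<in>
    iso ((mu3 m)\<lparr>carrier := monodromy m n\<rparr>)
      (cover_galois_group (weber_curve (m * n)) (weber_curve n) (weber_map m))"
proof -
  let ?N = "m * n"
  let ?X = "weber_curve ?N"
  let ?t = "torus_field_aut ?X"
  let ?G = "cover_galois_group ?X (weber_curve n) (weber_map m)"
  have m0: "m > 0" using div_24_mult(2)[OF mn] .
  have car: "?t g \<in> carrier ?G" if g: "g \<in> monodromy m n" for g
    using torus_field_aut_carrier[OF mn monodromyD(1)[OF g m0]] monodromyD(2)[OF g m0] by blast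
  have "?t \<in> hom ((mu3 m)\<lparr>carrier := monodromy m n\<rparr>) ?G"
  proof (rule homI)
    show "?t g \<in> carrier ?G" if "g \<in> carrier ((mu3 m)\<lparr>carrier := monodromy m n\<rparr>)" for g
      using car that by simp
    fix g h assume "g \<in> carrier ((mu3 m)\<lparr>carrier := monodromy m n\<rparr>)" "h \<in> carrier ((mu3 m)\<lparr>carrier := monodromy m n\<rparr>)"
    then have gh: "g \<in> monodromy m n" "h \<in> monodromy m n" by simp_all
    from monodromyD(2)[OF gh(1) m0] monodromyD(2)[OF gh(2) m0]
    obtain A B where A: "mults ?N g A" and B: "mults ?N h B" by blast
    have "compose (carrier (function_field ?X)) (?t g) (?t h) = ?t (tmul g h)"
    proof (rule extensionalityI)
      show "?t (tmul g h) \<in> extensional (carrier (function_field ?X))" by (simp add: torus_field_aut_def)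
      fix y assume y: "y \<in> carrier (function_field ?X)"
      then obtain a where a: "a \<in> KK ?N" "y = cls ?N a" by (rule carrier_cases)
      have "?t g (?t h y) = ?t (tmul g h) y"
        unfolding a(2) torus_field_aut_cls[OF B a(1)] torus_field_aut_cls[OF A mact_KK[OF B a(1)]]
          torus_field_aut_cls[OF mults_mult[OF A B] a(1)] mact_mact[OF A B a(1)] ..
      then show "compose (carrier (function_field ?X)) (?t g) (?t h) y = ?t (tmul g h) y"
        using y by (simp add: compose_eq)
    qed simp
    then show "?t (g \<otimes>\<^bsub>(mu3 m)\<lparr>carrier := monodromy m n\<rparr>\<^esub> h) = ?t g \<otimes>\<^bsub>?G\<^esub> ?t h"
      by (simp add: mult_mu3 mult_cover_galois_group[OF car[OF gh(1)] car[OF gh(2)]])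
  qed
  moreover have "inj_on ?t (monodromy m n)"
  proof (rule inj_onI)
    fix g h assume g: "g \<in> monodromy m n" and h: "h \<in> monodromy m n" and eq: "?t g = ?t h"
    obtain A B where A: "mults ?N g A" and B: "mults ?N h B"
      using monodromyD(2)[OF g m0] monodromyD(2)[OF h m0] by blast
    have "coord3 g i = coord3 h i" if i: "i < 3" for i
    proof -
      have "cls ?N (mact A (xx ?N i)) = cls ?N (mact B (xx ?N i))"
        using fun_cong[OF eq, of "cls ?N (xx ?N i)"]
        by (simp only: torus_field_aut_cls[OF A xx_KK[OF i]] torus_field_aut_cls[OF B xx_KK[OF i]])
      then have "mact A (xx ?N i) = mact B (xx ?N i)"
        by (simp only: cls_eq_iff[OF mact_KK[OF A xx_KK[OF i]]])
      then show ?thesis using xx_nonzero[of ?N i] by (simp add: mact_xx[OF A i] mact_xx[OF B i] cst_simps)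
    qed
    then show "g = h" by (intro coord3_eqI) simp_all
  qed
  moreover have "carrier ?G \<subseteq> ?t ` monodromy m n"
  proof
    fix \<sigma> assume "\<sigma> \<in> carrier ?G"
    then obtain g where g: "\<And>i. i < 3 \<Longrightarrow> coord3 g i ^ m = 1" "compatible m n g"
      and eq: "\<And>A. mults ?N g A \<Longrightarrow> \<sigma> = ?t g"
      using galois_element_compatible[OF mn] by blast
    have "g \<in> monodromy m n" by (rule compatible_monodromy[OF mn m g])
    moreover from this have "\<sigma> = ?t g" using eq monodromyD(2)[OF _ m0] by blast
    ultimately show "\<sigma> \<in> ?t ` monodromy m n" by blast
  qed
  ultimately show ?thesis using car by (auto simp: iso_def bij_betw_def)
qed

lemma weber_is_quotient:
  assumes mn: "m * n dvd 24"
  shows "is_quotient_by (weber_curve (m * n)) (weber_curve n) (weber_map m)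
    (torus_aut (weber_curve (m * n)) ` monodromy m n)"
proof -
  let ?N = "m * n"
  let ?X = "weber_curve ?N"
  let ?S = "torus_aut ?X ` monodromy m n"
  let ?F = "function_field ?X"
  have m0: "m > 0" using div_24_mult(2)[OF mn] .
  note D = monodromyD[OF _ m0]
  interpret M: subgroup "monodromy m n" "mu3 m" by (rule subgroup_monodromy[OF m0])
  have "weber_curve n \<subseteq> zariski_closure (weber_map m ` ?X)"
  proof -
    have "weber_point n ` upper_half_plane \<subseteq> weber_map m ` ?X"
    proof safe
      fix \<tau> assume "\<tau> \<in> upper_half_plane"
      then show "weber_point n \<tau> \<in> weber_map m ` ?X"
        by (intro image_eqI[of _ _ "weber_point ?N \<tau>"])
          (simp_all add: weber_map_point[OF mn] weber_point_in_curve)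
    qed
    then show ?thesis unfolding weber_curve_def[of n] zariski_closure_def by blast
  qed
  moreover have "finite ?S"
  proof (rule finite_imageI)
    have "monodromy m n \<subseteq> {z. z ^ m = 1} \<times> {z. z ^ m = 1} \<times> {z. z ^ m = 1}"
      using m0 by (auto simp: monodromy_def mu3_def carrier_mu)
    then show "finite (monodromy m n)"
      by (rule finite_subset) (intro finite_cartesian_product; use m0 in \<open>simp add: finite_roots_unity\<close>)
  qed
  moreover have "subgroup ?S (aut_group ?X)"
  proof
    show sub: "?S \<subseteq> carrier (aut_group ?X)" using torus_aut_carrier D(2) by blast
    have mult: "torus_aut ?X g \<otimes>\<^bsub>aut_group ?X\<^esub> torus_aut ?X h = torus_aut ?X (tmul g h)"
      if "g \<in> monodromy m n" "h \<in> monodromy m n" for g h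
      using torus_aut_mult D(2)[OF that(1)] D(2)[OF that(2)] by blast
    show "x \<otimes>\<^bsub>aut_group ?X\<^esub> y \<in> ?S" if "x \<in> ?S" "y \<in> ?S" for x y
      using that mult M.m_closed by (auto simp: mult_mu3)
    show "\<one>\<^bsub>aut_group ?X\<^esub> \<in> ?S"
      using M.one_closed torus_aut_one[of ?N] by (metis image_eqI one_mu3)
    fix x assume "x \<in> ?S"
    then obtain g where g: "g \<in> monodromy m n" "x = torus_aut ?X g" by blast
    then have g': "tinv g \<in> monodromy m n" using M.m_inv_closed inv_mu3[OF m0] M.subset by (metis subsetD)
    obtain A where A: "mults ?N g A" using D(2)[OF g(1)] by blast
    define y where "y = torus_aut ?X (tinv g)"
    have y: "y \<in> carrier (aut_group ?X)" "x \<otimes>\<^bsub>aut_group ?X\<^esub> y = \<one>\<^bsub>aut_group ?X\<^esub>" "y \<otimes>\<^bsub>aut_group ?X\<^esub> x = \<one>\<^bsub>aut_group ?X\<^esub>"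
      using sub g g' by (auto simp: y_def mult tmul_tinv[OF mults_nonzero[OF A]] torus_aut_one)
    \<comment> \<open>Multiplication and unit of \<open>aut_group\<close> are those of the group of
      all bijections of the curve, in which inverses are unique.\<close>
    interpret B: group "BijGroup ?X" by (rule group_BijGroup)
    have "inv\<^bsub>aut_group ?X\<^esub> x = y" unfolding m_inv_def
    proof (rule the_equality)
      fix z assume z: "z \<in> carrier (aut_group ?X) \<and> x \<otimes>\<^bsub>aut_group ?X\<^esub> z = \<one>\<^bsub>aut_group ?X\<^esub> \<and> z \<otimes>\<^bsub>aut_group ?X\<^esub> x = \<one>\<^bsub>aut_group ?X\<^esub>"
      have "x \<in> carrier (aut_group ?X)" using sub \<open>x \<in> ?S\<close> by blast
      then have "x \<in> carrier (BijGroup ?X)" "y \<in> carrier (BijGroup ?X)" "z \<in> carrier (BijGroup ?X)"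
        using y z by (auto simp: aut_group_def BijGroup_def)
      then show "z = y" using y(2) z B.inv_unique[of z x y] by (simp add: aut_group_def)
    qed (use y in blast)
    then show "inv\<^bsub>aut_group ?X\<^esub> x \<in> ?S" using g' by (simp add: y_def)
  qed
  moreover have "\<forall>\<sigma>\<in>?S. \<forall>x\<in>?X. weber_map m (\<sigma> x) = weber_map m x"
    using weber_map_torus[OF m0 D(1)] by (auto simp: torus_aut_def simp del: torus_act.simps)
  moreover have "pulled_back_field ?X (weber_curve n) (weber_map m) =
      {A \<in> carrier ?F. \<forall>\<sigma>\<in>?S. pullback ?X \<sigma> A = A}"
  proof -
    have act: "pullback ?X (torus_aut ?X g) (cls ?N a) = cls ?N (mact A a)" if "mults ?N g A" "a \<in> KK ?N" for g A a
      by (rule comorph_pullback[OF comorph_torus_aut[OF that(1)] that(2)])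
    have iff: "(\<forall>\<sigma>\<in>?S. pullback ?X \<sigma> (cls ?N a) = cls ?N a) \<longleftrightarrow> a \<in> KK n" if a: "a \<in> KK ?N" for a
    proof
      assume inv: "\<forall>\<sigma>\<in>?S. pullback ?X \<sigma> (cls ?N a) = cls ?N a"
      show "a \<in> KK n"
      proof (rule fixed_field[OF mn a])
        fix A assume A: "mults n (1, 1, 1) A"
        \<comment> \<open>Every matrix of level n acts through an element of the monodromy group, so
          invariance under the latter suffices.\<close>
        obtain g where g: "\<forall>i<3. coord3 g i ^ m = 1" "mults ?N g A" using mults_exists[OF A mn] by blast
        then have "g \<in> monodromy m n" using carrier_mu3[OF m0] by (auto simp: monodromy_def)
        with inv have "cls ?N (mact A a) = cls ?N a" using act[OF g(2) a] by auto
        then show "mact A a = a" by (simp only: cls_eq_iff[OF mact_KK[OF g(2) a]])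
      qed
    next
      assume "a \<in> KK n"
      then have "mact A a = a" if "g \<in> monodromy m n" "mults ?N g A" for g A
        using mact_fixes_KK[OF mults_trivial[OF that(2) mn D(1)[OF that(1)]]] by blast
      then show "\<forall>\<sigma>\<in>?S. pullback ?X \<sigma> (cls ?N a) = cls ?N a"
        using act[OF _ a] D(2) by fastforce
    qed
    show ?thesis
      unfolding pulled_back_field_weber[OF mn] carrier_function_field using iff KK_mono[OF mn] by auto
  qed
  ultimately show ?thesis
    unfolding is_quotient_by_def using comorph_morphism[OF comorph_weber_map[OF mn]] by blast
qed

section \<open>Dimension and degree\<close>

lemma subfield_cls:
  assumes L: "subfld L" and sub: "L \<subseteq> KK N"
  shows "subfield (cls N ` L) (function_field (weber_curve N))"
proof -
  let ?R = "function_field (weber_curve N)"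
  interpret field ?R by (rule field_function_field)
  note ops = function_field_ops[where N = N]
  have neg: "\<ominus>\<^bsub>?R\<^esub> (cls N a) = cls N (- a)" if "a \<in> L" for a
    by (rule minus_equality)
      (use that sub subfld_minus[OF subfld_KK] in \<open>auto simp: ops cls_carrier subset_iff\<close>)
  have inv: "inv\<^bsub>?R\<^esub> (cls N a) = cls N (inverse a)" if "a \<in> L" "a \<noteq> 0" for a
  proof (rule inv_char[symmetric, THEN sym])
    have "a \<in> KK N" "inverse a \<in> KK N" using that sub subfld_inverse[OF subfld_KK] by auto
    then show "cls N a \<in> carrier ?R" "cls N (inverse a) \<in> carrier ?R"
      "cls N a \<otimes>\<^bsub>?R\<^esub> cls N (inverse a) = \<one>\<^bsub>?R\<^esub>" "cls N (inverse a) \<otimes>\<^bsub>?R\<^esub> cls N a = \<one>\<^bsub>?R\<^esub>"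
      using that by (simp_all add: ops cls_carrier)
  qed
  show ?thesis
  proof (rule subfieldI')
    show "subring (cls N ` L) ?R"
    proof (rule subringI)
      show "cls N ` L \<subseteq> carrier ?R" using sub by (auto intro: cls_carrier)
      show "\<one>\<^bsub>?R\<^esub> \<in> cls N ` L" using subfld_1[OF L] by (simp add: ops)
      show "\<ominus>\<^bsub>?R\<^esub> h \<in> cls N ` L" if "h \<in> cls N ` L" for h
        using that neg subfld_minus[OF L] by auto
      show "h1 \<otimes>\<^bsub>?R\<^esub> h2 \<in> cls N ` L" "h1 \<oplus>\<^bsub>?R\<^esub> h2 \<in> cls N ` L" if "h1 \<in> cls N ` L" "h2 \<in> cls N ` L" for h1 h2
        using that sub subfld_mult[OF L] subfld_add[OF L] by (auto simp: ops subset_iff)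
    qed
    show "inv\<^bsub>?R\<^esub> k \<in> cls N ` L" if k: "k \<in> cls N ` L - {\<zero>\<^bsub>?R\<^esub>}" for k
    proof -
      obtain a where a: "a \<in> L" "k = cls N a" using k by blast
      then have "a \<noteq> 0" using k by (auto simp only: ops)
      then show ?thesis using inv[OF a(1)] subfld_inverse[OF L a(1)] a(2) by simp
    qed
  qed
qed

text \<open>Each power y^k with k < m lies outside the span of the preceding ones, so the dimension
  grows by one with every power until m is reached.\<close>

lemma kummer_dimension:
  assumes "kummer L y \<omega> m \<sigma>" and sub: "L \<subseteq> KK N" and y: "y \<in> KK N"
  shows "ring.dimension (function_field (weber_curve N)) m (cls N ` L) (cls N ` gen (insert y L))"
proof -
  let ?R = "function_field (weber_curve N)"
  interpret K: kummer L y \<omega> m \<sigma> by fact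
  interpret field ?R by (rule field_function_field)
  note ops = function_field_ops[where N = N] and KN = subfld_KK[of N]
  have yk: "y ^ k \<in> KK N" for k using y by (rule subfld_power[OF KN])
  have lin: "K.lin k \<subseteq> KK N" for k
    using sub yk by (auto simp: K.lin_def intro!: subfld_sum[OF KN] subfld_mult[OF KN])
  have "dimension k (cls N ` L) (cls N ` K.lin k)" if "k \<le> m" for k
    using that
  proof (induction k)
    case 0
    have "K.lin 0 = {0}" using subfld_0[OF K.L] by (auto simp: K.lin_def)
    then show ?case using zero_dim by (simp add: ops)
  next
    case (Suc k)
    have "cls N (y ^ k) \<notin> cls N ` K.lin k"
      using K.power_notin_lin[of k] Suc.prems cls_eq_iff[OF yk] by auto
    then have "dimension (Suc k) (cls N ` L) (line_extension (cls N ` L) (cls N (y ^ k)) (cls N ` K.lin k))"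
      using Suc by (intro Suc_dim cls_carrier yk) auto
    moreover have "line_extension (cls N ` L) (cls N (y ^ k)) (cls N ` K.lin k) = cls N ` K.lin (Suc k)"
    proof -
      have eq: "cls N c \<otimes>\<^bsub>?R\<^esub> cls N (y ^ k) \<oplus>\<^bsub>?R\<^esub> cls N a = cls N (c * y ^ k + a)" if "c \<in> L" "a \<in> K.lin k" for c a
        using that sub lin[of k] yk by (simp add: ops subset_iff subfld_mult[OF KN])
      show ?thesis
        unfolding K.lin_Suc by (rule Set.set_eqI) (auto simp: line_extension_mem_iff eq; metis eq imageI)
    qed
    ultimately show ?case by simp
  qed
  then show ?thesis using K.lin_eq_gen by (metis order_refl)
qed

text \<open>One Kummer step for m = 3; for m dividing 8, multiplicativity of the degree in a tower
  of two Kummer steps.\<close>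

lemma weber_degree:
  assumes mn: "m * n dvd 24"
  shows "m = 3 \<Longrightarrow> has_degree (weber_curve (m * n)) (weber_curve n) (weber_map m) 3"
    and "m dvd 8 \<Longrightarrow> has_degree (weber_curve (m * n)) (weber_curve n) (weber_map m) (m ^ 2)"
proof -
  assume "m = 3"
  then have 3: "3 * n dvd 24" using mn by simp
  obtain A where "kummer (KK n) (xx (3 * n) 0) (cst (\<zeta> 3)) 3 (mact A)" using kummer_3[OF 3] by metis
  from kummer_dimension[OF this KK_mono[OF 3] xx_KK]
  show "has_degree (weber_curve (m * n)) (weber_curve n) (weber_map m) 3"
    by (simp add: \<open>m = 3\<close> has_degree_def pulled_back_field_weber[OF 3] carrier_function_field KK_3[OF 3])
next
  assume m: "m dvd 8"
  let ?N = "m * n"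
  let ?L = "gen (insert (xx ?N 0) (KK n))"
  obtain A B where AB: "kummer (KK n) (xx ?N 0) (cst (\<zeta> m)) m (mact A)"
    "kummer ?L (xx ?N 1) (cst (\<zeta> m)) m (mact B)" using kummer_8[OF mn m] by metis
  interpret field "function_field (weber_curve ?N)" by (rule field_function_field)
  have L: "?L \<subseteq> KK ?N"
    using KK_mono[OF mn] xx_KK[of 0 ?N] by (intro gen_least subfld_KK) auto
  have "dimension (m * m) (cls ?N ` KK n) (cls ?N ` gen (insert (xx ?N 1) ?L))"
    by (rule telescopic_base[OF subfield_cls[OF subfld_KK KK_mono[OF mn]] subfield_cls[OF subfld_gen L]
          kummer_dimension[OF AB(1) KK_mono[OF mn] xx_KK] kummer_dimension[OF AB(2) L xx_KK]]) simp_all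
  then show "has_degree (weber_curve (m * n)) (weber_curve n) (weber_map m) (m ^ 2)"
    by (simp add: has_degree_def pulled_back_field_weber[OF mn] carrier_function_field KK_two_step[OF mn] power2_eq_square)
qed

theorem proposition5:
  fixes m n :: nat
  assumes "0 < m" and "0 < n" and "m * n dvd 24"
  shows "(\<exists>G. subgroup G (mu3 m) \<and>
            inj_on (torus_aut (weber_curve (m * n))) G \<and>
            is_quotient_by (weber_curve (m * n)) (weber_curve n) (weber_map m)
              (torus_aut (weber_curve (m * n)) ` G) \<and>
            (mu3 m)\<lparr>carrier := G\<rparr> \<cong>
              (PSL2Z\<lparr>carrier := Gamma_weber n\<rparr>) Mod (Gamma_weber (m * n))) \<and>
         (m = 3 \<longrightarrow>
            torus_aut (weber_curve (m * n)) \<in>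
              iso ((mu3 3)\<lparr>carrier := diagonal 3\<rparr>)
                  (cover_aut_group (weber_curve (m * n)) (weber_map m)) \<and>
            torus_field_aut (weber_curve (m * n)) \<in>
              iso ((mu3 3)\<lparr>carrier := diagonal 3\<rparr>)
                  (cover_galois_group (weber_curve (m * n)) (weber_curve n) (weber_map m))) \<and>
         (m dvd 8 \<longrightarrow>
            torus_aut (weber_curve (m * n)) \<in>
              iso ((mu3 m)\<lparr>carrier := nabla m\<rparr>)
                  (cover_aut_group (weber_curve (m * n)) (weber_map m)) \<and>
            torus_field_aut (weber_curve (m * n)) \<in>
              iso ((mu3 m)\<lparr>carrier := nabla m\<rparr>)
                  (cover_galois_group (weber_curve (m * n)) (weber_curve n) (weber_map m))) \<and>
         (m = 3 \<longrightarrow> has_degree (weber_curve (m * n)) (weber_curve n) (weber_map m) 3) \<and>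
         (m dvd 8 \<longrightarrow> has_degree (weber_curve (m * n)) (weber_curve n) (weber_map m) (m ^ 2))"
proof -
  note mn = assms(3)
  \<comment> \<open>For every m, including multiples of 6, the required subgroup is
    \<open>monodromy m n\<close>; it is identified explicitly only for m = 3 and for m dividing
    8.\<close>
  have "inj_on (torus_aut (weber_curve (m * n))) (monodromy m n)"
    by (rule inj_onI) (use torus_aut_inj monodromyD(2)[OF _ assms(1)] in blast)
  then have "\<exists>G. subgroup G (mu3 m) \<and>
            inj_on (torus_aut (weber_curve (m * n))) G \<and>
            is_quotient_by (weber_curve (m * n)) (weber_curve n) (weber_map m)
              (torus_aut (weber_curve (m * n)) ` G) \<and>
            (mu3 m)\<lparr>carrier := G\<rparr> \<cong>
              (PSL2Z\<lparr>carrier := Gamma_weber n\<rparr>) Mod (Gamma_weber (m * n))"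
    using subgroup_monodromy[OF assms(1)] weber_is_quotient[OF mn] monodromy_iso[OF mn] by blast
  moreover have "torus_aut (weber_curve (m * n)) \<in>
      iso ((mu3 3)\<lparr>carrier := diagonal 3\<rparr>) (cover_aut_group (weber_curve (m * n)) (weber_map m)) \<and>
    torus_field_aut (weber_curve (m * n)) \<in>
      iso ((mu3 3)\<lparr>carrier := diagonal 3\<rparr>)
        (cover_galois_group (weber_curve (m * n)) (weber_curve n) (weber_map m))" if "m = 3"
    using torus_aut_iso[OF mn disjI1[OF that]] torus_field_aut_iso[OF mn disjI1[OF that]]
      monodromy_diagonal[of n] mn that by simp
  moreover have "torus_aut (weber_curve (m * n)) \<in>
      iso ((mu3 m)\<lparr>carrier := nabla m\<rparr>) (cover_aut_group (weber_curve (m * n)) (weber_map m)) \<and>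
    torus_field_aut (weber_curve (m * n)) \<in>
      iso ((mu3 m)\<lparr>carrier := nabla m\<rparr>)
        (cover_galois_group (weber_curve (m * n)) (weber_curve n) (weber_map m))" if "m dvd 8"
    using torus_aut_iso[OF mn disjI2[OF that]] torus_field_aut_iso[OF mn disjI2[OF that]]
    unfolding monodromy_nabla[OF mn that] by blast
  ultimately show ?thesis using weber_degree[OF mn] by blast
qed

end
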